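(* Let $\rho:\mathbb{R}\to \mathcal{PAC}_{+}(S^{1})$ be a continuous group homomorphism, where $\mathcal{PAC}_+(S^1)$ carries the distance $d$. Then there exist a domain $\mathcal{D}$ (a finite disjoint union of circles) and an interval exchange transformation $f\in \mathrm{IET}(S^{1},\mathcal{D})$ such that the map $\hat\rho:\mathbb{R}\to \mathcal{PAC}_{+}(\mathcal{D})$ defined by $\hat\rho(t)=f\circ\rho(t)\circ f^{-1}$ is a continuous homomorphism (with respect to the distance $d_{\mathcal D}$) and, for every $t\in\mathbb{R}$, the map $\hat\rho(t):\mathcal{D}\to\mathcal{D}$ is continuous.
   Context: For $l>0$ let $(S^{1})_l=\mathbb{R}/l\mathbb{Z}$ with canonical projection $\pi_l:\mathbb{R}\to (S^1)_l$, the induced distance $\mathfrak{d}_l$, the measure $\mu_l$ generated by it (Lebesgue measure of total mass $l$), and the counterclockwise orientation; for $l=1$ the index is omitted. For $a\neq b$ in $(S^1)_l$, $[a,b]$ denotes $\pi_l([\hat a,\hat b])$, where $\hat a<\hat b$ are lifts of $a,b$ with $\pi_l([\hat a,\hat b])\neq (S^1)_l$; $[a,b)$, $(a,b]$, $(a,b)$ are defined in the same way. A bijection $f:S^1\to S^1$ is called right piecewise absolutely continuous if: (1) $f$ is right-continuous; (2) the set of discontinuities of $f$ is finite; (3) whenever the restriction of $f$ to $[a,b)$ is continuous, $f$ is absolutely continuous on $[a,b)$, meaning that, for some $\hat c\in\mathbb{R}$, the composition of $f\circ\pi|_{[\hat a,\hat b)}$ with the inverse of the bijection $\pi|_{[\hat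 c,\hat c+1)}$ is an absolutely continuous real function on $[\hat a,\hat b)$; (4) whenever the restriction of $f$ to $[a,b]$ is continuous, $f([a,b))=[f(a),f(b))$. $\mathcal{PAC}_+(S^1)$ is the group (under composition) of all bijections $f$ of $S^1$ such that $f$ and $f^{-1}$ are right piecewise absolutely continuous, with the distance $$d(f,g)=\int_{S^1}\mathfrak{d}(f(x),g(x))\,d\mu+\int_{S^1}\mathfrak{d}(f^{-1}(x),g^{-1}(x))\,d\mu .$$ A domain is a finite disjoint union of circles $\mathcal{D}=\biguplus_{i\le n}(S^1)_{\lambda_i}$; each component carries its natural metric, measure and orientation. The distance $\mathfrak{d}_{\mathcal D}(x,y)$ is $\mathfrak{d}_{\lambda_j}(x,y)$ if $x,y$ lie in the same component $(S^1)_{\lambda_j}$ and $\sum_{i\le n}\lambda_i$ otherwise. An interval exchange transformation $h:\mathcal{D}\to\mathcal{D}'$ between domains is a bijection which is piecewise isometric, orientation-preserving, right-continuous and has only finitely many discontinuity points; the set of these is $\mathrm{IET}(\mathcal{D},\mathcal{D}')$. The group $\mathcal{PAC}_+(\mathcal{D})$ is defined exactly as $\mathcal{PAC}_+(S^1)$, with $S^1$ replaced by $\mathcal{D}$ (intervals being intervals inside a component), and the distance $d_{\mathcal D}$ on it is defined as $d$, using $\mathfrak{d}_{\mathcal D}$ and the natural measure of $\mathcal{D}$. *)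

theory Defs
  imports "HOL-Analysis.Analysis" "HOL-Algebra.Bij"
begin

section \<open>Circles and domains\<close>

definition circle_proj :: "real \<Rightarrow> real \<Rightarrow> real set" where
  "circle_proj l x = range (\<lambda>k::int. x + of_int k * l)"

definition circle :: "real \<Rightarrow> real set set" where
  "circle l = range (circle_proj l)"

text \<open>A domain is encoded by the list of the lengths of its components. A point is a pair of the
  index of its component and an element of that component, i.e. a coset in the quotient of the
  reals by the multiples of the length; the elements of this coset are the lifts of the point.\<close>

type_synonym domain_lengths = "real list"
type_synonym point = "nat \<times> real set"

definition is_domain :: "domain_lengths \<Rightarrow> bool" where
  "is_domain D \<longleftrightarrow> (\<forall>l\<in>set D. 0 < l)"

abbreviation unit_circle :: domain_lengths where
  "unit_circle \<equiv> [1]"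

definition points :: "domain_lengths \<Rightarrow> point set" where
  "points D = (SIGMA i:{..<length D}. circle (D ! i))"

definition dom_proj :: "domain_lengths \<Rightarrow> nat \<Rightarrow> real \<Rightarrow> point" where
  "dom_proj D i x = (i, circle_proj (D ! i) x)"

text \<open>The quotient distance of two points of the same circle is the distance of the two cosets as
  subsets of the real line.\<close>

definition dom_dist :: "domain_lengths \<Rightarrow> point \<Rightarrow> point \<Rightarrow> real" where
  "dom_dist D p q = (if fst p = fst q then setdist (snd p) (snd q) else sum_list D)"

definition dom_top :: "domain_lengths \<Rightarrow> point topology" where
  "dom_top D = Metric_space.mtopology (points D) (dom_dist D)"

lemma circle_proj_shift: "y \<in> circle_proj l x \<Longrightarrow> y + of_int k * l \<in> circle_proj l x"
proof -
  assume "y \<in> circle_proj l x"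
  then obtain m :: int where "y = x + of_int m * l"
    by (auto simp: circle_proj_def)
  then have "y + of_int k * l = x + of_int (m + k) * l"
    by (simp add: algebra_simps)
  then show ?thesis
    unfolding circle_proj_def by blast
qed

lemma circle_proj_diff:
  assumes "y \<in> circle_proj l x" "z \<in> circle_proj l x"
  obtains k :: int where "z = y + of_int k * l"
proof -
  obtain m n :: int where "y = x + of_int m * l" "z = x + of_int n * l"
    using assms by (auto simp: circle_proj_def)
  then have "z = y + of_int (n - m) * l"
    by (simp add: algebra_simps)
  then show ?thesis
    using that by blast
qed

lemma circle_proj_self: "x \<in> circle_proj l x"
proof -
  have "x = x + of_int 0 * l" by simp
  then show ?thesis unfolding circle_proj_def by blast
qed

lemma circle_proj_eq: "y \<in> circle_proj l x \<Longrightarrow> circle_proj l y = circle_proj l x"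
proof (intro equalityI subsetI)
  fix z assume y: "y \<in> circle_proj l x"
  {
    assume "z \<in> circle_proj l y"
    then obtain k :: int where "z = y + of_int k * l" by (auto simp: circle_proj_def)
    then show "z \<in> circle_proj l x" using circle_proj_shift[OF y] by simp
  next
    assume "z \<in> circle_proj l x"
    then obtain k :: int where "z = y + of_int k * l" using circle_proj_diff[OF y] by blast
    then show "z \<in> circle_proj l y" by (auto simp: circle_proj_def)
  }
qed

lemma setdist_circle_triangle:
  "setdist (circle_proj l x) (circle_proj l z)
     \<le> setdist (circle_proj l x) (circle_proj l y) + setdist (circle_proj l y) (circle_proj l z)"
  (is "setdist ?X ?Z \<le> setdist ?X ?Y + setdist ?Y ?Z")
proof (rule field_le_epsilon)
  fix e :: real assume "0 < e"
  have ne: "?X \<noteq> {}" "?Y \<noteq> {}" "?Z \<noteq> {}"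
    using circle_proj_self by blast+
  obtain a b where ab: "a \<in> ?X" "b \<in> ?Y" "dist a b < setdist ?X ?Y + e / 2"
    using setdist_ltE[of ?X ?Y "setdist ?X ?Y + e / 2"] ne \<open>0 < e\<close> by auto
  obtain c d where cd: "c \<in> ?Y" "d \<in> ?Z" "dist c d < setdist ?Y ?Z + e / 2"
    using setdist_ltE[of ?Y ?Z "setdist ?Y ?Z + e / 2"] ne \<open>0 < e\<close> by auto
  obtain k :: int where k: "b = c + of_int k * l"
    using circle_proj_diff[OF cd(1) ab(2)] by blast
  have "setdist ?X ?Z \<le> dist a (d + of_int k * l)"
    by (intro setdist_le_dist ab circle_proj_shift cd)
  also have "\<dots> \<le> dist a b + dist c d"
    unfolding k dist_real_def by linarith
  also have "\<dots> \<le> setdist ?X ?Y + setdist ?Y ?Z + e"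
    using ab(3) cd(3) by linarith
  finally show "setdist ?X ?Z \<le> setdist ?X ?Y + setdist ?Y ?Z + e" .
qed

lemma setdist_circle_le:
  assumes "0 < l"
  shows "setdist (circle_proj l x) (circle_proj l y) \<le> l"
proof -
  define k where "k = \<lfloor>(x - y) / l\<rfloor>"
  have "of_int k \<le> (x - y) / l" "(x - y) / l < of_int k + 1"
    unfolding k_def by linarith+
  then have "of_int k * l \<le> x - y" "x - y < of_int k * l + l"
    using assms by (auto simp: field_simps)
  then have "dist x (y + of_int k * l) \<le> l"
    unfolding dist_real_def by linarith
  moreover have "setdist (circle_proj l x) (circle_proj l y) \<le> dist x (y + of_int k * l)"
    by (intro setdist_le_dist circle_proj_shift circle_proj_self)
  ultimately show ?thesis by linarith
qed

lemma setdist_circle_zero: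
  assumes "0 < l" "setdist (circle_proj l x) (circle_proj l y) = 0"
  shows "circle_proj l x = circle_proj l y"
proof -
  have ex: "\<exists>k::int. \<bar>x - (y + of_int k * l)\<bar> < e" if "0 < e" for e
  proof -
    have ne: "circle_proj l x \<noteq> {}" "circle_proj l y \<noteq> {}"
      using circle_proj_self by blast+
    have "setdist (circle_proj l x) (circle_proj l y) < e"
      using assms \<open>0 < e\<close> by simp
    from setdist_ltE[OF this ne]
    obtain a b where ab: "a \<in> circle_proj l x" "b \<in> circle_proj l y" "dist a b < e"
      by blast
    obtain m n :: int where "a = x + of_int m * l" "b = y + of_int n * l"
      using ab by (auto simp: circle_proj_def)
    then have "\<bar>x - (y + of_int (n - m) * l)\<bar> < e"
      using ab(3) by (simp add: dist_real_def algebra_simps)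
    then show ?thesis by blast
  qed
  obtain k :: int where k: "\<bar>x - (y + of_int k * l)\<bar> < l / 2"
    using ex[of "l / 2"] assms by auto
  have "x = y + of_int k * l"
  proof (rule ccontr)
    assume "x \<noteq> y + of_int k * l"
    then have "0 < min (l / 2) \<bar>x - (y + of_int k * l)\<bar>"
      using assms by simp
    from ex[OF this] obtain n :: int
      where n: "\<bar>x - (y + of_int n * l)\<bar> < min (l / 2) \<bar>x - (y + of_int k * l)\<bar>"
      by blast
    have "\<bar>of_int n * l - of_int k * l\<bar> < l"
      using k n by linarith
    also have "of_int n * l - of_int k * l = of_int (n - k) * l"
      by (simp add: algebra_simps)
    finally have "\<bar>real_of_int (n - k)\<bar> < 1"
      using assms by (simp add: abs_mult)
    then have "n = k" by linarith
    then show False using n by simp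
  qed
  then have "x \<in> circle_proj l y" by (auto simp: circle_proj_def)
  then show ?thesis by (rule circle_proj_eq)
qed

lemma Metric_space_domain:
  assumes "is_domain D"
  shows "Metric_space (points D) (dom_dist D)"
proof
  have nonneg: "0 \<le> sum_list D"
    using assms by (intro sum_list_nonneg) (auto simp: is_domain_def less_imp_le)
  show "0 \<le> dom_dist D p q" for p q
    using nonneg by (simp add: dom_dist_def)
  show "dom_dist D p q = dom_dist D q p" for p q
    by (simp add: dom_dist_def setdist_sym)
  have D_pos: "0 < D ! i" if "i < length D" for i
    using assms that by (simp add: is_domain_def)
  have D_le: "D ! i \<le> sum_list D" if "i < length D" for i
  proof -
    have "D ! i \<le> (\<Sum>j\<in>{0..<length D}. D ! j)"
      using that D_pos by (intro member_le_sum) (auto simp: less_imp_le)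
    then show ?thesis by (simp add: sum_list_sum_nth)
  qed
  show "dom_dist D p q = 0 \<longleftrightarrow> p = q" if pq: "p \<in> points D" "q \<in> points D" for p q
  proof
    assume zero: "dom_dist D p q = 0"
    obtain i x where p: "p = (i, circle_proj (D ! i) x)" "i < length D"
      using pq by (auto simp: points_def circle_def)
    obtain j y where q: "q = (j, circle_proj (D ! j) y)" "j < length D"
      using pq by (auto simp: points_def circle_def)
    have "i = j"
      using zero p q D_pos[of i] D_le[of i] by (auto simp: dom_dist_def split: if_splits)
    then show "p = q"
      using zero p q D_pos[of i] setdist_circle_zero[of "D ! i" x y] by (simp add: dom_dist_def)
  next
    assume "p = q"
    then show "dom_dist D p q = 0" by (simp add: dom_dist_def setdist_refl)
  qed
  show "dom_dist D p r \<le> dom_dist D p q + dom_dist D q r"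
    if pqr: "p \<in> points D" "q \<in> points D" "r \<in> points D" for p q r
  proof -
    obtain i x where p: "p = (i, circle_proj (D ! i) x)" "i < length D"
      using pqr by (auto simp: points_def circle_def)
    obtain j y where q: "q = (j, circle_proj (D ! j) y)" "j < length D"
      using pqr by (auto simp: points_def circle_def)
    obtain k z where r: "r = (k, circle_proj (D ! k) z)" "k < length D"
      using pqr by (auto simp: points_def circle_def)
    note tri = setdist_circle_triangle[of "D ! i" x z y]
    note le = setdist_circle_le[OF D_pos[OF p(2)], of x z] D_le[OF p(2)]
    consider "i = j" "j = k" | "i = k" "i \<noteq> j" | "i \<noteq> k" "i = j" | "i \<noteq> k" "i \<noteq> j"
      by blast
    then show ?thesis
    proof cases
      case 1
      then show ?thesis using p q r tri by (simp add: dom_dist_def)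
    next
      case 2
      then have "dom_dist D p r \<le> D ! i" "dom_dist D p q = sum_list D" "dom_dist D q r = sum_list D"
        using p q r le by (simp_all add: dom_dist_def)
      then show ?thesis using le nonneg by linarith
    next
      case 3
      then have "dom_dist D p r = sum_list D" "0 \<le> dom_dist D p q" "dom_dist D q r = sum_list D"
        using p q r by (simp_all add: dom_dist_def)
      then show ?thesis by linarith
    next
      case 4
      then have "dom_dist D p r = sum_list D" "dom_dist D p q = sum_list D" "0 \<le> dom_dist D q r"
        using p q r nonneg by (simp_all add: dom_dist_def)
      then show ?thesis by linarith
    qed
  qed
qed

text \<open>Admissible lifts of the end points of an interval inside a component: \<open>a < b\<close>, and the
  interval does not cover the whole component. The half-open interval between the two points is
  then \<open>dom_proj D i ` {a..<b}\<close>.\<close>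

definition interval_lifts :: "domain_lengths \<Rightarrow> nat \<Rightarrow> real \<Rightarrow> real \<Rightarrow> bool" where
  "interval_lifts D i a b \<longleftrightarrow>
     i < length D \<and> a < b \<and> circle_proj (D ! i) ` {a..b} \<noteq> circle (D ! i)"

text \<open>The interval \<open>[p, q)\<close>. For distinct points of one component all admissible lifts
  yield the same set; otherwise there are no admissible lifts and the union is empty.\<close>

definition interval_co :: "domain_lengths \<Rightarrow> point \<Rightarrow> point \<Rightarrow> point set" where
  "interval_co D p q =
     \<Union> {dom_proj D i ` {a..<b} | i a b.
           interval_lifts D i a b \<and> dom_proj D i a = p \<and> dom_proj D i b = q}"


section \<open>Maps between domains\<close>

definition right_continuous :: "domain_lengths \<Rightarrow> domain_lengths \<Rightarrow> (point \<Rightarrow> point) \<Rightarrow> bool" where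
  "right_continuous D D' f \<longleftrightarrow>
     (\<forall>i<length D. \<forall>x.
        limitin (dom_top D') (\<lambda>y. f (dom_proj D i y)) (f (dom_proj D i x)) (at_right x))"

definition discontinuities :: "domain_lengths \<Rightarrow> domain_lengths \<Rightarrow> (point \<Rightarrow> point) \<Rightarrow> point set" where
  "discontinuities D D' f = {p \<in> points D. \<not> topcontinuous_at (dom_top D) (dom_top D') f p}"

definition restriction_continuous ::
  "domain_lengths \<Rightarrow> domain_lengths \<Rightarrow> (point \<Rightarrow> point) \<Rightarrow> point set \<Rightarrow> bool" where
  "restriction_continuous D D' f A \<longleftrightarrow>
     continuous_map (subtopology (dom_top D) A) (dom_top D') f"

definition orientation_preserving ::
  "domain_lengths \<Rightarrow> domain_lengths \<Rightarrow> (point \<Rightarrow> point) \<Rightarrow> bool" where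
  "orientation_preserving D D' f \<longleftrightarrow>
     (\<forall>i a b. interval_lifts D i a b \<longrightarrow>
        restriction_continuous D D' f (dom_proj D i ` {a..b}) \<longrightarrow>
        f ` dom_proj D i ` {a..<b} = interval_co D' (f (dom_proj D i a)) (f (dom_proj D i b)))"

definition absolutely_continuous_on :: "real set \<Rightarrow> (real \<Rightarrow> real) \<Rightarrow> bool" where
  "absolutely_continuous_on S g \<longleftrightarrow>
     (\<forall>\<epsilon>>0. \<exists>\<delta>>0. \<forall>(n::nat) u v.
        (\<forall>k<n. u k \<le> v k \<and> {u k..v k} \<subseteq> S) \<longrightarrow>
        disjoint_family_on (\<lambda>k. {u k<..<v k}) {..<n} \<longrightarrow>
        (\<Sum>k<n. v k - u k) < \<delta> \<longrightarrow> (\<Sum>k<n. \<bar>g (v k) - g (u k)\<bar>) < \<epsilon>)"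

definition piecewise_absolutely_continuous :: "domain_lengths \<Rightarrow> (point \<Rightarrow> point) \<Rightarrow> bool" where
  "piecewise_absolutely_continuous D f \<longleftrightarrow>
     (\<forall>i a b. interval_lifts D i a b \<longrightarrow>
        restriction_continuous D D f (dom_proj D i ` {a..<b}) \<longrightarrow>
        (\<exists>j<length D. \<exists>c.
           f ` dom_proj D i ` {a..<b} \<subseteq> {j} \<times> circle (D ! j) \<and>
           absolutely_continuous_on {a..<b}
             (\<lambda>x. the_inv_into {c..<c + D ! j} (dom_proj D j) (f (dom_proj D i x)))))"

definition right_PAC :: "domain_lengths \<Rightarrow> (point \<Rightarrow> point) \<Rightarrow> bool" where
  "right_PAC D f \<longleftrightarrow>
     bij_betw f (points D) (points D) \<and>
     right_continuous D D f \<and>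
     finite (discontinuities D D f) \<and>
     piecewise_absolutely_continuous D f \<and>
     orientation_preserving D D f"

text \<open>Membership in \<^const>\<open>Bij\<close> normalises a function to be \<^const>\<open>undefined\<close> outside
  \<^term>\<open>points D\<close>, so that equality in the group is equality of functions on the domain.\<close>

definition PAC :: "domain_lengths \<Rightarrow> (point \<Rightarrow> point) set" where
  "PAC D = {f \<in> Bij (points D). right_PAC D f \<and> right_PAC D (inv_into (points D) f)}"

definition PAC_group :: "domain_lengths \<Rightarrow> (point \<Rightarrow> point) monoid" where
  "PAC_group D = (BijGroup (points D)) \<lparr>carrier := PAC D\<rparr>"

text \<open>Integration with respect to the natural measure of a domain, which is on each component the
  image of Lebesgue measure on the fundamental domain \<open>{0..<l}\<close>.\<close>

definition dom_integral :: "domain_lengths \<Rightarrow> (point \<Rightarrow> real) \<Rightarrow> real" where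
  "dom_integral D \<phi> =
     (\<Sum>i<length D. set_lebesgue_integral lborel {0..<D ! i} (\<lambda>x. \<phi> (dom_proj D i x)))"

definition PAC_dist :: "domain_lengths \<Rightarrow> (point \<Rightarrow> point) \<Rightarrow> (point \<Rightarrow> point) \<Rightarrow> real" where
  "PAC_dist D f g =
     dom_integral D (\<lambda>p. dom_dist D (f p) (g p)) +
     dom_integral D (\<lambda>p. dom_dist D (inv_into (points D) f p) (inv_into (points D) g p))"

definition real_group :: "real monoid" where
  "real_group = \<lparr>carrier = UNIV, monoid.mult = (+), one = 0\<rparr>"

definition continuous_hom :: "domain_lengths \<Rightarrow> (real \<Rightarrow> point \<Rightarrow> point) \<Rightarrow> bool" where
  "continuous_hom D \<rho> \<longleftrightarrow>
     \<rho> \<in> hom real_group (PAC_group D) \<and>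
     (\<forall>t. ((\<lambda>s. PAC_dist D (\<rho> s) (\<rho> t)) \<longlongrightarrow> 0) (at t))"

definition piecewise_isometric :: "domain_lengths \<Rightarrow> domain_lengths \<Rightarrow> (point \<Rightarrow> point) \<Rightarrow> bool" where
  "piecewise_isometric D D' h \<longleftrightarrow>
     (\<exists>P. finite P \<and> partition_on (points D) P \<and>
        (\<forall>A\<in>P. (\<exists>i a b. interval_lifts D i a b \<and> A = dom_proj D i ` {a..<b}) \<and>
           (\<forall>p\<in>A. \<forall>q\<in>A. dom_dist D' (h p) (h q) = dom_dist D p q)))"

definition IET :: "domain_lengths \<Rightarrow> domain_lengths \<Rightarrow> (point \<Rightarrow> point) set" where
  "IET D D' = {h \<in> extensional (points D).
     bij_betw h (points D) (points D') \<and>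
     piecewise_isometric D D' h \<and>
     orientation_preserving D D' h \<and>
     right_continuous D D' h \<and>
     finite (discontinuities D D' h)}"

end

theory Submission
  imports Defs
begin

text \<open>
  The idea is to keep track of the two sides of every point. An element \<open>\<phi>\<close> of the group carries
  right germs to right germs and left germs to left germs: a right germ at \<open>p\<close> goes to the right
  germ at \<open>\<phi> p\<close>, a left germ at \<open>p\<close> to the left germ at some point \<open>\<psi> p\<close>, and \<open>\<phi>\<close> is
  continuous at \<open>p\<close> exactly if \<open>\<psi> p = \<phi> p\<close>. The maps \<open>\<psi>\<^sub>t\<close> that belong to
  \<open>\<phi>\<^sub>t = \<rho> t\<close> form a second action of the real line, because germs can be composed
  (\<open>germ_compose\<close>). Cut the circle at finitely many points and glue, for a permutation \<open>\<sigma>\<close> of the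
  circle that moves only these points, the left side of each \<open>p\<close> to the right side of \<open>\<sigma> p\<close>
  instead of the right side of \<open>p\<close>. The result is a disjoint union of circles, the cutting and
  gluing is an interval exchange transformation, and the conjugated maps are continuous as soon as
  \<open>\<sigma> \<circ> \<psi>\<^sub>t = \<phi>\<^sub>t \<circ> \<sigma>\<close> for all \<open>t\<close>. So the theorem reduces to the existence of such a \<open>\<sigma>\<close>.

  Let the real line act on pairs of points by \<open>\<psi>\<^sub>t\<close> on the first and \<open>\<phi>\<^sub>t\<close> on the second
  component. The graph of \<open>\<sigma>\<close> has to be an invariant set that differs from the diagonal by a finite
  set. The diagonal itself is almost invariant: the number of pairs by which it differs from its
  translate by \<open>t\<close> is controlled by the number of jumps of \<open>\<phi>\<^sub>t\<close> and \<open>\<phi>\<^sub>-\<^sub>t\<close>. These numbers are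
  bounded for small \<open>t\<close>. Indeed, a jump of \<open>\<phi>\<^sub>t\<close> at \<open>x\<close> leaves an arc between \<open>\<psi>\<^sub>t x\<close> and
  \<open>\<phi>\<^sub>t x\<close>; if \<open>\<phi>\<^sub>s\<close> is close to \<open>\<phi>\<^sub>t\<close> but has no jump near \<open>x\<close>, then its inverse sends this
  arc into a small neighbourhood of \<open>x\<close>, so the inverses of \<open>\<phi>\<^sub>s\<close> and \<open>\<phi>\<^sub>t\<close> are far apart
  (\<open>jump_persists\<close>). Hence the set of \<open>t\<close> with more than \<open>n\<close> jumps is open, and the Baire category
  theorem gives an interval on which the number of jumps is bounded (\<open>bounded_jumps_near_0\<close>). A
  purely combinatorial argument, which uses only that the real line is abelian and divisible, turns
  a set that is almost invariant under small translations into an invariant set at finite distance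
  (\<open>invariant_near\<close>). Near the diagonal this invariant set is a partial bijection that misses equally
  many points on both sides, all of them fixed points, so it can be completed to the graph of \<open>\<sigma>\<close>
  (\<open>conjugating_permutation\<close>).

  Finally, passing from a segment between two cut points to its right end point and applying
  \<open>\<sigma>\<close> permutes the segments; its cycles are the circles of the new domain (\<open>tiles_exist\<close>). The
  conjugated homomorphism is continuous for the integral distance because convergence in mean gives
  almost everywhere convergence along subsequences, which survives composition with a map that is
  continuous off a finite set.
\<close>

section \<open>Almost invariant sets of actions of the real line\<close>

locale real_action =
  fixes act :: "real \<Rightarrow> 'a \<Rightarrow> 'a"
  assumes act_0 [simp]: "act 0 p = p"
    and act_add: "act (s + t) p = act s (act t p)"
begin

definition fixed :: "'a \<Rightarrow> bool" where
  "fixed p \<longleftrightarrow> (\<forall>t. act t p = p)"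

lemma act_inverse [simp]: "act (- t) (act t p) = p" "act t (act (- t) p) = p"
  by (simp_all flip: act_add)

lemma act_inj: "inj_on (act t) A"
  by (metis act_inverse(1) inj_onI)

lemma act_multiple: "act t p = p \<Longrightarrow> act (real n * t) p = p"
proof (induction n)
  case (Suc n)
  have "act (real (Suc n) * t) p = act (t + real n * t) p"
    by (simp add: algebra_simps)
  then show ?case using Suc by (simp add: act_add)
qed simp

lemma in_image_act_iff: "p \<in> act t ` M \<longleftrightarrow> act (- t) p \<in> M"
  by (metis act_inverse image_iff)

text \<open>This is the lemma of B. H. Neumann that a group is not a finite union of cosets of subgroups of
  infinite index, for the stabilisers of finitely many points \<open>s\<close> that are not fixed, and with the
  group element chosen near \<open>0\<close>. The finite pattern \<open>P\<close> makes the induction work: to avoid one more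
  coset, the pattern is enlarged by a short arithmetic progression whose step is so divisible that
  the progression meets each coset of the new stabiliser at most once. One of its translates of
  \<open>P\<close> then avoids the new coset.\<close>

lemma avoid_pattern:
  assumes "finite Q" "\<And>s r. (s, r) \<in> Q \<Longrightarrow> \<not> fixed s" "finite P" "0 < \<eta>"
  shows "\<exists>x. \<bar>x\<bar> < \<eta> \<and> (\<forall>(s, r)\<in>Q. \<forall>p\<in>P. act (x + p) s \<noteq> r)"
  using assms
proof (induction Q arbitrary: P \<eta> rule: finite_induct)
  case empty
  show ?case by (rule exI[of _ 0]) (use empty in auto)
next
  case (insert sr Q)
  obtain s r where sr: "sr = (s, r)" by force
  then have "\<not> fixed s" using insert.prems(1) by blast
  then obtain e where e: "act e s \<noteq> s" by (auto simp: fixed_def)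
  define L where "L = card P"
  obtain K :: nat where K: "real L * \<bar>e\<bar> / (\<eta> / 2) < real K"
    using reals_Archimedean2 by blast
  have K0: "0 < real K" using K insert.prems(3)
    by (intro le_less_trans[OF _ K]) simp
  \<comment> \<open>The factor \<open>K\<close> makes the progression short, the factorial makes \<open>e\<close> a multiple of \<open>k * d\<close> for all \<open>k \<le> L\<close>.\<close>
  define d where "d = e / (real K * fact L)"
  have Kd: "real (K * fact L) * d = e"
    using K0 by (simp add: d_def)
  have small: "real k * \<bar>d\<bar> < \<eta> / 2" if "k \<le> L" for k
  proof -
    have "real k * \<bar>d\<bar> \<le> real L * (\<bar>e\<bar> / real K)"
    proof (intro mult_mono)
      have "real K * 1 \<le> real K * fact L" by (intro mult_left_mono) auto
      then have "\<bar>e\<bar> / (real K * fact L) \<le> \<bar>e\<bar> / real K"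
        using K0 by (intro divide_left_mono) auto
      then show "\<bar>d\<bar> \<le> \<bar>e\<bar> / real K"
        by (simp add: d_def abs_mult)
    qed (use that in auto)
    also have "\<dots> < \<eta> / 2"
      using K K0 insert.prems(3) by (simp add: field_simps)
    finally show ?thesis .
  qed
  \<comment> \<open>A multiple \<open>k * d\<close> with \<open>0 < k \<le> L\<close> cannot fix \<open>s\<close>, because \<open>e\<close> is a multiple of it.\<close>
  have move: "act (real k * d) s \<noteq> s" if "0 < k" "k \<le> L" for k
  proof
    assume *: "act (real k * d) s = s"
    have "k dvd K * fact L" using that by (simp add: dvd_fact)
    then obtain m where m: "K * fact L = m * k" by (metis dvd_def mult.commute)
    have "e = real m * (real k * d)"
      using Kd unfolding m by (simp add: algebra_simps)
    then show False using act_multiple[OF *, of m] e by simp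
  qed
  define P' where "P' = (\<lambda>(p, k). p + real k * d) ` (P \<times> {..L})"
  have "finite P'" using insert.prems(2) by (simp add: P'_def)
  then obtain x where x: "\<bar>x\<bar> < \<eta> / 2" "\<And>s r p. (s, r) \<in> Q \<Longrightarrow> p \<in> P' \<Longrightarrow> act (x + p) s \<noteq> r"
    using insert.IH[of P' "\<eta> / 2"] insert.prems by (fastforce)
  define bad where "bad = {k \<in> {..L}. \<exists>p\<in>P. act (x + p + real k * d) s = r}"
  have unique: "k = k'" if "p \<in> P" "k \<le> L" "k' \<le> L"
      "act (x + p + real k * d) s = r" "act (x + p + real k' * d) s = r" for p k k'
  proof -
    have *: "k' \<le> k" if h: "k \<le> L" "k' \<le> L"
      "act (x + p + real k * d) s = r" "act (x + p + real k' * d) s = r" for k k'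
    proof (rule ccontr)
      assume "\<not> k' \<le> k"
      then have lt: "k < k'" by simp
      then have "x + p + real k' * d = (x + p + real k * d) + real (k' - k) * d"
        by (simp add: algebra_simps of_nat_diff)
      then have "act (x + p + real k * d) (act (real (k' - k) * d) s) = act (x + p + real k * d) s"
        using h by (metis act_add)
      then have "act (real (k' - k) * d) s = s"
        using act_inj[of "x + p + real k * d" UNIV] by (simp add: inj_eq)
      moreover have "0 < k' - k" "k' - k \<le> L" using lt h(2) by simp_all
      ultimately show False using move by blast
    qed
    show ?thesis using *[of k k'] *[of k' k] that by simp
  qed
  have "bad \<subseteq> (\<lambda>p. THE k. k \<le> L \<and> act (x + p + real k * d) s = r) ` P"
  proof
    fix k assume "k \<in> bad"
    then obtain p where p: "p \<in> P" "k \<le> L" "act (x + p + real k * d) s = r"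
      by (auto simp: bad_def)
    have "(THE k. k \<le> L \<and> act (x + p + real k * d) s = r) = k"
      using p unique[of p] by (intro the_equality) auto
    then show "k \<in> (\<lambda>p. THE k. k \<le> L \<and> act (x + p + real k * d) s = r) ` P"
      using p by force
  qed
  then have "card bad \<le> L"
    unfolding L_def using insert.prems(2) by (meson card_image_le card_mono finite_imageI order_trans)
  then have "bad \<noteq> {..L}" by auto
  then obtain k where k: "k \<le> L" "k \<notin> bad" by (auto simp: bad_def)
  show ?case
  proof (intro exI[of _ "x + real k * d"] conjI ballI)
    have "\<bar>real k * d\<bar> < \<eta> / 2" using small[OF k(1)] by (simp add: abs_mult)
    then show "\<bar>x + real k * d\<bar> < \<eta>" using x(1) by linarith
    fix z assume z: "z \<in> insert sr Q"
    have "act (x + real k * d + p) s' \<noteq> r'" if "z = (s', r')" "p \<in> P" for s' r' p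
    proof (cases "z = sr")
      case True
      then have "act (x + p + real k * d) s' \<noteq> r'"
        using k that sr by (auto simp: bad_def)
      then show ?thesis by (simp add: algebra_simps)
    next
      case False
      have "p + real k * d \<in> P'" using that k by (force simp: P'_def)
      then have "act (x + (p + real k * d)) s' \<noteq> r'" using x(2) z False that by blast
      then show ?thesis by (simp add: algebra_simps)
    qed
    then show "case z of (s, r) \<Rightarrow> \<forall>p\<in>P. act (x + real k * d + p) s \<noteq> r"
      by auto
  qed
qed

lemma avoid:
  assumes "finite Q" "\<And>s r. (s, r) \<in> Q \<Longrightarrow> \<not> fixed s" "0 < \<eta>"
  obtains x where "\<bar>x\<bar> < \<eta>" "\<And>s r. (s, r) \<in> Q \<Longrightarrow> act x s \<noteq> r"
proof -
  obtain x where "\<bar>x\<bar> < \<eta>" "\<forall>(s, r)\<in>Q. \<forall>p\<in>{0}. act (x + p) s \<noteq> r"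
    using avoid_pattern[of Q "{0}" \<eta>] assms by blast
  then show ?thesis by (intro that[of x]) auto
qed

lemma infinite_orbit:
  assumes "\<not> fixed p"
  shows "infinite (range (\<lambda>t. act t p))"
proof
  assume "finite (range (\<lambda>t. act t p))"
  then have "finite (Pair p ` range (\<lambda>t. act t p))" by simp
  then obtain x where "\<And>s r. (s, r) \<in> Pair p ` range (\<lambda>t. act t p) \<Longrightarrow> act x s \<noteq> r"
    by (rule avoid[of _ 1]) (use assms in auto)
  then show False by blast
qed

text \<open>The symmetric difference of the translates of \<open>M\<close> by \<open>s\<close> and by \<open>t\<close>, written without images.\<close>

definition change :: "'a set \<Rightarrow> real \<Rightarrow> real \<Rightarrow> 'a set" where
  "change M s t = {p. (act (- s) p \<in> M) \<noteq> (act (- t) p \<in> M)}"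

lemma change_translate: "change M (s + u) (t + u) = act u ` change M s t"
proof -
  have "act (- (s + u)) p = act (- s) (act (- u) p)" for s p
    by (metis act_add minus_add_distrib)
  then show ?thesis by (auto simp: change_def in_image_act_iff)
qed

lemma card_change: "card (change M s t) = card (change M 0 (t - s))"
  using change_translate[of M 0 s "t - s"] by (simp add: card_image act_inj)

lemma finite_change: "finite (change M s t) \<longleftrightarrow> finite (change M 0 (t - s))"
  using change_translate[of M 0 s "t - s"] by (simp add: finite_image_iff act_inj)

lemma change_not_fixed: "p \<in> change M s t \<Longrightarrow> \<not> fixed p"
  unfolding change_def fixed_def by (metis (mono_tags, lifting) mem_Collect_eq)

text \<open>Choose \<open>t\<close> such that the translate of \<open>M\<close> by \<open>t\<close> differs from \<open>M\<close> in a set \<open>S\<close> of maximal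
  size among all small parameters. The translates by \<open>t\<close> and by \<open>u\<close> cannot differ in more points,
  so at least half of the difference between \<open>M\<close> and its translate by \<open>u\<close> lies in \<open>S\<close>. Applied
  from both ends, this shows that two translates, by \<open>v\<close> and by \<open>w\<close>, agree outside the translates
  of \<open>S\<close> by \<open>v\<close> and \<open>w\<close>, provided that these are disjoint. As the latter can be achieved by the
  avoidance lemma, for a given point \<open>p\<close> all translates by \<open>v\<close> for which \<open>p\<close> is not in the
  translate of \<open>S\<close> agree on whether they contain \<open>p\<close>. The invariant set consists of the points
  for which the answer is yes.\<close>

theorem invariant_near:
  assumes eps: "0 < \<epsilon>" and fin: "\<And>t. \<bar>t\<bar> < \<epsilon> \<Longrightarrow> finite (change M 0 t)"
    and bound: "\<And>t. \<bar>t\<bar> < \<epsilon> \<Longrightarrow> card (change M 0 t) \<le> C"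
  obtains M' where "\<And>t p. act t p \<in> M' \<longleftrightarrow> p \<in> M'" "finite ((M - M') \<union> (M' - M))"
    "\<And>p. fixed p \<Longrightarrow> p \<in> M' \<longleftrightarrow> p \<in> M"
proof -
  define b where "b t = card (change M 0 t)" for t
  define B where "B \<delta> = Max (b ` {t. \<bar>t\<bar> < \<delta>})" for \<delta> :: real
  have fb: "finite (b ` {t. \<bar>t\<bar> < \<delta>})" if "\<delta> \<le> \<epsilon>" for \<delta>
  proof (rule finite_subset)
    show "b ` {t. \<bar>t\<bar> < \<delta>} \<subseteq> {..C}"
    proof (rule image_subsetI)
      fix t assume "t \<in> {t. \<bar>t\<bar> < \<delta>}"
      then have "\<bar>t\<bar> < \<epsilon>" using that by simp
      then show "b t \<in> {..C}" using bound[of t] by (simp add: b_def)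
    qed
  qed simp
  \<comment> \<open>The size of the window is chosen so that shrinking it does not lower the maximum.\<close>
  obtain \<delta> where \<delta>: "0 < \<delta>" "\<delta> \<le> \<epsilon>" and min: "\<And>\<delta>'. 0 < \<delta>' \<Longrightarrow> \<delta>' \<le> \<epsilon> \<Longrightarrow> B \<delta> \<le> B \<delta>'"
    using ex_has_least_nat[of "\<lambda>\<delta>. 0 < \<delta> \<and> \<delta> \<le> \<epsilon>" \<epsilon> B] eps by auto
  have "B (\<delta> / 2) \<in> b ` {t. \<bar>t\<bar> < \<delta> / 2}"
    unfolding B_def using \<delta> by (intro Max_in fb) (auto intro!: exI[of _ 0])
  then obtain t where t: "\<bar>t\<bar> < \<delta> / 2" "b t = B (\<delta> / 2)" by auto
  have bt: "b u \<le> b t" if "\<bar>u\<bar> < \<delta>" for u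
  proof -
    have "b u \<le> B \<delta>" unfolding B_def using that \<delta> by (intro Max_ge fb) auto
    also have "\<dots> \<le> B (\<delta> / 2)" using min[of "\<delta> / 2"] \<delta> by simp
    finally show ?thesis using t by simp
  qed
  define S where "S = change M 0 t"
  define \<eta> where "\<eta> = \<delta> / 2"
  have \<eta>: "0 < \<eta>" using \<delta> by (simp add: \<eta>_def)
  have finS: "finite S" unfolding S_def using t \<delta> by (intro fin) auto
  have half: "card (change M 0 u) \<le> 2 * card (change M 0 u \<inter> S)" if u: "\<bar>u\<bar> < \<eta>" for u
  proof -
    let ?X = "S" and ?Y = "change M 0 u"
    have finY: "finite ?Y" using u \<delta> by (intro fin) (auto simp: \<eta>_def)
    have eq: "change M t u = (?X - ?Y) \<union> (?Y - ?X)"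
      by (auto simp: change_def S_def)
    have "card (change M t u) \<le> card ?X"
      using bt[of "u - t"] u t card_change[of M t u] unfolding \<eta>_def b_def S_def by auto
    moreover have "card (change M t u) = card (?X - ?Y) + card (?Y - ?X)"
      unfolding eq using finS finY by (intro card_Un_disjoint) auto
    moreover have "card ?X = card (?X - ?Y) + card (?X \<inter> ?Y)"
      using finS by (metis add.commute card_Int_Diff)
    moreover have "card ?Y = card (?Y - ?X) + card (?X \<inter> ?Y)"
      using finY by (metis add.commute card_Int_Diff inf_commute)
    ultimately show ?thesis by (simp add: inf_commute)
  qed
  have half': "card (change M v w) \<le> 2 * card (change M v w \<inter> act v ` S)"
    and finc: "finite (change M v w)" if "\<bar>w - v\<bar> < \<eta>" for v w
  proof -
    have eq: "change M v w = act v ` change M 0 (w - v)"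
      using change_translate[of M 0 v "w - v"] by simp
    have "change M v w \<inter> act v ` S = act v ` (change M 0 (w - v) \<inter> S)"
      unfolding eq by (rule image_Int[symmetric]) (rule act_inj)
    then show "card (change M v w) \<le> 2 * card (change M v w \<inter> act v ` S)"
      unfolding eq using half[OF that] by (simp add: card_image act_inj)
    show "finite (change M v w)" 
      using finite_change[of M v w] fin[of "w - v"] that \<delta> unfolding \<eta>_def by linarith
  qed
  have loc: "change M v w \<subseteq> act v ` S \<union> act w ` S"
    if vw: "\<bar>w - v\<bar> < \<eta>" and disj: "act v ` S \<inter> act w ` S = {}" for v w
  proof -
    let ?Z = "change M v w"
    have sym: "change M w v = ?Z" by (auto simp: change_def)
    have "card ?Z \<le> 2 * card (?Z \<inter> act v ` S)" "card ?Z \<le> 2 * card (?Z \<inter> act w ` S)"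
      using half'[OF vw] half'[of v w] vw sym by (auto simp: abs_minus_commute)
    moreover have "card (?Z \<inter> (act v ` S \<union> act w ` S)) = card (?Z \<inter> act v ` S) + card (?Z \<inter> act w ` S)"
      unfolding Int_Un_distrib using finc[OF vw] disj by (intro card_Un_disjoint) auto
    ultimately have "card ?Z \<le> card (?Z \<inter> (act v ` S \<union> act w ` S))" by linarith
    then have "?Z \<inter> (act v ` S \<union> act w ` S) = ?Z"
      using finc[OF vw] by (intro card_seteq) auto
    then show ?thesis by blast
  qed
  have nf: "\<not> fixed s" if "s \<in> S" for s
    using that change_not_fixed unfolding S_def by blast
  have const: "act (- v) p \<in> M \<longleftrightarrow> act (- w) p \<in> M"
    if v: "\<bar>v\<bar> < \<eta> / 2" "p \<notin> act v ` S" and w: "\<bar>w\<bar> < \<eta> / 2" "p \<notin> act w ` S" for v w p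
  proof -
    have "finite (S \<times> (act v ` S \<union> act w ` S \<union> {p}))" using finS by simp
    then obtain u where u: "\<bar>u\<bar> < \<eta> / 2"
      "\<And>s r. (s, r) \<in> S \<times> (act v ` S \<union> act w ` S \<union> {p}) \<Longrightarrow> act u s \<noteq> r"
      by (rule avoid[of _ "\<eta> / 2"]) (use \<eta> nf in auto)
    have "r \<notin> act u ` S" if "r \<in> act v ` S \<union> act w ` S \<union> {p}" for r
      using u(2) that by blast
    then have "p \<notin> act u ` S" "act v ` S \<inter> act u ` S = {}" "act w ` S \<inter> act u ` S = {}"
      by auto
    moreover have "\<bar>u - v\<bar> < \<eta>" "\<bar>u - w\<bar> < \<eta>" using u(1) v(1) w(1) by linarith+
    ultimately have "p \<notin> change M v u" "p \<notin> change M w u"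
      using loc[of u v] loc[of u w] v w by blast+
    then show ?thesis by (auto simp: change_def)
  qed
  have ex: "\<exists>v. \<bar>v\<bar> < \<zeta> \<and> p \<notin> act v ` S" if "0 < \<zeta>" for \<zeta> p
  proof -
    obtain x where "\<bar>x\<bar> < \<zeta>" "\<And>s r. (s, r) \<in> S \<times> {p} \<Longrightarrow> act x s \<noteq> r"
      using avoid[of "S \<times> {p}" \<zeta>] \<open>0 < \<zeta>\<close> finS nf by auto
    then show ?thesis by (intro exI[of _ x]) auto
  qed
  define M' where "M' = {p. \<exists>v. \<bar>v\<bar> < \<eta> / 2 \<and> p \<notin> act v ` S \<and> act (- v) p \<in> M}"
  have inv_small: "act w p \<in> M'" if p: "p \<in> M'" and w: "\<bar>w\<bar> < \<eta> / 4" for w p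
  proof -
    obtain v where v: "\<bar>v\<bar> < \<eta> / 4" "p \<notin> act v ` S" using ex[of "\<eta> / 4"] \<eta> by auto
    obtain v' where v': "\<bar>v'\<bar> < \<eta> / 2" "p \<notin> act v' ` S" "act (- v') p \<in> M"
      using p by (auto simp: M'_def)
    have "act (- v) p \<in> M" using const[of v p v'] v v' \<eta> by auto
    moreover have "act (- (v + w)) (act w p) = act (- v) p"
      by (simp flip: act_add)
    moreover have "\<bar>v + w\<bar> < \<eta> / 2" using v w by linarith
    ultimately show ?thesis
      using v unfolding M'_def in_image_act_iff by auto
  qed
  have inv: "act w p \<in> M'" if p: "p \<in> M'" for w p
  proof -
    obtain n :: nat where n: "\<bar>w\<bar> / (\<eta> / 4) < real n" using reals_Archimedean2 by blast
    have n0: "0 < real n" by (rule le_less_trans[OF _ n]) (use \<eta> in simp)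
    have "\<bar>w / real n\<bar> < \<eta> / 4" using n n0 \<eta> by (simp add: field_simps)
    then have "act (real m * (w / real n)) p \<in> M'" for m
    proof (induction m)
      case (Suc m)
      have "real (Suc m) * (w / real n) = w / real n + real m * (w / real n)"
        by (simp add: algebra_simps add_divide_distrib)
      then show ?case using Suc inv_small by (simp only: act_add)
    qed (simp add: p)
    from this[of n] show ?thesis using n0 by simp
  qed
  show ?thesis
  proof (rule that)
    show "act t p \<in> M' \<longleftrightarrow> p \<in> M'" for t p
      using inv[of p t] inv[of "act t p" "- t"] by auto
    have "p \<in> M' \<longleftrightarrow> p \<in> M" if p: "p \<notin> S" for p
    proof -
      have 0: "p \<notin> act 0 ` S" using p by (simp add: in_image_act_iff)
      have "act (- v) p \<in> M \<longleftrightarrow> p \<in> M" if "\<bar>v\<bar> < \<eta> / 2" "p \<notin> act v ` S" for v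
        using const[OF that, of 0] 0 \<eta> by simp
      moreover have "p \<in> M \<Longrightarrow> p \<in> M'"
        using 0 \<eta> unfolding M'_def by (intro CollectI exI[of _ 0]) simp
      ultimately show ?thesis unfolding M'_def by blast
    qed
    then show "finite ((M - M') \<union> (M' - M))"
      by (intro finite_subset[OF _ finS]) blast
    show "p \<in> M' \<longleftrightarrow> p \<in> M" if "fixed p" for p
    proof -
      have eq: "act v p = p" for v using that by (simp add: fixed_def)
      have "\<exists>v. \<bar>v\<bar> < \<eta> / 2 \<and> p \<notin> act v ` S" using \<eta> by (intro ex) simp
      then show ?thesis unfolding M'_def mem_Collect_eq eq by blast
    qed
  qed
qed

end

section \<open>Correcting a cocycle of finitely supported permutations\<close>

text \<open>If \<open>x\<close> were related to two points, then the orbit of this configuration would give infinitely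
  many pairs off the diagonal, unless nothing moves at all. The lemma is used for an invariant
  relation and for its converse.\<close>

lemma almost_diagonal_functional:
  assumes "real_action \<psi>" "real_action \<phi>"
    and inv: "\<And>t x y. (\<psi> t x, \<phi> t y) \<in> R \<longleftrightarrow> (x, y) \<in> R"
    and fin: "finite {p \<in> R. fst p \<noteq> snd p}"
    and diag: "\<And>x y. real_action.fixed \<psi> x \<Longrightarrow> real_action.fixed \<phi> y \<Longrightarrow> (x, y) \<in> R \<Longrightarrow> x = y"
    and y: "(x, y) \<in> R" "(x, y') \<in> R"
  shows "y = y'"
proof (rule ccontr)
  interpret \<phi>: real_action \<phi> by fact
  interpret \<psi>: real_action \<psi> by fact
  let ?N = "{p \<in> R. fst p \<noteq> snd p}"
  assume ne: "y \<noteq> y'"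
  show False
  proof (cases "\<psi>.fixed x")
    case False
    have "\<psi> t x \<in> fst ` ?N" for t
    proof -
      have "\<phi> t y \<noteq> \<phi> t y'" using ne by (metis \<phi>.act_inverse(1))
      then have "(\<psi> t x, \<phi> t y) \<in> ?N \<or> (\<psi> t x, \<phi> t y') \<in> ?N"
        using y inv by auto
      then show ?thesis by force
    qed
    then show False
      using \<psi>.infinite_orbit[OF False] finite_imageI[OF fin, of fst] by (meson finite_subset image_subsetI)
  next
    case True
    have "\<phi>.fixed z" if z: "(x, z) \<in> R" for z
    proof (rule ccontr)
      assume nf: "\<not> \<phi>.fixed z"
      have "(x, \<phi> t z) \<in> R" for t
        using z inv[of t x z] True by (simp add: \<psi>.fixed_def)
      then have "range (\<lambda>t. \<phi> t z) \<subseteq> insert x (snd ` ?N)"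
        by (force simp: image_iff)
      then show False
        using \<phi>.infinite_orbit[OF nf] finite_imageI[OF fin, of snd] by (meson finite_insert finite_subset)
    qed
    then show False using y True diag ne by blast
  qed
qed

text \<open>The invariant set near the diagonal is a partial bijection. A point outside its domain has a
  finite orbit, as the domain is invariant and its complement finite, hence is fixed; the same holds
  for the range. Since the partial bijection agrees with the identity off a finite set \<open>F\<close>, the
  missing points of \<open>F\<close> on both sides are equal in number, and they can be matched
  arbitrarily without losing equivariance.\<close>

theorem conjugating_permutation:
  fixes \<phi> \<psi> :: "real \<Rightarrow> 'a \<Rightarrow> 'a"
  assumes "real_action \<phi>" "real_action \<psi>"
    and eps: "0 < \<epsilon>" and fin: "\<And>t. \<bar>t\<bar> < \<epsilon> \<Longrightarrow> finite {x. \<psi> t x \<noteq> \<phi> t x}"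
    and bound: "\<And>t. \<bar>t\<bar> < \<epsilon> \<Longrightarrow> card {x. \<psi> t x \<noteq> \<phi> t x} \<le> C"
  obtains \<sigma> where "bij \<sigma>" "finite {x. \<sigma> x \<noteq> x}" "\<And>t x. \<sigma> (\<psi> t x) = \<phi> t (\<sigma> x)"
    "\<And>x. (\<And>t. \<psi> t x = x) \<Longrightarrow> (\<And>t. \<phi> t x = x) \<Longrightarrow> \<sigma> x = x"
proof -
  interpret \<phi>: real_action \<phi> by fact
  interpret \<psi>: real_action \<psi> by fact
  define act where "act t = map_prod (\<psi> t) (\<phi> t)" for t
  interpret act: real_action act
    by unfold_locales (auto simp: act_def \<phi>.act_add \<psi>.act_add prod.map_id0)
  have act_pair: "act t (x, y) = (\<psi> t x, \<phi> t y)" for t x y by (simp add: act_def)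
  have fixed_pair: "act.fixed (x, y) \<longleftrightarrow> \<psi>.fixed x \<and> \<phi>.fixed y" for x y
    by (auto simp: act.fixed_def \<phi>.fixed_def \<psi>.fixed_def act_pair)
  define M :: "('a \<times> 'a) set" where "M = {(x, x) | x. True}"
  have M_iff: "(x, y) \<in> M \<longleftrightarrow> x = y" for x y by (auto simp: M_def)
  let ?d = "\<lambda>t. {x. \<psi> t x \<noteq> \<phi> t x}"
  have sub: "act.change M 0 t \<subseteq> (\<lambda>x. (x, x)) ` ?d (- t) \<union> (\<lambda>x. (\<psi> t x, \<phi> t x)) ` ?d t" for t
  proof (clarify)
    fix x y assume xy: "(x, y) \<in> act.change M 0 t"
      "(x, y) \<notin> (\<lambda>x. (\<psi> t x, \<phi> t x)) ` ?d t"
    then have ne: "(x = y) \<noteq> (\<psi> (- t) x = \<phi> (- t) y)"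
      by (simp add: act.change_def act_pair M_iff)
    show "(x, y) \<in> (\<lambda>x. (x, x)) ` ?d (- t)"
    proof (cases "x = y")
      case True
      then show ?thesis using ne by auto
    next
      case False
      then have "\<psi> (- t) x = \<phi> (- t) y" using ne by simp
      define z where "z = \<psi> (- t) x"
      have z': "z = \<phi> (- t) y" using \<open>\<psi> (- t) x = \<phi> (- t) y\<close> by (simp only: z_def)
      have z: "\<psi> t z = x" "\<phi> t z = y" unfolding z_def[symmetric]
        by (simp add: z_def) (simp add: z')
      have "(x, y) = (\<lambda>x. (\<psi> t x, \<phi> t x)) z" "z \<in> ?d t" using z False by simp_all
      then have "(x, y) \<in> (\<lambda>x. (\<psi> t x, \<phi> t x)) ` ?d t" by (rule image_eqI)
      then show ?thesis using xy(2) by blast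
    qed
  qed
  have finc: "finite (act.change M 0 t)" if "\<bar>t\<bar> < \<epsilon>" for t
    by (rule finite_subset[OF sub]) (use fin[of t] fin[of "- t"] that in simp)
  have cardc: "card (act.change M 0 t) \<le> 2 * C" if t: "\<bar>t\<bar> < \<epsilon>" for t
  proof -
    have "card (act.change M 0 t)
        \<le> card ((\<lambda>x. (x, x)) ` ?d (- t) \<union> (\<lambda>x. (\<psi> t x, \<phi> t x)) ` ?d t)"
      by (rule card_mono[OF _ sub]) (use fin[of t] fin[of "- t"] t in simp)
    also have "\<dots> \<le> card ((\<lambda>x. (x, x)) ` ?d (- t)) + card ((\<lambda>x. (\<psi> t x, \<phi> t x)) ` ?d t)"
      by (rule card_Un_le)
    also have "\<dots> \<le> card (?d (- t)) + card (?d t)"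
      by (intro add_mono card_image_le) (use fin[of t] fin[of "- t"] t in simp_all)
    also have "\<dots> \<le> 2 * C" using bound[of t] bound[of "- t"] t by simp
    finally show ?thesis .
  qed
  obtain M' where inv: "\<And>t p. act t p \<in> M' \<longleftrightarrow> p \<in> M'"
    and fM: "finite ((M - M') \<union> (M' - M))" and M'_fixed: "\<And>p. act.fixed p \<Longrightarrow> p \<in> M' \<longleftrightarrow> p \<in> M"
    using act.invariant_near[OF eps finc cardc] by metis
  have inv': "(\<psi> t x, \<phi> t y) \<in> M' \<longleftrightarrow> (x, y) \<in> M'" for t x y
    using inv[of t "(x, y)"] by (simp add: act_pair)
  have fin1: "finite {p \<in> M'. fst p \<noteq> snd p}" and fin2: "finite {p \<in> prod.swap ` M'. fst p \<noteq> snd p}"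
  proof -
    show *: "finite {p \<in> M'. fst p \<noteq> snd p}"
      by (rule finite_subset[OF _ fM]) (auto simp: M_def)
    show "finite {p \<in> prod.swap ` M'. fst p \<noteq> snd p}"
      by (rule finite_subset[OF _ finite_imageI[OF *, of prod.swap]]) force
  qed
  have diag: "x = y" if "\<psi>.fixed x" "\<phi>.fixed y" "(x, y) \<in> M'" for x y
    using that M'_fixed[of "(x, y)"] by (simp add: fixed_pair M_iff)
  have row: "y = y'" if "(x, y) \<in> M'" "(x, y') \<in> M'" for x y y'
    using almost_diagonal_functional[OF \<open>real_action \<psi>\<close> \<open>real_action \<phi>\<close> inv' fin1 diag that] .
  have col: "x = x'" if "(x, y) \<in> M'" "(x', y) \<in> M'" for x x' y
  proof (rule almost_diagonal_functional[OF \<open>real_action \<phi>\<close> \<open>real_action \<psi>\<close> _ fin2])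
    show "(\<phi> t u, \<psi> t v) \<in> prod.swap ` M' \<longleftrightarrow> (u, v) \<in> prod.swap ` M'" for t u v
      using inv' by auto
    show "u = v" if "\<phi>.fixed u" "\<psi>.fixed v" "(u, v) \<in> prod.swap ` M'" for u v
      using that diag[of v u] by auto
    show "(y, x) \<in> prod.swap ` M'" "(y, x') \<in> prod.swap ` M'" using that by auto
  qed
  define A where "A = {x. \<forall>y. (x, y) \<notin> M'}"
  define B where "B = {y. \<forall>x. (x, y) \<notin> M'}"
  define F where "F = fst ` ((M - M') \<union> (M' - M)) \<union> snd ` ((M - M') \<union> (M' - M))"
  have finF: "finite F" using fM unfolding F_def by blast
  have outside: "(x, x) \<in> M'" if "x \<notin> F" for x
  proof (rule ccontr)
    assume "(x, x) \<notin> M'"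
    then have "(x, x) \<in> M - M'" by (simp add: M_iff)
    then have "x \<in> F" unfolding F_def by force
    then show False using that by simp
  qed
  have AF: "A \<subseteq> F" and BF: "B \<subseteq> F" using outside by (auto simp: A_def B_def)
  have "\<psi> t x \<in> A" if "x \<in> A" for t x
    using that inv'[of "- t" "\<psi> t x"] by (auto simp: A_def)
  then have A_fixed: "\<psi>.fixed x" if "x \<in> A" for x
    using \<psi>.infinite_orbit[of x] that finite_subset[OF AF finF] by (meson finite_subset image_subsetI)
  have "\<phi> t x \<in> B" if "x \<in> B" for t x
    using that inv'[of "- t" _ "\<phi> t x"] by (auto simp: B_def)
  then have B_fixed: "\<phi>.fixed x" if "x \<in> B" for x
    using \<phi>.infinite_orbit[of x] that finite_subset[OF BF finF] by (meson finite_subset image_subsetI)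
  define m where "m x = (THE y. (x, y) \<in> M')" for x
  have m: "m x = y" if "(x, y) \<in> M'" for x y
    unfolding m_def using that row by (intro the_equality) auto
  have m_in: "(x, m x) \<in> M'" if "x \<notin> A" for x
    using that m by (auto simp: A_def)
  have F_sym: "x \<in> F \<longleftrightarrow> y \<in> F" if "(x, y) \<in> M'" for x y
    using outside[of x] outside[of y] row col that by blast
  have bij_m: "bij_betw m (F - A) (F - B)"
  proof (rule bij_betw_imageI)
    show "inj_on m (F - A)" using m_in col by (metis DiffD2 inj_onI)
    show "m ` (F - A) = F - B"
    proof (intro equalityI subsetI)
      fix y assume "y \<in> m ` (F - A)"
      then obtain x where x: "x \<in> F" "x \<notin> A" "y = m x" by auto
      then show "y \<in> F - B" using m_in[of x] F_sym by (auto simp: B_def)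
    next
      fix y assume y: "y \<in> F - B"
      then obtain x where x: "(x, y) \<in> M'" by (auto simp: B_def)
      then have "x \<in> F - A" using y F_sym by (auto simp: A_def)
      then show "y \<in> m ` (F - A)" using m[OF x] by blast
    qed
  qed
  have "card (F - A) = card (F - B)" by (rule bij_betw_same_card[OF bij_m])
  then have "card A = card B"
    using AF BF finF by (metis card_Diff_subset card_mono diff_diff_cancel finite_subset)
  then obtain \<beta> where \<beta>: "bij_betw \<beta> A B"
    using AF BF finF finite_same_card_bij finite_subset by metis
  define \<sigma> where "\<sigma> x = (if x \<in> A then \<beta> x else m x)" for x
  have \<sigma>_out: "\<sigma> x = x" if "x \<notin> F" for x
    using that AF m[OF outside[OF that]] by (auto simp: \<sigma>_def)
  have bij_\<sigma>F: "bij_betw \<sigma> F F"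
  proof -
    have "bij_betw \<sigma> A B"
      using \<beta> by (subst bij_betw_cong[of A \<sigma> \<beta>]) (auto simp: \<sigma>_def)
    moreover have "bij_betw \<sigma> (F - A) (F - B)"
      using bij_m by (subst bij_betw_cong[of "F - A" \<sigma> m]) (auto simp: \<sigma>_def)
    ultimately have "bij_betw \<sigma> (A \<union> (F - A)) (B \<union> (F - B))"
      by (rule bij_betw_combine) auto
    then show ?thesis using AF BF by (simp add: Un_absorb1)
  qed
  have "bij_betw \<sigma> (- F) (- F)"
    by (subst bij_betw_cong[of "- F" \<sigma> id]) (auto simp: \<sigma>_out)
  then have "bij_betw \<sigma> (F \<union> - F) (F \<union> - F)"
    by (intro bij_betw_combine bij_\<sigma>F) auto
  then have "bij \<sigma>" by simp
  moreover have "finite {x. \<sigma> x \<noteq> x}"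
    by (rule finite_subset[OF _ finF]) (use \<sigma>_out in auto)
  moreover have "\<sigma> (\<psi> t x) = \<phi> t (\<sigma> x)" for t x
  proof (cases "x \<in> A")
    case True
    then have "\<beta> x \<in> B" using \<beta> by (auto simp: bij_betw_def)
    then show ?thesis
      using True A_fixed[of x] B_fixed[of "\<beta> x"] by (simp add: \<sigma>_def \<phi>.fixed_def \<psi>.fixed_def)
  next
    case False
    then have "(\<psi> t x, \<phi> t (m x)) \<in> M'" using m_in inv' by blast
    then show ?thesis using m[of "\<psi> t x"] False by (auto simp: \<sigma>_def A_def)
  qed
  moreover have "\<sigma> x = x" if "\<And>t. \<psi> t x = x" "\<And>t. \<phi> t x = x" for x
  proof -
    have "act.fixed (x, x)" using that by (simp add: fixed_pair \<phi>.fixed_def \<psi>.fixed_def)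
    then have "(x, x) \<in> M'" using M'_fixed by (simp add: M_iff)
    then show ?thesis using m[of x x] by (auto simp: \<sigma>_def A_def)
  qed
  ultimately show ?thesis by (rule that)
qed


section \<open>Lifts of points\<close>

lemma circle_proj_eq_iff: "circle_proj l x = circle_proj l y \<longleftrightarrow> (\<exists>k::int. y = x + of_int k * l)"
proof
  assume "circle_proj l x = circle_proj l y"
  then have "y \<in> circle_proj l x" using circle_proj_self by metis
  then show "\<exists>k::int. y = x + of_int k * l" by (auto simp: circle_proj_def)
next
  assume "\<exists>k::int. y = x + of_int k * l"
  then have "y \<in> circle_proj l x" by (auto simp: circle_proj_def)
  then show "circle_proj l x = circle_proj l y" by (simp add: circle_proj_eq)
qed

lemma dom_proj_eq_iff:
  "dom_proj D i x = dom_proj D j y \<longleftrightarrow> i = j \<and> (\<exists>k::int. y = x + of_int k * D ! i)"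
  by (cases "i = j") (simp_all add: dom_proj_def circle_proj_eq_iff)

lemma dom_proj_shift [simp]: "dom_proj D i (x + of_int k * D ! i) = dom_proj D i x"
  by (metis dom_proj_eq_iff)

lemma in_points_iff: "p \<in> points D \<longleftrightarrow> (\<exists>i<length D. \<exists>x. p = dom_proj D i x)"
  by (auto simp: points_def circle_def dom_proj_def)

lemma dom_proj_in_points [simp]: "dom_proj D i x \<in> points D \<longleftrightarrow> i < length D"
  by (auto simp: points_def circle_def dom_proj_def)

text \<open>Points of a component that are closer than its length have different projections; this is how
  lifts are recovered from points.\<close>

lemma dom_proj_near_imp_eq:
  assumes "dom_proj D i x = dom_proj D i y" "\<bar>x - y\<bar> < D ! i"
  shows "x = y"
proof -
  obtain k :: int where k: "y = x + of_int k * D ! i"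
    using assms(1) by (auto simp: dom_proj_eq_iff)
  have pos: "0 < D ! i" using assms(2) by linarith
  have "\<bar>of_int k\<bar> * D ! i < 1 * D ! i"
    using assms(2) k pos by (simp add: abs_mult)
  then have "\<bar>real_of_int k\<bar> < 1"
    using pos by (meson mult_less_cancel_right_pos)
  then have "k = 0" by linarith
  then show ?thesis using k by simp
qed

lemma domain_pos: "is_domain D \<Longrightarrow> i < length D \<Longrightarrow> 0 < D ! i"
  by (simp add: is_domain_def)

lemma domain_le_sum_list:
  assumes "is_domain D" "i < length D"
  shows "D ! i \<le> sum_list D"
proof -
  have "D ! i \<le> (\<Sum>j\<in>{0..<length D}. D ! j)"
    using assms by (intro member_le_sum) (auto simp: domain_pos less_imp_le)
  then show ?thesis by (simp add: sum_list_sum_nth)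
qed

lemma lift_in_window:
  fixes l x c :: real
  assumes "0 < l"
  obtains m :: int where "c \<le> x + of_int m * l" "x + of_int m * l < c + l"
proof -
  define k where "k = \<lfloor>(x - c) / l\<rfloor>"
  have "of_int k \<le> (x - c) / l" "(x - c) / l < of_int k + 1"
    unfolding k_def by linarith+
  then have "of_int k * l \<le> x - c" "x - c < of_int k * l + l"
    using assms by (auto simp: field_simps)
  then show ?thesis using that[of "- k"] by simp
qed

lemma dom_dist_le: "dom_dist D (dom_proj D i x) (dom_proj D i y) \<le> \<bar>x - y\<bar>"
  using setdist_le_dist[OF circle_proj_self circle_proj_self]
  by (simp add: dom_dist_def dom_proj_def dist_real_def)

lemma dom_dist_same: "dom_dist D (dom_proj D i x) (dom_proj D i y)
    = setdist (circle_proj (D ! i) x) (circle_proj (D ! i) y)"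
  by (simp add: dom_dist_def dom_proj_def)

lemma dom_dist_ltE:
  assumes "dom_dist D (dom_proj D i x) (dom_proj D i y) < e"
  obtains y' where "dom_proj D i y' = dom_proj D i y" "\<bar>x - y'\<bar> < e"
proof -
  obtain a b where ab: "a \<in> circle_proj (D ! i) x" "b \<in> circle_proj (D ! i) y" "dist a b < e"
    using setdist_ltE[of "circle_proj (D ! i) x" "circle_proj (D ! i) y" e] assms
      circle_proj_self unfolding dom_dist_same by blast
  then obtain m n :: int where "a = x + of_int m * D ! i" "b = y + of_int n * D ! i"
    by (auto simp: circle_proj_def)
  then have "\<bar>x - (y + of_int (n - m) * D ! i)\<bar> < e"
    using ab(3) by (simp add: dist_real_def algebra_simps)
  then show ?thesis by (intro that[of "y + of_int (n - m) * D ! i"]) (simp_all only: dom_proj_shift)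
qed

lemma dom_dist_small:
  assumes "is_domain D" "i < length D" "q \<in> points D" "dom_dist D (dom_proj D i x) q < e"
    "e \<le> D ! i"
  obtains y where "q = dom_proj D i y" "\<bar>x - y\<bar> < e"
proof -
  obtain j y where q: "q = dom_proj D j y" "j < length D" using assms(3) by (auto simp: in_points_iff)
  have "i = j"
  proof (rule ccontr)
    assume "i \<noteq> j"
    then have "dom_dist D (dom_proj D i x) q = sum_list D"
      by (simp add: dom_dist_def q dom_proj_def)
    then show False using assms domain_le_sum_list[of D i] by simp
  qed
  then show ?thesis using dom_dist_ltE[of D i x y e] assms(4) q that by metis
qed

lemma dom_dist_eq:
  assumes "\<bar>x - y\<bar> \<le> D ! i / 2"
  shows "dom_dist D (dom_proj D i x) (dom_proj D i y) = \<bar>x - y\<bar>"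
proof (rule antisym[OF dom_dist_le], rule ccontr)
  let ?d = "dom_dist D (dom_proj D i x) (dom_proj D i y)"
  assume "\<not> \<bar>x - y\<bar> \<le> ?d"
  then obtain y' where y': "dom_proj D i y' = dom_proj D i y" "\<bar>x - y'\<bar> < \<bar>x - y\<bar>"
    using dom_dist_ltE[of D i x y "\<bar>x - y\<bar>"] by auto
  then have "\<bar>y' - y\<bar> < D ! i" using assms by linarith
  then have "y' = y" using y'(1) by (rule dom_proj_near_imp_eq[rotated])
  then show False using y' by simp
qed

lemma interval_lifts_iff:
  assumes "is_domain D"
  shows "interval_lifts D i a b \<longleftrightarrow> i < length D \<and> a < b \<and> b < a + D ! i"
proof -
  have "circle_proj (D ! i) ` {a..b} = circle (D ! i) \<longleftrightarrow> a + D ! i \<le> b"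
    if i: "i < length D" and ab: "a < b"
  proof
    assume "a + D ! i \<le> b"
    have "circle_proj (D ! i) x \<in> circle_proj (D ! i) ` {a..b}" for x
    proof -
      obtain k :: int where "a \<le> x + of_int k * D ! i" "x + of_int k * D ! i < a + D ! i"
        using lift_in_window[OF domain_pos[OF assms i], of a x] by blast
      then have "x + of_int k * D ! i \<in> {a..b}" using \<open>a + D ! i \<le> b\<close> by simp
      moreover have "circle_proj (D ! i) x = circle_proj (D ! i) (x + of_int k * D ! i)"
        unfolding circle_proj_eq_iff by blast
      ultimately show ?thesis by blast
    qed
    then show "circle_proj (D ! i) ` {a..b} = circle (D ! i)" by (auto simp: circle_def)
  next
    assume eq: "circle_proj (D ! i) ` {a..b} = circle (D ! i)"
    show "a + D ! i \<le> b"
    proof (rule ccontr)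
      assume *: "\<not> a + D ! i \<le> b"
      define c where "c = (b + (a + D ! i)) / 2"
      have c: "b < c" "c < a + D ! i" using * by (auto simp: c_def field_simps)
      have "circle_proj (D ! i) c \<in> circle (D ! i)" by (simp add: circle_def)
      then obtain y where y: "y \<in> {a..b}" "circle_proj (D ! i) c = circle_proj (D ! i) y"
        unfolding eq[symmetric] by blast
      then have "dom_proj D i c = dom_proj D i y" by (simp add: dom_proj_def)
      then have "c = y" using y c by (intro dom_proj_near_imp_eq) auto
      then show False using y c by simp
    qed
  qed
  then show ?thesis unfolding interval_lifts_def by (metis not_le)
qed

lemma inj_on_dom_proj: "inj_on (dom_proj D i) {a..<a + D ! i}"
  by (rule inj_onI) (auto intro!: dom_proj_near_imp_eq)

text \<open>All admissible lifts of the end points differ from the given ones by a common period, so that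
  the union in the definition of \<^const>\<open>interval_co\<close> has a single member.\<close>

lemma interval_co_dom_proj:
  assumes "is_domain D" "i < length D" "a < b" "b < a + D ! i"
  shows "interval_co D (dom_proj D i a) (dom_proj D i b) = dom_proj D i ` {a..<b}"
proof -
  have "dom_proj D i' ` {a'..<b'} = dom_proj D i ` {a..<b}"
    if h: "interval_lifts D i' a' b'" "dom_proj D i' a' = dom_proj D i a"
      "dom_proj D i' b' = dom_proj D i b" for i' a' b'
  proof -
    have i': "i' = i" using h by (simp add: dom_proj_eq_iff)
    obtain m n :: int where mn: "a = a' + of_int m * D ! i" "b = b' + of_int n * D ! i"
      using h unfolding i' by (auto simp: dom_proj_eq_iff)
    have ab': "a' < b'" "b' < a' + D ! i" using h(1) unfolding interval_lifts_iff[OF assms(1)] i' by auto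
    have pos: "0 < D ! i" using assms by (intro domain_pos)
    have "of_int (n - m) * D ! i = (b - a) - (b' - a')" using mn by (simp add: algebra_simps)
    then have "of_int (n - m) * D ! i < 1 * D ! i" "(-1) * D ! i < of_int (n - m) * D ! i"
      using ab' assms by simp_all
    then have "real_of_int (n - m) < 1" "-1 < real_of_int (n - m)"
      using pos by (meson mult_less_cancel_right_pos)+
    then have "n = m" by linarith
    then have "{a..<b} = (\<lambda>x. x + of_int m * D ! i) ` {a'..<b'}"
      using mn by (simp add: add.commute[of _ "of_int m * D ! i"])
    then have "dom_proj D i ` {a..<b} = (\<lambda>x. dom_proj D i (x + of_int m * D ! i)) ` {a'..<b'}"
      by (simp only: image_image)
    then show ?thesis unfolding i' dom_proj_shift by simp
  qed
  moreover have "interval_lifts D i a b" using assms by (simp add: interval_lifts_iff)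
  ultimately show ?thesis unfolding interval_co_def by blast
qed

section \<open>Absolutely continuous functions\<close>

definition ac_modulus :: "real set \<Rightarrow> (real \<Rightarrow> real) \<Rightarrow> real \<Rightarrow> real \<Rightarrow> bool" where
  "ac_modulus S g \<epsilon> \<delta> \<longleftrightarrow> (\<forall>(n::nat) u v. (\<forall>k<n. u k \<le> v k \<and> {u k..v k} \<subseteq> S) \<longrightarrow>
     disjoint_family_on (\<lambda>k. {u k<..<v k}) {..<n} \<longrightarrow>
     (\<Sum>k<n. v k - u k) < \<delta> \<longrightarrow> (\<Sum>k<n. \<bar>g (v k) - g (u k)\<bar>) < \<epsilon>)"

lemma absolutely_continuous_on_iff:
  "absolutely_continuous_on S g \<longleftrightarrow> (\<forall>\<epsilon>>0. \<exists>\<delta>>0. ac_modulus S g \<epsilon> \<delta>)"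
  by (simp add: absolutely_continuous_on_def ac_modulus_def)

lemma absolutely_continuous_onE:
  assumes "absolutely_continuous_on S g" "0 < \<epsilon>"
  obtains \<delta> where "0 < \<delta>" "ac_modulus S g \<epsilon> \<delta>"
  using assms unfolding absolutely_continuous_on_iff by blast

lemma ac_modulusI:
  assumes "\<And>(n::nat) u v. \<forall>k<n. u k \<le> v k \<and> {u k..v k} \<subseteq> S \<Longrightarrow>
    disjoint_family_on (\<lambda>k. {u k<..<v k}) {..<n} \<Longrightarrow>
    (\<Sum>k<n. v k - u k) < \<delta> \<Longrightarrow> (\<Sum>k<n. \<bar>g (v k) - g (u k)\<bar>) < \<epsilon>"
  shows "ac_modulus S g \<epsilon> \<delta>"
  using assms unfolding ac_modulus_def by blast

lemma ac_modulusD: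
  fixes n :: nat
  assumes "ac_modulus S g \<epsilon> \<delta>" "\<And>k. k < n \<Longrightarrow> u k \<le> v k \<and> {u k..v k} \<subseteq> S"
    "disjoint_family_on (\<lambda>k. {u k<..<v k}) {..<n}" "(\<Sum>k<n. v k - u k) < \<delta>"
  shows "(\<Sum>k<n. \<bar>g (v k) - g (u k)\<bar>) < \<epsilon>"
  using assms unfolding ac_modulus_def by blast

lemma absolutely_continuous_on_subset:
  "absolutely_continuous_on S g \<Longrightarrow> T \<subseteq> S \<Longrightarrow> absolutely_continuous_on T g"
  unfolding absolutely_continuous_on_def by (meson order_trans)

lemma absolutely_continuous_on_cong:
  assumes "absolutely_continuous_on S g" "\<And>x. x \<in> S \<Longrightarrow> h x = g x"
  shows "absolutely_continuous_on S h"
  unfolding absolutely_continuous_on_iff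
proof (intro allI impI)
  fix \<epsilon> :: real assume "0 < \<epsilon>"
  from absolutely_continuous_onE[OF assms(1) this] obtain \<delta> where \<delta>: "0 < \<delta>"
    "ac_modulus S g \<epsilon> \<delta>" by blast
  show "\<exists>\<delta>>0. ac_modulus S h \<epsilon> \<delta>"
  proof (intro exI[of _ \<delta>] conjI ac_modulusI)
    fix n :: nat and u v
    assume *: "\<forall>k<n. u k \<le> v k \<and> {u k..v k} \<subseteq> S" "disjoint_family_on (\<lambda>k. {u k<..<v k}) {..<n}"
      "(\<Sum>k<n. v k - u k) < \<delta>"
    have "(\<Sum>k<n. \<bar>h (v k) - h (u k)\<bar>) = (\<Sum>k<n. \<bar>g (v k) - g (u k)\<bar>)"
    proof (rule sum.cong)
      fix k assume "k \<in> {..<n}"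
      then have "u k \<in> S" "v k \<in> S" using *(1) by (metis atLeastAtMost_iff lessThan_iff order_refl subsetD)+
      then show "\<bar>h (v k) - h (u k)\<bar> = \<bar>g (v k) - g (u k)\<bar>" using assms(2) by simp
    qed simp
    then show "(\<Sum>k<n. \<bar>h (v k) - h (u k)\<bar>) < \<epsilon>" using ac_modulusD[OF \<delta>(2), of n u v] * by simp
  qed (rule \<delta>)
qed

lemma absolutely_continuous_on_singleton: "absolutely_continuous_on {x} g"
  unfolding absolutely_continuous_on_iff
proof (intro allI impI)
  fix \<epsilon> :: real assume "0 < \<epsilon>"
  show "\<exists>\<delta>>0. ac_modulus {x} g \<epsilon> \<delta>"
  proof (intro exI[of _ 1] conjI ac_modulusI)
    fix n :: nat and u v
    assume *: "\<forall>k<n. u k \<le> v k \<and> {u k..v k} \<subseteq> {x}"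
    have "(\<Sum>k<n. \<bar>g (v k) - g (u k)\<bar>) = 0"
    proof (rule sum.neutral, rule ballI)
      fix k assume "k \<in> {..<n}"
      then have "u k \<in> {x}" "v k \<in> {x}"
        using * by (metis atLeastAtMost_iff lessThan_iff order_refl subsetD)+
      then show "\<bar>g (v k) - g (u k)\<bar> = 0" by simp
    qed
    then show "(\<Sum>k<n. \<bar>g (v k) - g (u k)\<bar>) < \<epsilon>" using \<open>0 < \<epsilon>\<close> by simp
  qed simp
qed

lemma absolutely_continuous_on_add_const:
  "absolutely_continuous_on S (\<lambda>x. g x + c) \<longleftrightarrow> absolutely_continuous_on S g"
  by (simp add: absolutely_continuous_on_def)

lemma absolutely_continuous_on_translation: "absolutely_continuous_on S (\<lambda>x. x + c)"
  unfolding absolutely_continuous_on_iff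
proof (intro allI impI)
  fix \<epsilon> :: real assume "0 < \<epsilon>"
  show "\<exists>\<delta>>0. ac_modulus S (\<lambda>x. x + c) \<epsilon> \<delta>"
  proof (intro exI[of _ \<epsilon>] conjI ac_modulusI)
    fix n :: nat and u v
    assume *: "\<forall>k<n. u k \<le> v k \<and> {u k..v k} \<subseteq> S" "(\<Sum>k<n. v k - u k) < \<epsilon>"
    have "(\<Sum>k<n. \<bar>v k + c - (u k + c)\<bar>) = (\<Sum>k<n. v k - u k)"
      by (rule sum.cong) (use * in auto)
    then show "(\<Sum>k<n. \<bar>v k + c - (u k + c)\<bar>) < \<epsilon>" using * by simp
  qed fact
qed

text \<open>The inner function has to be monotone in order to map disjoint intervals to disjoint
  intervals.\<close>

lemma absolutely_continuous_on_compose: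
  assumes h: "absolutely_continuous_on T h" and k: "absolutely_continuous_on S k"
    and mono: "mono_on S k" and T: "is_interval T" and ST: "k ` S \<subseteq> T"
  shows "absolutely_continuous_on S (\<lambda>x. h (k x))"
  unfolding absolutely_continuous_on_iff
proof (intro allI impI)
  fix \<epsilon> :: real assume "0 < \<epsilon>"
  from absolutely_continuous_onE[OF h this] obtain \<eta> where \<eta>: "0 < \<eta>"
    "ac_modulus T h \<epsilon> \<eta>" by blast
  from absolutely_continuous_onE[OF k \<eta>(1)] obtain \<delta> where \<delta>: "0 < \<delta>"
    "ac_modulus S k \<eta> \<delta>" by blast
  show "\<exists>\<delta>>0. ac_modulus S (\<lambda>x. h (k x)) \<epsilon> \<delta>"
  proof (intro exI[of _ \<delta>] conjI ac_modulusI)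
    fix n :: nat and u v
    assume *: "\<forall>k<n. u k \<le> v k \<and> {u k..v k} \<subseteq> S" "disjoint_family_on (\<lambda>k. {u k<..<v k}) {..<n}"
      "(\<Sum>k<n. v k - u k) < \<delta>"
    have uv: "u i \<in> S" "v i \<in> S" "u i \<le> v i" "k (u i) \<le> k (v i)" if "i < n" for i
    proof -
      show uv: "u i \<in> S" "v i \<in> S" "u i \<le> v i"
        using *(1) that by (metis atLeastAtMost_iff order_refl subsetD)+
      show "k (u i) \<le> k (v i)" using uv mono by (meson mono_onD)
    qed
    show "(\<Sum>i<n. \<bar>h (k (v i)) - h (k (u i))\<bar>) < \<epsilon>"
    proof (rule ac_modulusD[OF \<eta>(2), of n "\<lambda>i. k (u i)" "\<lambda>i. k (v i)"])
      fix i assume i: "i < n"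
      have "k (u i) \<in> T" "k (v i) \<in> T" using uv[OF i] ST by auto
      then have "{k (u i)..k (v i)} \<subseteq> T" using T unfolding is_interval_1 by (meson atLeastAtMost_iff subsetI)
      then show "k (u i) \<le> k (v i) \<and> {k (u i)..k (v i)} \<subseteq> T" using uv[OF i] by simp
    next
      show "disjoint_family_on (\<lambda>i. {k (u i)<..<k (v i)}) {..<n}"
        unfolding disjoint_family_on_def
      proof (intro ballI impI)
        fix i j assume ij: "i \<in> {..<n}" "j \<in> {..<n}" "i \<noteq> j"
        then have i: "i < n" and j: "j < n" by auto
        have "{u i<..<v i} \<inter> {u j<..<v j} = {}"
          using *(2) ij by (auto simp: disjoint_family_on_def)
        then have "v i \<le> u j \<or> v j \<le> u i \<or> u i = v i \<or> u j = v j"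
          using uv[OF i] uv[OF j] dense[of "max (u i) (u j)" "min (v i) (v j)"] by force
        then show "{k (u i)<..<k (v i)} \<inter> {k (u j)<..<k (v j)} = {}"
        proof (elim disjE)
          assume "v i \<le> u j"
          then have "k (v i) \<le> k (u j)" using uv[OF i] uv[OF j] mono by (meson mono_onD)
          then show ?thesis by auto
        next
          assume "v j \<le> u i"
          then have "k (v j) \<le> k (u i)" using uv[OF i] uv[OF j] mono by (meson mono_onD)
          then show ?thesis by auto
        qed auto
      qed
      have "(\<Sum>i<n. k (v i) - k (u i)) = (\<Sum>i<n. \<bar>k (v i) - k (u i)\<bar>)"
        by (rule sum.cong) (use uv in auto)
      also have "\<dots> < \<eta>" using ac_modulusD[OF \<delta>(2), of n u v] * by blast
      finally show "(\<Sum>i<n. k (v i) - k (u i)) < \<eta>" .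
    qed
  qed (rule \<delta>)
qed

lemma absolutely_continuous_on_shift_interval:
  assumes "absolutely_continuous_on T h" "is_interval T" "\<And>x. x \<in> S \<Longrightarrow> x + c \<in> T"
  shows "absolutely_continuous_on S (\<lambda>x. h (x + c))"
  using assms
  by (intro absolutely_continuous_on_compose[OF assms(1) absolutely_continuous_on_translation])
     (auto simp: mono_on_def)

lemma absolutely_continuous_on_uniform:
  assumes "absolutely_continuous_on S g" "is_interval S" "0 < \<epsilon>"
  obtains \<delta> where "0 < \<delta>" "\<And>x y. x \<in> S \<Longrightarrow> y \<in> S \<Longrightarrow> \<bar>x - y\<bar> < \<delta> \<Longrightarrow> \<bar>g x - g y\<bar> < \<epsilon>"
proof -
  from absolutely_continuous_onE[OF assms(1,3)] obtain \<delta> where \<delta>: "0 < \<delta>"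
    "ac_modulus S g \<epsilon> \<delta>" by blast
  have *: "\<bar>g x - g y\<bar> < \<epsilon>" if "x \<in> S" "y \<in> S" "\<bar>x - y\<bar> < \<delta>" "y \<le> x" for x y
  proof -
    have "{y..x} \<subseteq> S" using that assms(2) unfolding is_interval_1 by (meson atLeastAtMost_iff subsetI)
    then show ?thesis
      using ac_modulusD[OF \<delta>(2), of "Suc 0" "\<lambda>_. y" "\<lambda>_. x"] that by (simp add: disjoint_family_on_def)
  qed
  show ?thesis
  proof (rule that[OF \<delta>(1)])
    show "\<bar>g x - g y\<bar> < \<epsilon>" if "x \<in> S" "y \<in> S" "\<bar>x - y\<bar> < \<delta>" for x y
      using *[of x y] *[of y x] that by (cases "y \<le> x") (auto simp: abs_minus_commute)
  qed
qed

lemma absolutely_continuous_on_imp_uniformly_continuous_on: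
  assumes "absolutely_continuous_on S g" "is_interval S"
  shows "uniformly_continuous_on S g"
  unfolding uniformly_continuous_on_def
proof (intro allI impI)
  fix e :: real assume "0 < e"
  then obtain \<delta> where "0 < \<delta>" "\<And>x y. x \<in> S \<Longrightarrow> y \<in> S \<Longrightarrow> \<bar>x - y\<bar> < \<delta> \<Longrightarrow> \<bar>g x - g y\<bar> < e"
    using absolutely_continuous_on_uniform[OF assms] by metis
  then show "\<exists>d>0. \<forall>x\<in>S. \<forall>x'\<in>S. dist x' x < d \<longrightarrow> dist (g x') (g x) < e"
    by (auto simp: dist_real_def)
qed

lemma absolutely_continuous_on_concat:
  assumes "absolutely_continuous_on {a..b} g" "absolutely_continuous_on {b..c} g"
  shows "absolutely_continuous_on {a..c} g"
  unfolding absolutely_continuous_on_iff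
proof (intro allI impI)
  fix \<epsilon> :: real assume "0 < \<epsilon>"
  then have e: "0 < \<epsilon> / 2" by simp
  from absolutely_continuous_onE[OF assms(1) e] obtain \<delta>1 where \<delta>1: "0 < \<delta>1"
    "ac_modulus {a..b} g (\<epsilon> / 2) \<delta>1" by blast
  from absolutely_continuous_onE[OF assms(2) e] obtain \<delta>2 where \<delta>2: "0 < \<delta>2"
    "ac_modulus {b..c} g (\<epsilon> / 2) \<delta>2" by blast
  show "\<exists>\<delta>>0. ac_modulus {a..c} g \<epsilon> \<delta>"
  proof (intro exI[of _ "min \<delta>1 \<delta>2"] conjI ac_modulusI)
    fix n :: nat and u v
    assume *: "\<forall>k<n. u k \<le> v k \<and> {u k..v k} \<subseteq> {a..c}" "disjoint_family_on (\<lambda>k. {u k<..<v k}) {..<n}"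
      "(\<Sum>k<n. v k - u k) < min \<delta>1 \<delta>2"
    have uv: "u k \<le> v k" "a \<le> u k" "v k \<le> c" if "k < n" for k
    proof -
      have "u k \<in> {a..c}" "v k \<in> {a..c}" "u k \<le> v k"
        using *(1) that by (metis atLeastAtMost_iff order_refl subsetD)+
      then show "u k \<le> v k" "a \<le> u k" "v k \<le> c" by auto
    qed
    \<comment> \<open>Cut every interval at \<open>b\<close>; the parts on the other side of \<open>b\<close> become degenerate.\<close>
    have le1: "(\<Sum>k<n. min (v k) b - min (u k) b) \<le> (\<Sum>k<n. v k - u k)"
      and le2: "(\<Sum>k<n. max (v k) b - max (u k) b) \<le> (\<Sum>k<n. v k - u k)"
      using uv by (intro sum_mono; force)+
    have "(\<Sum>k<n. \<bar>g (min (v k) b) - g (min (u k) b)\<bar>) < \<epsilon> / 2"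
    proof (cases "a \<le> b")
      case True
      show ?thesis
      proof (rule ac_modulusD[OF \<delta>1(2)])
        show "min (u k) b \<le> min (v k) b \<and> {min (u k) b..min (v k) b} \<subseteq> {a..b}" if "k < n" for k
          using uv[OF that] True by auto
        show "disjoint_family_on (\<lambda>k. {min (u k) b<..<min (v k) b}) {..<n}"
          using *(2) unfolding disjoint_family_on_def by fastforce
        show "(\<Sum>k<n. min (v k) b - min (u k) b) < \<delta>1" using le1 *(3) by linarith
      qed
    next
      case False
      then have "(\<Sum>k<n. \<bar>g (min (v k) b) - g (min (u k) b)\<bar>) = 0"
        using uv by (intro sum.neutral) (force simp: min_def)
      then show ?thesis using e by simp
    qed
    moreover have "(\<Sum>k<n. \<bar>g (max (v k) b) - g (max (u k) b)\<bar>) < \<epsilon> / 2"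
    proof (cases "b \<le> c")
      case True
      show ?thesis
      proof (rule ac_modulusD[OF \<delta>2(2)])
        show "max (u k) b \<le> max (v k) b \<and> {max (u k) b..max (v k) b} \<subseteq> {b..c}" if "k < n" for k
          using uv[OF that] True by auto
        show "disjoint_family_on (\<lambda>k. {max (u k) b<..<max (v k) b}) {..<n}"
          using *(2) unfolding disjoint_family_on_def by fastforce
        show "(\<Sum>k<n. max (v k) b - max (u k) b) < \<delta>2" using le2 *(3) by linarith
      qed
    next
      case False
      then have "(\<Sum>k<n. \<bar>g (max (v k) b) - g (max (u k) b)\<bar>) = 0"
        using uv by (intro sum.neutral) (force simp: max_def)
      then show ?thesis using e by simp
    qed
    moreover have "(\<Sum>k<n. \<bar>g (v k) - g (u k)\<bar>)
        \<le> (\<Sum>k<n. \<bar>g (min (v k) b) - g (min (u k) b)\<bar> + \<bar>g (max (v k) b) - g (max (u k) b)\<bar>)"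
      by (intro sum_mono) (auto simp: min_def max_def)
    ultimately show "(\<Sum>k<n. \<bar>g (v k) - g (u k)\<bar>) < \<epsilon>"
      by (simp add: sum.distrib)
  qed (use \<delta>1 \<delta>2 in simp)
qed

text \<open>The estimate for \<open>{a..<b}\<close> with half of the tolerance applies to the intervals cut off at
  \<open>c < b\<close>, and it survives the limit \<open>c \<rightarrow> b\<close>.\<close>

lemma absolutely_continuous_on_close:
  assumes "absolutely_continuous_on {a..<b} g" "(g \<longlongrightarrow> g b) (at_left b)" "a < b"
  shows "absolutely_continuous_on {a..b} g"
  unfolding absolutely_continuous_on_iff
proof (intro allI impI)
  fix \<epsilon> :: real assume "0 < \<epsilon>"
  then have e: "0 < \<epsilon> / 2" by simp
  from absolutely_continuous_onE[OF assms(1) e] obtain \<delta> where \<delta>: "0 < \<delta>"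
    "ac_modulus {a..<b} g (\<epsilon> / 2) \<delta>" by blast
  show "\<exists>\<delta>>0. ac_modulus {a..b} g \<epsilon> \<delta>"
  proof (intro exI[of _ \<delta>] conjI ac_modulusI)
    fix n :: nat and u v
    assume *: "\<forall>k<n. u k \<le> v k \<and> {u k..v k} \<subseteq> {a..b}" "disjoint_family_on (\<lambda>k. {u k<..<v k}) {..<n}"
      "(\<Sum>k<n. v k - u k) < \<delta>"
    have uv: "u k \<le> v k" "a \<le> u k" "v k \<le> b" if "k < n" for k
    proof -
      have "u k \<in> {a..b}" "v k \<in> {a..b}" "u k \<le> v k"
        using *(1) that by (metis atLeastAtMost_iff order_refl subsetD)+
      then show "u k \<le> v k" "a \<le> u k" "v k \<le> b" by auto
    qed
    have lim: "((\<lambda>c. g (min w c)) \<longlongrightarrow> g w) (at_left b)" if "w \<le> b" for w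
    proof (cases "w = b")
      case True
      have "((\<lambda>c. g (min w c)) \<longlongrightarrow> g w) (at_left b) \<longleftrightarrow> (g \<longlongrightarrow> g b) (at_left b)"
        unfolding True by (intro filterlim_cong) (auto simp: eventually_at_left_field min_def intro!: exI[of _ a] assms(3))
      then show ?thesis using assms(2) by simp
    next
      case False
      then have "w < b" using that by simp
      then have "eventually (\<lambda>c. g (min w c) = g w) (at_left b)"
        unfolding eventually_at_left_field by (intro exI[of _ w]) auto
      then show ?thesis by (rule tendsto_eventually)
    qed
    have "((\<lambda>c. \<Sum>k<n. \<bar>g (min (v k) c) - g (min (u k) c)\<bar>) \<longlongrightarrow> (\<Sum>k<n. \<bar>g (v k) - g (u k)\<bar>)) (at_left b)"
      by (intro tendsto_sum tendsto_rabs tendsto_diff lim) (use uv in force)+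
    moreover have "eventually (\<lambda>c. (\<Sum>k<n. \<bar>g (min (v k) c) - g (min (u k) c)\<bar>) \<le> \<epsilon> / 2) (at_left b)"
      unfolding eventually_at_left_field
    proof (intro exI[of _ a] conjI allI impI assms(3))
      fix c assume c: "a < c" "c < b"
      have "(\<Sum>k<n. min (v k) c - min (u k) c) \<le> (\<Sum>k<n. v k - u k)"
        using uv by (intro sum_mono) force
      then have "(\<Sum>k<n. \<bar>g (min (v k) c) - g (min (u k) c)\<bar>) < \<epsilon> / 2"
      proof (intro ac_modulusD[OF \<delta>(2)])
        show "min (u k) c \<le> min (v k) c \<and> {min (u k) c..min (v k) c} \<subseteq> {a..<b}" if "k < n" for k
          using uv[OF that] c by auto
        show "disjoint_family_on (\<lambda>k. {min (u k) c<..<min (v k) c}) {..<n}"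
          using *(2) unfolding disjoint_family_on_def by fastforce
      qed (use *(3) in linarith)
      then show "(\<Sum>k<n. \<bar>g (min (v k) c) - g (min (u k) c)\<bar>) \<le> \<epsilon> / 2" by simp
    qed
    ultimately have "(\<Sum>k<n. \<bar>g (v k) - g (u k)\<bar>) \<le> \<epsilon> / 2"
      by (intro tendsto_upperbound) (auto simp: trivial_limit_at_left_real)
    then show "(\<Sum>k<n. \<bar>g (v k) - g (u k)\<bar>) < \<epsilon>" using \<open>0 < \<epsilon>\<close> by linarith
  qed (rule \<delta>)
qed


section \<open>Germs\<close>

text \<open>The closed one-sided neighbourhood of \<open>x\<close>: on the right if \<open>r\<close> holds, on the left otherwise.\<close>

definition side :: "bool \<Rightarrow> real \<Rightarrow> real \<Rightarrow> real set" where
  "side r x \<delta> = (if r then {x..x + \<delta>} else {x - \<delta>..x})"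

text \<open>The relation that \<open>h\<close> carries the right (or left) germ at \<open>p\<close> to the right (left) germ at \<open>q\<close>.
  The lift \<open>k\<close> is required on the closed side, where \<open>k x\<close> is the one-sided limit, but it describes
  \<open>h\<close> only away from \<open>x\<close>, so that left germs make sense at a jump.
  Absolute continuity and monotonicity belong to the definition because both are inherited by
  compositions.\<close>

definition germ :: "bool \<Rightarrow> domain_lengths \<Rightarrow> domain_lengths \<Rightarrow> (point \<Rightarrow> point) \<Rightarrow> point \<Rightarrow> point \<Rightarrow> bool" where
  "germ r D D' h p q \<longleftrightarrow> (\<exists>i<length D. \<exists>j<length D'. \<exists>x k \<delta>. 0 < \<delta> \<and>
     p = dom_proj D i x \<and> q = dom_proj D' j (k x) \<and>
     absolutely_continuous_on (side r x \<delta>) k \<and> strict_mono_on (side r x \<delta>) k \<and>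
     (\<forall>y\<in>side r x \<delta> - {x}. h (dom_proj D i y) = dom_proj D' j (k y)))"

lemma side_mono: "\<delta> \<le> \<delta>' \<Longrightarrow> side r x \<delta> \<subseteq> side r x \<delta>'"
  by (auto simp: side_def)

lemma in_side: "0 \<le> \<delta> \<Longrightarrow> x \<in> side r x \<delta>"
  by (simp add: side_def)

lemma is_interval_side [simp]: "is_interval (side r x \<delta>)"
  by (simp add: side_def)

lemma side_dist: "y \<in> side r x \<delta> \<Longrightarrow> \<bar>y - x\<bar> \<le> \<delta>"
  by (auto simp: side_def split: if_splits)

lemma side_add: "y \<in> side r x \<delta> \<Longrightarrow> y + c \<in> side r (x + c) \<delta>"
  by (auto simp: side_def split: if_splits)

lemma strict_mono_on_side:
  assumes "strict_mono_on (side r x \<delta>) k" "y \<in> side r x \<delta>" "y \<noteq> x" "\<bar>k y - k x\<bar> \<le> \<epsilon>"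
  shows "k y \<in> side r (k x) \<epsilon> - {k x}"
proof (cases r)
  case True
  then have "k x < k y" using assms by (intro strict_mono_onD[OF assms(1)]) (auto simp: side_def)
  then show ?thesis using True assms(4) by (auto simp: side_def)
next
  case False
  then have "k y < k x" using assms by (intro strict_mono_onD[OF assms(1)]) (auto simp: side_def)
  then show ?thesis using False assms(4) by (auto simp: side_def)
qed

lemma germI:
  assumes "i < length D" "j < length D'" "0 < \<delta>"
    "absolutely_continuous_on (side r x \<delta>) k" "strict_mono_on (side r x \<delta>) k"
    "\<And>y. y \<in> side r x \<delta> \<Longrightarrow> y \<noteq> x \<Longrightarrow> h (dom_proj D i y) = dom_proj D' j (k y)"
    "q = dom_proj D' j (k x)"
  shows "germ r D D' h (dom_proj D i x) q"
  using assms unfolding germ_def by blast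

lemma germ_points: "germ r D D' h p q \<Longrightarrow> p \<in> points D \<and> q \<in> points D'"
  by (auto simp: germ_def)

text \<open>Lifts of \<open>p\<close> and of \<open>q\<close> can be prescribed, because shifting both by periods changes nothing.
  This normal form is what makes germs composable.\<close>

lemma germE:
  assumes "germ r D D' h (dom_proj D i x) (dom_proj D' j z)" "0 < \<eta>"
  obtains k \<delta> where "0 < \<delta>" "\<delta> \<le> \<eta>" "k x = z"
    "absolutely_continuous_on (side r x \<delta>) k" "strict_mono_on (side r x \<delta>) k"
    "\<And>y. y \<in> side r x \<delta> \<Longrightarrow> y \<noteq> x \<Longrightarrow> h (dom_proj D i y) = dom_proj D' j (k y)"
    "i < length D" "j < length D'"
proof -
  from assms(1) obtain i' j' x' k \<delta> where *: "i' < length D" "j' < length D'" "0 < \<delta>"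
     "dom_proj D i x = dom_proj D i' x'" "dom_proj D' j z = dom_proj D' j' (k x')"
     "absolutely_continuous_on (side r x' \<delta>) k" "strict_mono_on (side r x' \<delta>) k"
     "\<And>y. y \<in> side r x' \<delta> \<Longrightarrow> y \<noteq> x' \<Longrightarrow> h (dom_proj D i' y) = dom_proj D' j' (k y)"
    unfolding germ_def by blast
  obtain m :: int where m: "i' = i" "x' = x + of_int m * D ! i"
    using *(4) by (auto simp: dom_proj_eq_iff)
  obtain n :: int where n: "j' = j" "k x' = z + of_int n * D' ! j"
    using *(5) by (auto simp: dom_proj_eq_iff)
  define a where "a = of_int m * D ! i"
  define b where "b = of_int (- n) * D' ! j"
  define k' where "k' y = k (y + a) + b" for y
  have a: "dom_proj D i (y + a) = dom_proj D i y" for y unfolding a_def by (rule dom_proj_shift)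
  have b: "dom_proj D' j (y + b) = dom_proj D' j y" for y unfolding b_def by (rule dom_proj_shift)
  define \<delta>' where "\<delta>' = min \<delta> \<eta>"
  have sub: "y + a \<in> side r x' \<delta>" if "y \<in> side r x \<delta>'" for y
    using side_add[OF that, of a] side_mono[of \<delta>' \<delta> r x'] m by (auto simp: a_def \<delta>'_def)
  show ?thesis
  proof (rule that[of \<delta>' k'])
    show "0 < \<delta>'" "\<delta>' \<le> \<eta>" using * assms(2) by (auto simp: \<delta>'_def)
    show "k' x = z" using m n by (simp add: k'_def a_def b_def)
    show "absolutely_continuous_on (side r x \<delta>') k'"
      unfolding k'_def absolutely_continuous_on_add_const
      by (rule absolutely_continuous_on_shift_interval[OF *(6)]) (use sub in auto)
    show "strict_mono_on (side r x \<delta>') k'"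
      using *(7) sub unfolding k'_def strict_mono_on_def by simp
    show "h (dom_proj D i y) = dom_proj D' j (k' y)" if "y \<in> side r x \<delta>'" "y \<noteq> x" for y
    proof -
      have "h (dom_proj D i (y + a)) = dom_proj D' j (k (y + a))"
        using *(8)[of "y + a"] sub[OF that(1)] that(2) m n by (auto simp: a_def)
      then show ?thesis by (simp add: a b k'_def)
    qed
  qed (use * m n in auto)
qed

lemma germ_obtain_lifts:
  assumes "germ r D D' h p q"
  obtains i x j z where "i < length D" "p = dom_proj D i x" "j < length D'" "q = dom_proj D' j z"
  using germ_points[OF assms] by (auto simp: in_points_iff)

lemma germ_cong:
  assumes "germ r D D' h p q" "\<And>p. p \<in> points D \<Longrightarrow> h' p = h p"
  shows "germ r D D' h' p q"
  using assms(1) unfolding germ_def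
  by (metis assms(2) dom_proj_in_points)

lemma germ_compose:
  assumes "germ r D D' h p q" "germ r D' D'' h' q s"
  shows "germ r D D'' (\<lambda>p. h' (h p)) p s"
proof -
  obtain i x j z where p: "p = dom_proj D i x" and q: "q = dom_proj D' j z"
    using germ_obtain_lifts[OF assms(1)] by metis
  obtain l w where s: "s = dom_proj D'' l w"
    using germ_obtain_lifts[OF assms(2)] by metis
  from germE[OF assms(2)[unfolded q s] zero_less_one] obtain k' \<delta>' where k':
    "0 < \<delta>'" "k' z = w" "absolutely_continuous_on (side r z \<delta>') k'" "strict_mono_on (side r z \<delta>') k'"
    "\<And>y. y \<in> side r z \<delta>' \<Longrightarrow> y \<noteq> z \<Longrightarrow> h' (dom_proj D' j y) = dom_proj D'' l (k' y)"
    "l < length D''" by metis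
  from germE[OF assms(1)[unfolded p q] zero_less_one] obtain k \<delta> where k:
    "0 < \<delta>" "k x = z" "absolutely_continuous_on (side r x \<delta>) k" "strict_mono_on (side r x \<delta>) k"
    "\<And>y. y \<in> side r x \<delta> \<Longrightarrow> y \<noteq> x \<Longrightarrow> h (dom_proj D i y) = dom_proj D' j (k y)"
    "i < length D" by metis
  obtain \<eta> where \<eta>: "0 < \<eta>" "\<And>u v. u \<in> side r x \<delta> \<Longrightarrow> v \<in> side r x \<delta> \<Longrightarrow> \<bar>u - v\<bar> < \<eta> \<Longrightarrow> \<bar>k u - k v\<bar> < \<delta>'"
    using absolutely_continuous_on_uniform[OF k(3) _ k'(1)] by (metis is_interval_side)
  define d where "d = min \<delta> (\<eta> / 2)"
  have d: "0 < d" "side r x d \<subseteq> side r x \<delta>" using k \<eta> by (auto simp: d_def intro!: side_mono)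
  have in': "k y \<in> side r z \<delta>' - {z}" if "y \<in> side r x d" "y \<noteq> x" for y
  proof -
    have "\<bar>y - x\<bar> < \<eta>" using side_dist[OF that(1)] \<eta>(1) by (auto simp: d_def)
    then have "\<bar>k y - k x\<bar> \<le> \<delta>'" using \<eta>(2)[of y x] that d in_side[of \<delta> x r] k by auto
    then show ?thesis using strict_mono_on_side[OF k(4), of y \<delta>'] that d k(2) by auto
  qed
  have sub: "k ` side r x d \<subseteq> side r z \<delta>'"
    using in' k(2) in_side[of \<delta>' z r] k'(1) by (force)
  have smd: "strict_mono_on (side r x d) k" using k(4) d(2) by (rule monotone_on_subset)
  show ?thesis unfolding p
  proof (rule germI[of i _ l _ d])
    show "absolutely_continuous_on (side r x d) (\<lambda>y. k' (k y))"
      by (rule absolutely_continuous_on_compose[OF k'(3) absolutely_continuous_on_subset[OF k(3) d(2)]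
            strict_mono_on_imp_mono_on[OF smd] is_interval_side sub])
    show "strict_mono_on (side r x d) (\<lambda>y. k' (k y))"
    proof (rule strict_mono_onI)
      fix u v assume "u \<in> side r x d" "v \<in> side r x d" "u < v"
      then show "k' (k u) < k' (k v)"
        using sub strict_mono_onD[OF smd, of u v] strict_mono_onD[OF k'(4), of "k u" "k v"] by auto
    qed
    show "h' (h (dom_proj D i y)) = dom_proj D'' l (k' (k y))" if "y \<in> side r x d" "y \<noteq> x" for y
      using k(5)[of y] k'(5)[of "k y"] in'[OF that] that d by auto
  qed (use k k' d s in auto)
qed

lemma germ_translation:
  assumes "i < length D" "j < length D'" "0 < \<delta>"
    "\<And>y. y \<in> side r x \<delta> \<Longrightarrow> y \<noteq> x \<Longrightarrow> h (dom_proj D i y) = dom_proj D' j (y + c)"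
  shows "germ r D D' h (dom_proj D i x) (dom_proj D' j (x + c))"
  by (rule germI[of i _ j _ \<delta> r x "\<lambda>y. y + c"])
     (use assms in \<open>auto simp: absolutely_continuous_on_translation strict_mono_on_def\<close>)

lemma germ_id:
  assumes "p \<in> points D" "\<And>p. p \<in> points D \<Longrightarrow> h p = p"
  shows "germ r D D h p p"
proof -
  obtain i x where p: "i < length D" "p = dom_proj D i x" using assms by (auto simp: in_points_iff)
  show ?thesis
    using germ_translation[of i D i D 1 r x h 0] p assms(2) by simp
qed

lemma germ_limit:
  assumes "germ r D D' h (dom_proj D i x) q" "0 < \<epsilon>"
  obtains \<delta> where "0 < \<delta>"
    "\<And>y. y \<in> side r x \<delta> \<Longrightarrow> y \<noteq> x \<Longrightarrow> h (dom_proj D i y) \<in> points D' \<and> dom_dist D' (h (dom_proj D i y)) q < \<epsilon>"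
proof -
  obtain j z where q: "q = dom_proj D' j z" using germ_obtain_lifts[OF assms(1)] by metis
  from germE[OF assms(1)[unfolded q] zero_less_one] obtain k \<delta> where k:
    "0 < \<delta>" "k x = z" "absolutely_continuous_on (side r x \<delta>) k"
    "\<And>y. y \<in> side r x \<delta> \<Longrightarrow> y \<noteq> x \<Longrightarrow> h (dom_proj D i y) = dom_proj D' j (k y)"
    "j < length D'" by metis
  obtain \<eta> where \<eta>: "0 < \<eta>" "\<And>u v. u \<in> side r x \<delta> \<Longrightarrow> v \<in> side r x \<delta> \<Longrightarrow> \<bar>u - v\<bar> < \<eta> \<Longrightarrow> \<bar>k u - k v\<bar> < \<epsilon>"
    using absolutely_continuous_on_uniform[OF k(3) _ assms(2)] by (metis is_interval_side)
  define d where "d = min \<delta> (\<eta> / 2)"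
  have d: "0 < d" "side r x d \<subseteq> side r x \<delta>" using k \<eta> by (auto simp: d_def intro!: side_mono)
  show ?thesis
  proof (rule that[OF d(1)])
    fix y assume y: "y \<in> side r x d" "y \<noteq> x"
    have "\<bar>y - x\<bar> < \<eta>" using side_dist[OF y(1)] \<eta>(1) by (auto simp: d_def)
    then have "\<bar>k y - k x\<bar> < \<epsilon>" using \<eta>(2)[of y x] y d in_side[of \<delta> x r] k by auto
    then have "dom_dist D' (dom_proj D' j (k y)) q < \<epsilon>"
      using dom_dist_le[of D' j "k y" z] k(2) q by simp
    then show "h (dom_proj D i y) \<in> points D' \<and> dom_dist D' (h (dom_proj D i y)) q < \<epsilon>"
      using k(4,5) y d by auto
  qed
qed

text \<open>A germ determines the one-sided limit of the map. This single argument gives the uniqueness of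
  germs and the comparison of germs with the two notions of continuity.\<close>

lemma limit_eq_germ:
  assumes D': "is_domain D'" and g: "germ r D D' h (dom_proj D i x) q" and s: "s \<in> points D'"
    and lim: "\<And>\<epsilon>. 0 < \<epsilon> \<Longrightarrow> \<exists>\<delta>>0. \<forall>y\<in>side r x \<delta> - {x}. dom_dist D' s (h (dom_proj D i y)) < \<epsilon>"
  shows "q = s"
proof -
  interpret Metric_space "points D'" "dom_dist D'" by (rule Metric_space_domain) fact
  have q: "q \<in> points D'" using germ_points[OF g] by simp
  have "dom_dist D' s q \<le> 0 + e" if e: "0 < e" for e
  proof -
    have e2: "0 < e / 2" using e by simp
    obtain \<delta> where \<delta>: "0 < \<delta>" "\<And>y. y \<in> side r x \<delta> \<Longrightarrow> y \<noteq> x \<Longrightarrow>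
      h (dom_proj D i y) \<in> points D' \<and> dom_dist D' (h (dom_proj D i y)) q < e / 2"
      using germ_limit[OF g e2] by blast
    obtain \<delta>' where \<delta>': "0 < \<delta>'" "\<forall>y\<in>side r x \<delta>' - {x}. dom_dist D' s (h (dom_proj D i y)) < e / 2"
      using lim[OF e2] by blast
    define y where "y = (if r then x + min \<delta> \<delta>' else x - min \<delta> \<delta>')"
    have "y \<in> side r x \<delta>" "y \<in> side r x \<delta>' - {x}" "y \<noteq> x"
      using \<delta>(1) \<delta>'(1) by (auto simp: y_def side_def)
    then have *: "h (dom_proj D i y) \<in> points D'" "dom_dist D' (h (dom_proj D i y)) q < e / 2"
       "dom_dist D' s (h (dom_proj D i y)) < e / 2" using \<delta>(2) \<delta>'(2) by blast+
    have "dom_dist D' s q \<le> dom_dist D' s (h (dom_proj D i y)) + dom_dist D' (h (dom_proj D i y)) q"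
      by (rule triangle) (use q s * in auto)
    then show ?thesis using * by linarith
  qed
  then have "dom_dist D' s q \<le> 0" by (rule field_le_epsilon)
  then show ?thesis using q s by (metis nonneg order_antisym zero)
qed

lemma germ_unique:
  assumes "is_domain D'" "germ r D D' h p q" "germ r D D' h p q'"
  shows "q = q'"
proof -
  interpret Metric_space "points D'" "dom_dist D'" by (rule Metric_space_domain) fact
  obtain i x where p: "p = dom_proj D i x" using germ_obtain_lifts[OF assms(2)] by metis
  show ?thesis
  proof (rule limit_eq_germ[OF assms(1) assms(2)[unfolded p]])
    show "q' \<in> points D'" using germ_points assms(3) by blast
    fix \<epsilon> :: real assume "0 < \<epsilon>"
    then obtain \<delta> where "0 < \<delta>" "\<And>y. y \<in> side r x \<delta> \<Longrightarrow> y \<noteq> x \<Longrightarrow>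
        dom_dist D' (h (dom_proj D i y)) q' < \<epsilon>"
      using germ_limit[OF assms(3)[unfolded p]] by metis
    then show "\<exists>\<delta>>0. \<forall>y\<in>side r x \<delta> - {x}. dom_dist D' q' (h (dom_proj D i y)) < \<epsilon>"
      by (metis DiffD1 DiffD2 commute singletonI)
  qed
qed

section \<open>From germs to intervals\<close>

text \<open>Local lifts of a map that is compatible with germs on both sides are glued along the interval
  by the bisection principle \<open>Bolzano\<close>; two lifts that meet at a point differ by a period.\<close>

lemma germ_lift_Icc:
  assumes D': "is_domain D'" and i: "i < length D" and ab: "a < b"
    and R: "\<And>y. y \<in> {a..<b} \<Longrightarrow> germ True D D' h (dom_proj D i y) (h (dom_proj D i y))"
    and L: "\<And>y. y \<in> {a<..b} \<Longrightarrow> germ False D D' h (dom_proj D i y) (h (dom_proj D i y))"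
  obtains j g where "j < length D'" "absolutely_continuous_on {a..b} g" "strict_mono_on {a..b} g"
    "\<And>y. y \<in> {a..b} \<Longrightarrow> h (dom_proj D i y) = dom_proj D' j (g y)"
proof -
  define Q where "Q j g u v \<longleftrightarrow> j < length D' \<and> absolutely_continuous_on {u..v} g \<and>
     strict_mono_on {u..v} g \<and> (\<forall>y\<in>{u..v}. h (dom_proj D i y) = dom_proj D' j (g y))" for j g u v
  have concat: "Q j (\<lambda>y. if y \<le> v then g1 y else g2 y) u w"
    if Q: "Q j g1 u v" "Q j g2 v w" "g1 v = g2 v" and uvw: "u \<le> v" "v \<le> w" for j g1 g2 u v w
  proof -
    let ?g = "\<lambda>y. if y \<le> v then g1 y else g2 y"
    have "absolutely_continuous_on {u..v} ?g"
      by (rule absolutely_continuous_on_cong[of _ g1]) (use Q in \<open>auto simp: Q_def\<close>)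
    moreover have "absolutely_continuous_on {v..w} ?g"
      by (rule absolutely_continuous_on_cong[of _ g2]) (use Q in \<open>auto simp: Q_def\<close>)
    ultimately have "absolutely_continuous_on {u..w} ?g" by (rule absolutely_continuous_on_concat)
    moreover have "strict_mono_on {u..w} ?g"
    proof (rule strict_mono_onI)
      fix y z assume yz: "y \<in> {u..w}" "z \<in> {u..w}" "y < z"
      have 1: "g1 y < g1 z" if "z \<le> v" using Q(1) yz that by (auto simp: Q_def strict_mono_on_def)
      have 2: "g2 y < g2 z" if "v \<le> y" using Q(2) yz that by (auto simp: Q_def strict_mono_on_def)
      have 3: "g1 y \<le> g1 v" if "y \<le> v" using Q(1) yz that uvw
        by (cases "y = v") (auto simp: Q_def strict_mono_on_def intro: less_imp_le)
      have 4: "g2 v < g2 z" if "v < z" using Q(2) yz that uvw by (auto simp: Q_def strict_mono_on_def)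
      show "?g y < ?g z" using 1 2 3 4 Q(3) yz by (auto simp: not_le)
    qed
    moreover have "\<forall>y\<in>{u..w}. h (dom_proj D i y) = dom_proj D' j (?g y)"
      using Q by (auto simp: Q_def)
    ultimately show ?thesis using Q by (simp add: Q_def)
  qed
  have shift: "Q j (\<lambda>y. g y + of_int n * D' ! j) u v" if "Q j g u v" for j g u v and n :: int
    using that by (simp add: Q_def absolutely_continuous_on_add_const strict_mono_on_def)
  have local: "\<exists>k \<delta>. 0 < \<delta> \<and> k x = z \<and>
      (\<forall>v\<in>side r x \<delta>. a \<le> v \<longrightarrow> v \<le> b \<longrightarrow> Q j k (min x v) (max x v))"
    if x: "a \<le> x" "x \<le> b" and z: "h (dom_proj D i x) = dom_proj D' j z" "j < length D'" for r x z j
  proof (cases "x = (if r then b else a)")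
    case True
    then have "Q j (\<lambda>_. z) (min x v) (max x v)" if "v \<in> side r x 1" "a \<le> v" "v \<le> b" for v
      using that z by (cases r)
        (auto simp: Q_def side_def absolutely_continuous_on_singleton strict_mono_on_def)
    then show ?thesis by (intro exI[of _ "\<lambda>_. z"] exI[of _ 1]) simp
  next
    case False
    then have "germ r D D' h (dom_proj D i x) (dom_proj D' j z)"
      using R[of x] L[of x] x z by (cases r) simp_all
    from germE[OF this zero_less_one] obtain k \<delta> where k: "0 < \<delta>" "k x = z"
      "absolutely_continuous_on (side r x \<delta>) k" "strict_mono_on (side r x \<delta>) k"
      "\<And>y. y \<in> side r x \<delta> \<Longrightarrow> y \<noteq> x \<Longrightarrow> h (dom_proj D i y) = dom_proj D' j (k y)" by metis
    have "Q j k (min x v) (max x v)" if v: "v \<in> side r x \<delta>" for v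
    proof -
      have s: "{min x v..max x v} \<subseteq> side r x \<delta>" using v by (auto simp: side_def split: if_splits)
      have "h (dom_proj D i y) = dom_proj D' j (k y)" if "y \<in> {min x v..max x v}" for y
        using k(2) k(5)[of y] z that s by (cases "y = x") auto
      then show ?thesis
        using k s z(2) unfolding Q_def by (meson absolutely_continuous_on_subset monotone_on_subset)
    qed
    then show ?thesis using k by blast
  qed
  \<comment> \<open>\<open>P u v\<close> has to hold for arbitrary \<open>u\<close> and \<open>v\<close> near a point of \<open>{a..b}\<close>, hence the guards.\<close>
  define P where "P u v \<longleftrightarrow> (a \<le> u \<longrightarrow> u \<le> v \<longrightarrow> v \<le> b \<longrightarrow> (\<exists>j g. Q j g u v))" for u v
  have "P a b"
  proof (rule Bolzano)
    show "a \<le> b" using ab by simp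
  next
    fix u v w assume P: "P u v" "P v w" and uvw: "u \<le> v" "v \<le> w"
    show "P u w"
      unfolding P_def
    proof (intro impI)
      assume *: "a \<le> u" "u \<le> w" "w \<le> b"
      obtain j g where g: "Q j g u v" using P(1) * uvw by (auto simp: P_def)
      obtain j' g' where g': "Q j' g' v w" using P(2) * uvw by (auto simp: P_def)
      have "dom_proj D' j (g v) = dom_proj D' j' (g' v)" using g g' uvw unfolding Q_def
        by (metis atLeastAtMost_iff order_refl)
      then obtain n :: int where n: "j' = j" "g' v = g v + of_int n * D' ! j"
        by (auto simp: dom_proj_eq_iff)
      have "Q j (\<lambda>y. g' y + of_int (- n) * D' ! j) v w" using shift g' n by blast
      then show "\<exists>j g. Q j g u w" using concat[OF g] uvw n by fastforce
    qed
  next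
    fix x assume x: "a \<le> x" "x \<le> b"
    have "h (dom_proj D i x) \<in> points D'"
      using R[of x] L[of x] x ab germ_points by (cases "x = b") auto
    then obtain j z where z: "h (dom_proj D i x) = dom_proj D' j z" "j < length D'"
      by (auto simp: in_points_iff)
    obtain k \<delta> where k: "0 < \<delta>" "k x = z"
      "\<And>v. v \<in> side True x \<delta> \<Longrightarrow> a \<le> v \<Longrightarrow> v \<le> b \<Longrightarrow> Q j k (min x v) (max x v)"
      using local[OF x z, of True] by blast
    obtain k' \<delta>' where k': "0 < \<delta>'" "k' x = z"
      "\<And>u. u \<in> side False x \<delta>' \<Longrightarrow> a \<le> u \<Longrightarrow> u \<le> b \<Longrightarrow> Q j k' (min x u) (max x u)"
      using local[OF x z, of False] by blast
    show "\<exists>d>0. \<forall>u v. u \<le> x \<and> x \<le> v \<and> v - u < d \<longrightarrow> P u v"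
    proof (intro exI[of _ "min \<delta> \<delta>'"] conjI allI impI)
      show "0 < min \<delta> \<delta>'" using k k' by simp
      fix u v assume uv: "u \<le> x \<and> x \<le> v \<and> v - u < min \<delta> \<delta>'"
      show "P u v" unfolding P_def
      proof (intro impI)
        assume "a \<le> u" "u \<le> v" "v \<le> b"
        then have "Q j k' u x" "Q j k x v" using k(3)[of v] k'(3)[of u] uv by (auto simp: side_def)
        then show "\<exists>j g. Q j g u v" using concat[of j k' u x k v] k k' uv by auto
      qed
    qed
  qed
  then obtain j g where "Q j g a b" using ab by (auto simp: P_def)
  then show ?thesis using that[of j g] by (auto simp: Q_def)
qed

text \<open>Otherwise the lift would reach \<open>g a + D' ! j\<close>, by the intermediate value theorem, and \<open>h\<close> would
  take the value at \<open>a\<close> a second time.\<close>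

lemma lift_length_less:
  assumes "is_domain D'" "i < length D" "a < b" "b < a + D ! i" "inj_on h (points D)"
    "j < length D'" "absolutely_continuous_on {a..b} g" "strict_mono_on {a..b} g"
    "\<And>y. y \<in> {a..b} \<Longrightarrow> h (dom_proj D i y) = dom_proj D' j (g y)"
  shows "g b < g a + D' ! j"
proof (rule ccontr)
  assume "\<not> g b < g a + D' ! j"
  moreover have pos: "0 < D' ! j" using assms by (intro domain_pos)
  moreover have "continuous_on {a..b} g"
    by (rule uniformly_continuous_imp_continuous[OF absolutely_continuous_on_imp_uniformly_continuous_on])
       (use assms in auto)
  ultimately obtain y where y: "a \<le> y" "y \<le> b" "g y = g a + D' ! j"
    using IVT'[of g a "g a + D' ! j" b] assms(3) by auto
  have "dom_proj D' j (g y) = dom_proj D' j (g a)"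
    using dom_proj_shift[of D' j "g a" 1] y by simp
  then have "h (dom_proj D i y) = h (dom_proj D i a)" using assms(9)[of y] assms(9)[of a] y assms(3) by simp
  then have "dom_proj D i y = dom_proj D i a" using assms(2,5) by (auto dest: inj_onD)
  then have "y = a" using y assms by (intro dom_proj_near_imp_eq) auto
  then show False using y pos by simp
qed

lemma image_interval_lift:
  assumes "is_domain D'" "i < length D" "a < b" "b < a + D ! i" "inj_on h (points D)"
    "j < length D'" "absolutely_continuous_on {a..b} g" "strict_mono_on {a..b} g"
    "\<And>y. y \<in> {a..b} \<Longrightarrow> h (dom_proj D i y) = dom_proj D' j (g y)"
  shows "h ` dom_proj D i ` {a..<b} = interval_co D' (h (dom_proj D i a)) (h (dom_proj D i b))"
proof -
  have cont: "continuous_on {a..b} g"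
    by (rule uniformly_continuous_imp_continuous[OF absolutely_continuous_on_imp_uniformly_continuous_on])
       (use assms in auto)
  have less: "g y < g z" if "a \<le> y" "y < z" "z \<le> b" for y z
    using strict_mono_onD[OF assms(8)] that by auto
  have "g ` {a..<b} = {g a..<g b}"
  proof (intro equalityI subsetI)
    fix w assume "w \<in> g ` {a..<b}"
    then obtain y where "w = g y" "a \<le> y" "y < b" by auto
    then show "w \<in> {g a..<g b}" using less[of a y] less[of y b] by (cases "y = a") auto
  next
    fix w assume w: "w \<in> {g a..<g b}"
    then obtain y where y: "a \<le> y" "y \<le> b" "g y = w"
      using IVT'[of g a w b] assms(3) cont by auto
    then have "y \<noteq> b" using w by auto
    then show "w \<in> g ` {a..<b}" using y by force
  qed
  moreover have "h ` dom_proj D i ` {a..<b} = dom_proj D' j ` g ` {a..<b}"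
    unfolding image_image by (rule image_cong) (use assms(9) in auto)
  moreover have "interval_co D' (h (dom_proj D i a)) (h (dom_proj D i b)) = dom_proj D' j ` {g a..<g b}"
    using assms(9)[of a] assms(9)[of b] assms(3) less[of a b] lift_length_less[OF assms]
      interval_co_dom_proj[OF assms(1,6)] by simp
  ultimately show ?thesis by simp
qed


section \<open>Germs and continuity\<close>

lemma dom_dist_self [simp]: "dom_dist D p p = 0"
  by (simp add: dom_dist_def setdist_refl)

lemma topspace_dom_top: "is_domain D \<Longrightarrow> topspace (dom_top D) = points D"
  by (simp add: dom_top_def Metric_space.topspace_mtopology Metric_space_domain)

lemma restriction_continuous_iff:
  assumes "is_domain D" "is_domain D'" "S \<subseteq> points D"
  shows "restriction_continuous D D' f S \<longleftrightarrow> f ` S \<subseteq> points D' \<and>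
    (\<forall>p\<in>S. \<forall>\<epsilon>>0. \<exists>\<delta>>0. \<forall>q. q \<in> S \<and> dom_dist D p q < \<delta> \<longrightarrow> dom_dist D' (f p) (f q) < \<epsilon>)"
proof -
  interpret Metric_space "points D" "dom_dist D" by (rule Metric_space_domain) fact
  interpret Submetric "points D" "dom_dist D" S by unfold_locales fact
  show ?thesis
    unfolding restriction_continuous_def dom_top_def mtopology_submetric[symmetric]
    by (rule sub.metric_continuous_map[OF Metric_space_domain[OF assms(2)]])
qed

lemma topcontinuous_at_iff:
  assumes "is_domain D" "is_domain D'"
  shows "topcontinuous_at (dom_top D) (dom_top D') f p \<longleftrightarrow> p \<in> points D \<and> f \<in> points D \<rightarrow> points D' \<and>
    (\<forall>\<epsilon>>0. \<exists>\<delta>>0. \<forall>q. q \<in> points D \<and> dom_dist D p q < \<delta> \<longrightarrow> dom_dist D' (f p) (f q) < \<epsilon>)"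
    (is "?L \<longleftrightarrow> ?R")
proof -
  interpret A: Metric_space "points D" "dom_dist D" by (rule Metric_space_domain) fact
  interpret B: Metric_space "points D'" "dom_dist D'" by (rule Metric_space_domain) fact
  show ?thesis
  proof
    assume L: ?L
    then have p: "p \<in> points D" "f \<in> points D \<rightarrow> points D'"
      by (auto simp: topcontinuous_at_def dom_top_def)
    have "\<exists>\<delta>>0. \<forall>q. q \<in> points D \<and> dom_dist D p q < \<delta> \<longrightarrow> dom_dist D' (f p) (f q) < \<epsilon>" if "0 < \<epsilon>" for \<epsilon>
    proof -
      have "openin (dom_top D') (B.mball (f p) \<epsilon>)" "f p \<in> B.mball (f p) \<epsilon>"
        using p that by (auto simp: dom_top_def)
      then obtain U where U: "openin (dom_top D) U" "p \<in> U" "\<forall>y\<in>U. f y \<in> B.mball (f p) \<epsilon>"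
        using L unfolding topcontinuous_at_def by meson
      obtain r where "0 < r" "A.mball p r \<subseteq> U" using U unfolding dom_top_def A.openin_mtopology by blast
      then show ?thesis using U p by (intro exI[of _ r]) (auto simp: subset_iff)
    qed
    then show ?R using p by blast
  next
    assume R: ?R
    have "\<exists>U. openin (dom_top D) U \<and> p \<in> U \<and> (\<forall>y\<in>U. f y \<in> V)" if V: "openin (dom_top D') V" "f p \<in> V" for V
    proof -
      obtain e where e: "0 < e" "B.mball (f p) e \<subseteq> V" using V unfolding dom_top_def B.openin_mtopology by blast
      obtain \<delta> where \<delta>: "0 < \<delta>" "\<And>q. q \<in> points D \<Longrightarrow> dom_dist D p q < \<delta> \<Longrightarrow> dom_dist D' (f p) (f q) < e"
        using R e by meson
      have "f y \<in> V" if "y \<in> A.mball p \<delta>" for y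
      proof -
        have "y \<in> points D" "dom_dist D p y < \<delta>" using that by auto
        then have "f y \<in> B.mball (f p) e" using \<delta>(2)[of y] R by auto
        then show ?thesis using e by blast
      qed
      then show ?thesis using \<delta>(1) R by (intro exI[of _ "A.mball p \<delta>"]) (auto simp: dom_top_def)
    qed
    then show ?L using R assms by (auto simp: topcontinuous_at_def topspace_dom_top)
  qed
qed

lemma germs_imp_topcontinuous_at:
  assumes D: "is_domain D" "is_domain D'" and h: "h \<in> points D \<rightarrow> points D'"
    and g: "germ True D D' h p (h p)" "germ False D D' h p (h p)"
  shows "topcontinuous_at (dom_top D) (dom_top D') h p"
proof -
  interpret B: Metric_space "points D'" "dom_dist D'" by (rule Metric_space_domain) fact
  obtain i x where p: "i < length D" "p = dom_proj D i x" using germ_obtain_lifts[OF g(1)] by metis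
  show ?thesis unfolding topcontinuous_at_iff[OF D]
  proof (intro conjI allI impI)
    show pD: "p \<in> points D" using p by simp
    show "h \<in> points D \<rightarrow> points D'" by fact
    fix \<epsilon> :: real assume e: "0 < \<epsilon>"
    obtain \<delta> where \<delta>: "0 < \<delta>" "\<And>y. y \<in> side True x \<delta> \<Longrightarrow> y \<noteq> x \<Longrightarrow> dom_dist D' (h (dom_proj D i y)) (h p) < \<epsilon>"
      using germ_limit[OF g(1)[unfolded p(2)] e] p(2) by metis
    obtain \<delta>' where \<delta>': "0 < \<delta>'" "\<And>y. y \<in> side False x \<delta>' \<Longrightarrow> y \<noteq> x \<Longrightarrow> dom_dist D' (h (dom_proj D i y)) (h p) < \<epsilon>"
      using germ_limit[OF g(2)[unfolded p(2)] e] p(2) by metis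
    define d where "d = min (D ! i) (min \<delta> \<delta>')"
    show "\<exists>\<delta>>0. \<forall>q. q \<in> points D \<and> dom_dist D p q < \<delta> \<longrightarrow> dom_dist D' (h p) (h q) < \<epsilon>"
    proof (intro exI[of _ d] conjI allI impI)
      show "0 < d" using \<delta> \<delta>' domain_pos[OF D(1) p(1)] by (simp add: d_def)
      fix q assume q: "q \<in> points D \<and> dom_dist D p q < d"
      then obtain y where y: "q = dom_proj D i y" "\<bar>x - y\<bar> < d"
        using dom_dist_small[OF D(1) p(1), of q x d] p(2) by (auto simp: d_def)
      have "dom_dist D' (h q) (h p) < \<epsilon>"
      proof (cases "y = x")
        case True
        then have "q = p" using y p by simp
        then show ?thesis using e by simp
      next
        case False
        then have "y \<in> side True x \<delta> \<or> y \<in> side False x \<delta>'" using y(2) by (auto simp: side_def d_def)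
        then show ?thesis using \<delta>(2) \<delta>'(2) False y by blast
      qed
      then show "dom_dist D' (h p) (h q) < \<epsilon>" by (simp add: B.commute)
    qed
  qed
qed

lemma germs_imp_right_continuous:
  assumes "is_domain D'" and g: "\<And>p. p \<in> points D \<Longrightarrow> germ True D D' h p (h p)"
  shows "right_continuous D D' h"
proof -
  interpret B: Metric_space "points D'" "dom_dist D'" by (rule Metric_space_domain) fact
  show ?thesis unfolding right_continuous_def dom_top_def B.limitin_metric
  proof (intro allI impI conjI)
    fix i x assume i: "i < length D"
    then have gx: "germ True D D' h (dom_proj D i x) (h (dom_proj D i x))" by (intro g) simp
    then show "h (dom_proj D i x) \<in> points D'" using germ_points by blast
    fix \<epsilon> :: real assume "0 < \<epsilon>"
    then obtain \<delta> where \<delta>: "0 < \<delta>" "\<And>y. y \<in> side True x \<delta> \<Longrightarrow> y \<noteq> x \<Longrightarrow>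
      h (dom_proj D i y) \<in> points D' \<and> dom_dist D' (h (dom_proj D i y)) (h (dom_proj D i x)) < \<epsilon>"
      using germ_limit[OF gx] by metis
    then show "\<forall>\<^sub>F y in at_right x. h (dom_proj D i y) \<in> points D' \<and>
        dom_dist D' (h (dom_proj D i y)) (h (dom_proj D i x)) < \<epsilon>"
      unfolding eventually_at_right_field by (intro exI[of _ "x + \<delta>"]) (auto simp: side_def)
  qed
qed

lemma topcontinuous_at_germ:
  assumes D: "is_domain D" "is_domain D'" and h: "topcontinuous_at (dom_top D) (dom_top D') h p"
    and g: "germ r D D' h p q"
  shows "q = h p"
proof -
  obtain i x where p: "i < length D" "p = dom_proj D i x" using germ_obtain_lifts[OF g(1)] by metis
  note h' = h[unfolded topcontinuous_at_iff[OF D]]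
  show ?thesis
  proof (rule limit_eq_germ[OF D(2) g[unfolded p(2)]])
    show "h p \<in> points D'" using h' by auto
    fix \<epsilon> :: real assume "0 < \<epsilon>"
    then obtain \<delta> where \<delta>: "0 < \<delta>" "\<And>q. q \<in> points D \<Longrightarrow> dom_dist D p q < \<delta> \<Longrightarrow> dom_dist D' (h p) (h q) < \<epsilon>"
      using h' by meson
    have "dom_dist D' (h p) (h (dom_proj D i y)) < \<epsilon>" if "y \<in> side r x (\<delta> / 2)" for y
    proof (rule \<delta>(2))
      show "dom_proj D i y \<in> points D" using p by simp
      show "dom_dist D p (dom_proj D i y) < \<delta>"
        using dom_dist_le[of D i x y] side_dist[OF that] \<delta>(1) p(2) by (simp add: abs_minus_commute)
    qed
    then show "\<exists>\<delta>>0. \<forall>y\<in>side r x \<delta> - {x}. dom_dist D' (h p) (h (dom_proj D i y)) < \<epsilon>"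
      using \<delta>(1) by (intro exI[of _ "\<delta> / 2"]) auto
  qed
qed

lemma restriction_continuous_germ:
  assumes D: "is_domain D" "is_domain D'" and i: "i < length D"
    and h: "restriction_continuous D D' h (dom_proj D i ` {a..b})"
    and y: "y \<in> {a<..b}" and g: "germ False D D' h (dom_proj D i y) q"
  shows "q = h (dom_proj D i y)"
proof -
  have S: "dom_proj D i ` {a..b} \<subseteq> points D" using i by auto
  note h' = h[unfolded restriction_continuous_iff[OF D S]]
  have yS: "dom_proj D i y \<in> dom_proj D i ` {a..b}" using y by auto
  show ?thesis
  proof (rule limit_eq_germ[OF D(2) g])
    show "h (dom_proj D i y) \<in> points D'" using h' yS by blast
    fix \<epsilon> :: real assume "0 < \<epsilon>"
    then obtain \<delta> where \<delta>: "0 < \<delta>" "\<And>q. q \<in> dom_proj D i ` {a..b} \<Longrightarrow>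
        dom_dist D (dom_proj D i y) q < \<delta> \<Longrightarrow> dom_dist D' (h (dom_proj D i y)) (h q) < \<epsilon>"
      using h' yS by meson
    define d where "d = min (\<delta> / 2) (y - a)"
    have "dom_dist D' (h (dom_proj D i y)) (h (dom_proj D i z)) < \<epsilon>" if "z \<in> side False y d" for z
    proof (rule \<delta>(2))
      show "dom_proj D i z \<in> dom_proj D i ` {a..b}" using that y by (auto simp: side_def d_def)
      show "dom_dist D (dom_proj D i y) (dom_proj D i z) < \<delta>"
        using dom_dist_le[of D i y z] side_dist[OF that] \<delta>(1) by (simp add: abs_minus_commute d_def)
    qed
    moreover have "0 < d" using y \<delta> by (auto simp: d_def)
    ultimately show "\<exists>\<delta>>0. \<forall>z\<in>side False y \<delta> - {y}. dom_dist D' (h (dom_proj D i y)) (h (dom_proj D i z)) < \<epsilon>"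
      by blast
  qed
qed

text \<open>On an interval where the restriction of \<open>h\<close> is continuous, the left germ at each point but the
  first goes to the value of \<open>h\<close>, so that \<open>h\<close> has an increasing lift there. Jumps are allowed, since
  the lemma is also needed for the interval exchange transformation.\<close>

lemma germs_imp_orientation_preserving:
  assumes D: "is_domain D" "is_domain D'" and inj: "inj_on h (points D)"
    and R: "\<And>p. p \<in> points D \<Longrightarrow> germ True D D' h p (h p)"
    and L: "\<And>p. p \<in> points D \<Longrightarrow> \<exists>q. germ False D D' h p q"
  shows "orientation_preserving D D' h"
  unfolding orientation_preserving_def
proof (intro allI impI)
  fix i a b assume lifts: "interval_lifts D i a b"
    and c: "restriction_continuous D D' h (dom_proj D i ` {a..b})"
  then have i: "i < length D" "a < b" "b < a + D ! i" using interval_lifts_iff[OF D(1)] by auto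
  have L': "germ False D D' h (dom_proj D i y) (h (dom_proj D i y))" if y: "y \<in> {a<..b}" for y
  proof -
    obtain q where "germ False D D' h (dom_proj D i y) q" using L[of "dom_proj D i y"] i by auto
    then show ?thesis using restriction_continuous_germ[OF D i(1) c y] by auto
  qed
  obtain j g where "j < length D'" "absolutely_continuous_on {a..b} g" "strict_mono_on {a..b} g"
    "\<And>y. y \<in> {a..b} \<Longrightarrow> h (dom_proj D i y) = dom_proj D' j (g y)"
    using germ_lift_Icc[OF D(2) i(1,2) R L'] i by auto
  then show "h ` dom_proj D i ` {a..<b} = interval_co D' (h (dom_proj D i a)) (h (dom_proj D i b))"
    by (intro image_interval_lift[OF D(2) i inj])
qed

text \<open>If the cut \<open>c\<close> in the target component is placed at \<open>g a\<close>, the inverse of the projection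
  composed with \<open>h\<close> is the increasing lift \<open>g\<close> itself.\<close>

lemma germs_imp_piecewise_absolutely_continuous:
  assumes D: "is_domain D" and inj: "inj_on h (points D)"
    and R: "\<And>p. p \<in> points D \<Longrightarrow> germ True D D h p (h p)"
    and L: "\<And>p. p \<in> points D \<Longrightarrow> germ False D D h p (h p)"
  shows "piecewise_absolutely_continuous D h"
  unfolding piecewise_absolutely_continuous_def
proof (intro allI impI)
  fix i a b assume lifts: "interval_lifts D i a b"
  then have i: "i < length D" "a < b" "b < a + D ! i" using interval_lifts_iff[OF D(1)] by auto
  obtain j g where g: "j < length D" "absolutely_continuous_on {a..b} g" "strict_mono_on {a..b} g"
    "\<And>y. y \<in> {a..b} \<Longrightarrow> h (dom_proj D i y) = dom_proj D j (g y)"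
    using germ_lift_Icc[OF D i(1,2) R L] i by auto
  have less: "g b < g a + D ! j" by (rule lift_length_less[OF D i inj g])
  show "\<exists>j<length D. \<exists>c. h ` dom_proj D i ` {a..<b} \<subseteq> {j} \<times> circle (D ! j) \<and>
      absolutely_continuous_on {a..<b}
        (\<lambda>x. the_inv_into {c..<c + D ! j} (dom_proj D j) (h (dom_proj D i x)))"
  proof (intro exI[of _ j] exI[of _ "g a"] conjI g(1))
    show "h ` dom_proj D i ` {a..<b} \<subseteq> {j} \<times> circle (D ! j)"
      using g(4) by (auto simp: dom_proj_def circle_def)
    show "absolutely_continuous_on {a..<b}
        (\<lambda>x. the_inv_into {g a..<g a + D ! j} (dom_proj D j) (h (dom_proj D i x)))"
    proof (rule absolutely_continuous_on_cong)
      show "absolutely_continuous_on {a..<b} g"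
        using g(2) by (rule absolutely_continuous_on_subset) auto
      fix x assume x: "x \<in> {a..<b}"
      then have "g a \<le> g x" "g x < g b"
        using strict_mono_onD[OF g(3), of a x] strict_mono_onD[OF g(3), of x b] by (cases "x = a"; auto)+
      then have "g x \<in> {g a..<g a + D ! j}" using less by simp
      then show "the_inv_into {g a..<g a + D ! j} (dom_proj D j) (h (dom_proj D i x)) = g x"
        using g(4)[of x] x the_inv_into_f_f[OF inj_on_dom_proj] by simp
    qed
  qed
qed

lemma germs_imp_right_PAC:
  assumes D: "is_domain D" and bij: "bij_betw h (points D) (points D)"
    and R: "\<And>p. p \<in> points D \<Longrightarrow> germ True D D h p (h p)"
    and L: "\<And>p. p \<in> points D \<Longrightarrow> germ False D D h p (h p)"
  shows "right_PAC D h" "continuous_map (dom_top D) (dom_top D) h"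
proof -
  have inj: "inj_on h (points D)" and maps: "h \<in> points D \<rightarrow> points D"
    using bij by (auto simp: bij_betw_def)
  have cont: "topcontinuous_at (dom_top D) (dom_top D) h p" if "p \<in> points D" for p
    using germs_imp_topcontinuous_at[OF D D maps R L] that by simp
  then show "continuous_map (dom_top D) (dom_top D) h"
    by (simp add: continuous_map_eq_topcontinuous_at topspace_dom_top[OF D])
  have "discontinuities D D h = {}" using cont by (auto simp: discontinuities_def)
  moreover have "orientation_preserving D D h"
    by (rule germs_imp_orientation_preserving[OF D D inj R]) (use L in blast)+
  ultimately show "right_PAC D h"
    using bij germs_imp_right_continuous[OF D R] germs_imp_piecewise_absolutely_continuous[OF D inj R L]
    by (simp add: right_PAC_def)
qed

section \<open>Germs of piecewise absolutely continuous maps\<close>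

lemma isolated_lifts:
  assumes "is_domain D" "i < length D" "finite Z"
  obtains \<delta> where "0 < \<delta>" "\<delta> < D ! i / 4" "\<And>y. y \<noteq> x \<Longrightarrow> \<bar>y - x\<bar> \<le> \<delta> \<Longrightarrow> dom_proj D i y \<notin> Z"
proof -
  have pos: "0 < D ! i" using assms by (intro domain_pos)
  define Y where "Y = {y \<in> {x - D ! i / 4..x + D ! i / 4}. dom_proj D i y \<in> Z}"
  have "inj_on (dom_proj D i) Y"
    by (rule inj_on_subset[OF inj_on_dom_proj[of D i "x - D ! i / 4"]]) (use pos in \<open>auto simp: Y_def\<close>)
  moreover have "finite (dom_proj D i ` Y)" by (rule finite_subset[OF _ assms(3)]) (auto simp: Y_def)
  ultimately have "finite Y" by (rule finite_imageD[rotated])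
  then obtain d where d: "0 < d" "\<And>y. y \<in> Y \<Longrightarrow> y \<noteq> x \<Longrightarrow> d \<le> dist x y"
    using finite_set_avoid by metis
  show ?thesis
  proof (rule that[of "min (d / 2) (D ! i / 8)"])
    fix y assume y: "y \<noteq> x" "\<bar>y - x\<bar> \<le> min (d / 2) (D ! i / 8)"
    then have y': "\<bar>y - x\<bar> \<le> d / 2" "\<bar>y - x\<bar> \<le> D ! i / 8" by simp_all
    then have "dist x y < d" using d(1) unfolding dist_real_def by linarith
    then have "y \<notin> Y" using d(2)[of y] y(1) by auto
    moreover have "y \<in> {x - D ! i / 4..x + D ! i / 4}" using y'(2) pos unfolding atLeastAtMost_iff by linarith
    ultimately show "dom_proj D i y \<notin> Z" by (auto simp: Y_def)
  qed (use d pos in auto)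
qed

lemma restriction_continuousI:
  assumes D: "is_domain D" "is_domain D'" and i: "i < length D"
    and I: "\<And>x y. x \<in> I \<Longrightarrow> y \<in> I \<Longrightarrow> \<bar>x - y\<bar> < D ! i / 2"
    and f: "f \<in> points D \<rightarrow> points D'" "right_continuous D D' f"
    and c: "\<And>x. x \<in> I \<Longrightarrow> topcontinuous_at (dom_top D) (dom_top D') f (dom_proj D i x) \<or> (\<forall>y\<in>I. x \<le> y)"
  shows "restriction_continuous D D' f (dom_proj D i ` I)"
proof -
  interpret B: Metric_space "points D'" "dom_dist D'" by (rule Metric_space_domain) fact
  have S: "dom_proj D i ` I \<subseteq> points D" using i by auto
  have pos: "0 < D ! i" using D(1) i by (rule domain_pos)
  show ?thesis unfolding restriction_continuous_iff[OF D S]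
  proof (intro conjI ballI allI impI)
    show "f ` dom_proj D i ` I \<subseteq> points D'" using S funcset_mem[OF f(1)] by blast
    fix p \<epsilon> assume "p \<in> dom_proj D i ` I" and e: "0 < (\<epsilon>::real)"
    then obtain x where x: "x \<in> I" "p = dom_proj D i x" by auto
    show "\<exists>\<delta>>0. \<forall>q. q \<in> dom_proj D i ` I \<and> dom_dist D p q < \<delta> \<longrightarrow> dom_dist D' (f p) (f q) < \<epsilon>"
    proof (cases "topcontinuous_at (dom_top D) (dom_top D') f p")
      case True
      then show ?thesis unfolding topcontinuous_at_iff[OF D] using e S by (meson subsetD)
    next
      case False
      then have min: "\<forall>y\<in>I. x \<le> y" using c[OF x(1)] x(2) by simp
      have "\<forall>\<^sub>F y in at_right x. f (dom_proj D i y) \<in> points D' \<and> dom_dist D' (f (dom_proj D i y)) (f p) < \<epsilon>"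
        using f(2) i e x(2) unfolding right_continuous_def dom_top_def B.limitin_metric by blast
      then obtain b where b: "x < b" "\<And>y. x < y \<Longrightarrow> y < b \<Longrightarrow> dom_dist D' (f (dom_proj D i y)) (f p) < \<epsilon>"
        unfolding eventually_at_right_field by blast
      define d where "d = min (b - x) (D ! i / 2)"
      show ?thesis
      proof (intro exI[of _ d] conjI allI impI)
        show "0 < d" using b pos by (simp add: d_def)
        fix q assume q: "q \<in> dom_proj D i ` I \<and> dom_dist D p q < d"
        then obtain y where y: "y \<in> I" "q = dom_proj D i y" by auto
        have "q \<in> points D" "dom_dist D (dom_proj D i x) q < d" "d \<le> D ! i"
          using q S x pos by (auto simp: d_def)
        then obtain y' where y': "q = dom_proj D i y'" "\<bar>x - y'\<bar> < d"
          using dom_dist_small[OF D(1) i] by metis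
        have "\<bar>x - y'\<bar> < D ! i / 2" using y'(2) by (simp add: d_def)
        then have "\<bar>y - y'\<bar> < D ! i" using I[OF x(1) y(1)] by linarith
        then have "y' = y" using y y' dom_proj_near_imp_eq by metis
        have "dom_dist D' (f q) (f p) < \<epsilon>"
        proof (cases "y = x")
          case True
          then show ?thesis using e x y by simp
        next
          case False
          then show ?thesis using b(2)[of y] y y' \<open>y' = y\<close> min by (force simp: d_def)
        qed
        then show "dom_dist D' (f p) (f q) < \<epsilon>" by (simp add: B.commute)
      qed
    qed
  qed
qed

text \<open>Absolute continuity provides a uniformly continuous lift \<open>k\<close>. It can only increase: if
  \<open>k b < k a\<close> for close \<open>a < b\<close>, then the arc from \<open>k a\<close> to \<open>k b\<close> in positive direction makes
  almost a full turn and contains the point opposite to \<open>k a\<close>, whereas the values of \<open>k\<close> on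
  \<open>{a..<b}\<close>, which fill this arc, stay within a quarter of a turn of \<open>k a\<close>.\<close>

lemma right_PAC_lift:
  assumes D: "is_domain D" and f: "right_PAC D f" and i: "i < length D"
    and uv: "u < v" "v - u < D ! i / 2"
    and c: "\<And>y. y \<in> {u<..<v} \<Longrightarrow> topcontinuous_at (dom_top D) (dom_top D) f (dom_proj D i y)"
  obtains j k \<eta> where "j < length D" "0 < \<eta>" "absolutely_continuous_on {u..<v} k"
    "\<And>y. y \<in> {u..<v} \<Longrightarrow> f (dom_proj D i y) = dom_proj D j (k y)"
    "\<And>a b. u \<le> a \<Longrightarrow> a < b \<Longrightarrow> b < v \<Longrightarrow> b - a < \<eta> \<Longrightarrow> k a < k b"
proof -
  have bij: "bij_betw f (points D) (points D)" and rc: "right_continuous D D f"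
    and pac: "piecewise_absolutely_continuous D f" and op: "orientation_preserving D D f"
    using f by (auto simp: right_PAC_def)
  have inj: "inj_on f (points D)" and maps: "f \<in> points D \<rightarrow> points D"
    using bij by (auto simp: bij_betw_def)
  have pos: "0 < D ! i" using D i by (rule domain_pos)
  have cont: "restriction_continuous D D f (dom_proj D i ` I)"
    if "I \<subseteq> {u..<v}" "\<And>z. z \<in> I \<Longrightarrow> z \<noteq> u \<or> (\<forall>y\<in>I. z \<le> y)" for I
  proof (rule restriction_continuousI[OF D D i _ maps rc])
    show "\<bar>x - y\<bar> < D ! i / 2" if "x \<in> I" "y \<in> I" for x y
    proof -
      have "u \<le> x" "x < v" "u \<le> y" "y < v" using that \<open>I \<subseteq> {u..<v}\<close> by auto
      then show ?thesis using uv by linarith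
    qed
    show "topcontinuous_at (dom_top D) (dom_top D) f (dom_proj D i x) \<or> (\<forall>y\<in>I. x \<le> y)" if "x \<in> I" for x
      using that \<open>I \<subseteq> {u..<v}\<close> by (cases "x = u") (auto intro!: c)
  qed
  have "restriction_continuous D D f (dom_proj D i ` {u..<v})" by (rule cont) auto
  moreover have "interval_lifts D i u v" using interval_lifts_iff[OF D, of i u v] uv i pos by simp
  ultimately obtain j w where j: "j < length D" "f ` dom_proj D i ` {u..<v} \<subseteq> {j} \<times> circle (D ! j)"
    "absolutely_continuous_on {u..<v} (\<lambda>x. the_inv_into {w..<w + D ! j} (dom_proj D j) (f (dom_proj D i x)))"
    using pac unfolding piecewise_absolutely_continuous_def by blast
  have posj: "0 < D ! j" using D j(1) by (rule domain_pos)
  define k where "k x = the_inv_into {w..<w + D ! j} (dom_proj D j) (f (dom_proj D i x))" for x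
  have k: "f (dom_proj D i y) = dom_proj D j (k y)" if y: "y \<in> {u..<v}" for y
  proof -
    obtain z where z: "f (dom_proj D i y) = dom_proj D j z"
      using j(2) y by (force simp: circle_def dom_proj_def)
    obtain m :: int where "w \<le> z + of_int m * D ! j" "z + of_int m * D ! j < w + D ! j"
      using lift_in_window[OF posj, of w z] by blast
    then have "z + of_int m * D ! j \<in> {w..<w + D ! j}" by simp
    then have "f (dom_proj D i y) \<in> dom_proj D j ` {w..<w + D ! j}"
      unfolding z by (metis dom_proj_shift image_eqI)
    then show ?thesis unfolding k_def by (simp add: f_the_inv_into_f[OF inj_on_dom_proj])
  qed
  have ac: "absolutely_continuous_on {u..<v} k" using j(3) unfolding k_def .
  obtain \<eta> where \<eta>: "0 < \<eta>" "\<And>x y. x \<in> {u..<v} \<Longrightarrow> y \<in> {u..<v} \<Longrightarrow> \<bar>x - y\<bar> < \<eta> \<Longrightarrow> \<bar>k x - k y\<bar> < D ! j / 4"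
    using absolutely_continuous_on_uniform[OF ac, of "D ! j / 4"] posj by auto
  have "k a < k b" if ab: "u \<le> a" "a < b" "b < v" "b - a < \<eta>" for a b
  proof (rule ccontr)
    assume "\<not> k a < k b"
    moreover have "k a \<noteq> k b"
    proof
      assume "k a = k b"
      then have "f (dom_proj D i a) = f (dom_proj D i b)" using k ab by simp
      then have "dom_proj D i a = dom_proj D i b" using inj i by (auto dest: inj_onD)
      then have "a = b" using ab uv pos by (intro dom_proj_near_imp_eq) auto
      then show False using ab by simp
    qed
    ultimately have ba: "k b < k a" by simp
    have close: "\<bar>k a - k y\<bar> < D ! j / 4" if "a \<le> y" "y \<le> b" for y
      using \<eta>(2)[of a y] ab that by auto
    have "restriction_continuous D D f (dom_proj D i ` {a..b})" by (rule cont) (use ab in auto)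
    then have "f ` dom_proj D i ` {a..<b} = interval_co D (f (dom_proj D i a)) (f (dom_proj D i b))"
      using op interval_lifts_iff[OF D, of i a b] ab uv i pos unfolding orientation_preserving_def by auto
    also have "\<dots> = interval_co D (dom_proj D j (k a)) (dom_proj D j (k b + D ! j))"
      using k ab dom_proj_shift[of D j "k b" 1] by simp
    also have "\<dots> = dom_proj D j ` {k a..<k b + D ! j}"
      by (rule interval_co_dom_proj[OF D j(1)]) (use ba close[of b] ab in auto)
    finally have eq: "f ` dom_proj D i ` {a..<b} = dom_proj D j ` {k a..<k b + D ! j}" .
    have "\<bar>k a - k b\<bar> < D ! j / 4" using close[of b] ab by simp
    then have "k a + D ! j / 2 \<in> {k a..<k b + D ! j}"
      using posj unfolding atLeastLessThan_iff by linarith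
    then have "dom_proj D j (k a + D ! j / 2) \<in> f ` dom_proj D i ` {a..<b}" unfolding eq by blast
    then obtain y where y: "a \<le> y" "y < b" "f (dom_proj D i y) = dom_proj D j (k a + D ! j / 2)" by auto
    then have "dom_proj D j (k y) = dom_proj D j (k a + D ! j / 2)" using k[of y] ab by auto
    moreover have cy: "\<bar>k a - k y\<bar> < D ! j / 4" using close[of y] y by simp
    then have "\<bar>k y - (k a + D ! j / 2)\<bar> < D ! j" using posj by linarith
    ultimately have "k y = k a + D ! j / 2" by (rule dom_proj_near_imp_eq)
    then show False using cy posj by linarith
  qed
  then show ?thesis using that[of j \<eta> k] j(1) \<eta>(1) ac k by blast
qed

lemma right_PAC_germ_True:
  assumes D: "is_domain D" and f: "right_PAC D f" and p: "p \<in> points D"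
  shows "germ True D D f p (f p)"
proof -
  obtain i x where i: "i < length D" "p = dom_proj D i x" using p by (auto simp: in_points_iff)
  have "finite (discontinuities D D f)" using f by (simp add: right_PAC_def)
  then obtain \<delta> where \<delta>: "0 < \<delta>" "\<delta> < D ! i / 4"
    "\<And>y. y \<noteq> x \<Longrightarrow> \<bar>y - x\<bar> \<le> \<delta> \<Longrightarrow> dom_proj D i y \<notin> discontinuities D D f"
    using isolated_lifts[OF D i(1)] by metis
  have c: "topcontinuous_at (dom_top D) (dom_top D) f (dom_proj D i y)" if "y \<in> {x<..<x + \<delta>}" for y
    using \<delta>(3)[of y] that i by (auto simp: discontinuities_def)
  obtain j k \<eta> where k: "j < length D" "0 < \<eta>" "absolutely_continuous_on {x..<x + \<delta>} k"
    "\<And>y. y \<in> {x..<x + \<delta>} \<Longrightarrow> f (dom_proj D i y) = dom_proj D j (k y)"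
    "\<And>a b. x \<le> a \<Longrightarrow> a < b \<Longrightarrow> b < x + \<delta> \<Longrightarrow> b - a < \<eta> \<Longrightarrow> k a < k b"
    by (rule right_PAC_lift[OF D f i(1) _ _ c]) (use \<delta>(1,2) in auto)
  define d where "d = min (\<delta> / 2) (\<eta> / 2)"
  show ?thesis unfolding i(2)
  proof (rule germI[OF i(1) k(1), of d])
    show "absolutely_continuous_on (side True x d) k"
      by (rule absolutely_continuous_on_subset[OF k(3)]) (use \<delta> in \<open>auto simp: side_def d_def\<close>)
    show "strict_mono_on (side True x d) k"
      by (rule strict_mono_onI, rule k(5)) (use \<delta> k(2) in \<open>auto simp: side_def d_def\<close>)
  qed (use \<delta> k in \<open>auto simp: side_def d_def\<close>)
qed

text \<open>The lift on the left of \<open>x\<close> is increasing and bounded, so it extends to \<open>x\<close> by its supremum.\<close>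

lemma right_PAC_germ_False:
  assumes D: "is_domain D" and f: "right_PAC D f" and p: "p \<in> points D"
  shows "\<exists>q. germ False D D f p q"
proof -
  obtain i x where i: "i < length D" "p = dom_proj D i x" using p by (auto simp: in_points_iff)
  have "finite (discontinuities D D f)" using f by (simp add: right_PAC_def)
  then obtain \<delta> where \<delta>: "0 < \<delta>" "\<delta> < D ! i / 4"
    "\<And>y. y \<noteq> x \<Longrightarrow> \<bar>y - x\<bar> \<le> \<delta> \<Longrightarrow> dom_proj D i y \<notin> discontinuities D D f"
    using isolated_lifts[OF D i(1)] by metis
  have c: "topcontinuous_at (dom_top D) (dom_top D) f (dom_proj D i y)" if "y \<in> {x - \<delta><..<x}" for y
    using \<delta>(3)[of y] that i by (auto simp: discontinuities_def)
  obtain j k \<eta> where k: "j < length D" "0 < \<eta>" "absolutely_continuous_on {x - \<delta>..<x} k"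
    "\<And>y. y \<in> {x - \<delta>..<x} \<Longrightarrow> f (dom_proj D i y) = dom_proj D j (k y)"
    "\<And>a b. x - \<delta> \<le> a \<Longrightarrow> a < b \<Longrightarrow> b < x \<Longrightarrow> b - a < \<eta> \<Longrightarrow> k a < k b"
    by (rule right_PAC_lift[OF D f i(1) _ _ c]) (use \<delta>(1,2) in auto)
  obtain \<eta>' where \<eta>': "0 < \<eta>'" "\<And>u v. u \<in> {x - \<delta>..<x} \<Longrightarrow> v \<in> {x - \<delta>..<x} \<Longrightarrow> \<bar>u - v\<bar> < \<eta>' \<Longrightarrow> \<bar>k u - k v\<bar> < 1"
    using absolutely_continuous_on_uniform[OF k(3), of 1] by auto
  define d where "d = min \<delta> (min (\<eta> / 2) (\<eta>' / 2))"
  have d: "0 < d" "d \<le> \<delta>" "d < \<eta>" "d < \<eta>'" using \<delta> k(2) \<eta>'(1) by (auto simp: d_def)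
  have mono: "k a < k b" if "x - d \<le> a" "a < b" "b < x" for a b using k(5)[of a b] that d by auto
  define s where "s = Sup (k ` {x - d..<x})"
  have bdd: "bdd_above (k ` {x - d..<x})"
  proof (rule bdd_aboveI2)
    fix y assume y: "y \<in> {x - d..<x}"
    then show "k y \<le> k (x - d) + 1" using \<eta>'(2)[of "x - d" y] d by auto
  qed
  have upper: "k y \<le> s" if "y \<in> {x - d..<x}" for y
    unfolding s_def using bdd that by (intro cSup_upper) auto
  have lim: "(k \<longlongrightarrow> s) (at_left x)"
  proof (rule order_tendstoI)
    fix a assume "s < a"
    then show "eventually (\<lambda>y. k y < a) (at_left x)"
      unfolding eventually_at_left_field
    proof (intro exI[of _ "x - d"] conjI allI impI)
      show "k y < a" if "x - d < y" "y < x" for y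
        using upper[of y] that \<open>s < a\<close> by simp
    qed (use d in simp)
  next
    fix a assume "a < s"
    then obtain y where y: "x - d \<le> y" "y < x" "a < k y"
      unfolding s_def using less_cSup_iff[OF _ bdd, of a] d by auto
    then show "eventually (\<lambda>z. a < k z) (at_left x)"
      unfolding eventually_at_left_field using mono by (intro exI[of _ y]) (auto intro: less_trans)
  qed
  define k' where "k' = k(x := s)"
  have "germ False D D f (dom_proj D i x) (dom_proj D j s)"
  proof (rule germI[OF i(1) k(1) d(1)])
    have "absolutely_continuous_on {x - d..<x} k'"
      by (rule absolutely_continuous_on_cong[of _ k])
         (use k(3) d in \<open>auto simp: k'_def intro: absolutely_continuous_on_subset\<close>)
    moreover have "(k' \<longlongrightarrow> k' x) (at_left x)"
    proof -
      have "(k' \<longlongrightarrow> s) (at_left x) \<longleftrightarrow> (k \<longlongrightarrow> s) (at_left x)"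
        by (intro filterlim_cong) (auto simp: k'_def eventually_at_filter)
      then show ?thesis using lim by (simp add: k'_def)
    qed
    ultimately show "absolutely_continuous_on (side False x d) k'"
      using absolutely_continuous_on_close[of "x - d" x k'] d by (simp add: side_def)
    show "strict_mono_on (side False x d) k'"
    proof (rule strict_mono_onI)
      fix a b assume ab: "a \<in> side False x d" "b \<in> side False x d" "a < b"
      show "k' a < k' b"
      proof (cases "b = x")
        case True
        have "k a < k ((a + x) / 2)" using ab True by (intro mono) (auto simp: side_def)
        also have "\<dots> \<le> s" using ab True by (intro upper) (auto simp: side_def)
        finally show ?thesis using True ab by (simp add: k'_def)
      next
        case False
        then show ?thesis using mono[of a b] ab by (auto simp: side_def k'_def)
      qed
    qed
  qed (use k d in \<open>auto simp: side_def k'_def\<close>)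
  then show ?thesis unfolding i(2) by blast
qed


section \<open>Small distances force nearby values\<close>

lemma dom_dist_nonneg: "is_domain D \<Longrightarrow> 0 \<le> dom_dist D p q"
  using Metric_space.nonneg[OF Metric_space_domain] .

lemma dom_dist_commute: "is_domain D \<Longrightarrow> dom_dist D p q = dom_dist D q p"
  using Metric_space.commute[OF Metric_space_domain] .

lemma dom_dist_triangle:
  "is_domain D \<Longrightarrow> p \<in> points D \<Longrightarrow> q \<in> points D \<Longrightarrow> r \<in> points D \<Longrightarrow>
    dom_dist D p r \<le> dom_dist D p q + dom_dist D q r"
  using Metric_space.triangle[OF Metric_space_domain] .

lemma dom_dist_pos:
  "is_domain D \<Longrightarrow> p \<in> points D \<Longrightarrow> q \<in> points D \<Longrightarrow> p \<noteq> q \<Longrightarrow> 0 < dom_dist D p q"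
  using Metric_space.zero[OF Metric_space_domain] dom_dist_nonneg by (metis order_less_le)

lemma dom_dist_bounded:
  assumes "is_domain D" "p \<in> points D" "q \<in> points D"
  shows "dom_dist D p q \<le> sum_list D"
proof (cases "fst p = fst q")
  case True
  obtain i x where p: "i < length D" "p = dom_proj D i x" using assms(2) unfolding in_points_iff by blast
  obtain j y where q: "q = dom_proj D j y" using assms(3) unfolding in_points_iff by blast
  have "j = i" using True by (simp add: p q dom_proj_def)
  have "dom_dist D p q \<le> D ! i"
    unfolding p q \<open>j = i\<close> dom_dist_same by (rule setdist_circle_le) (rule domain_pos[OF assms(1) p(1)])
  also have "\<dots> \<le> sum_list D" by (rule domain_le_sum_list[OF assms(1) p(1)])
  finally show ?thesis .
qed (simp add: dom_dist_def)

lemma right_continuous_in_points: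
  assumes "is_domain D" "right_continuous D' D f" "i < length D'"
  shows "f (dom_proj D' i x) \<in> points D"
proof -
  interpret Metric_space "points D" "dom_dist D" by (rule Metric_space_domain) fact
  show ?thesis using assms(2,3) unfolding right_continuous_def dom_top_def limitin_metric by blast
qed

text \<open>A right-continuous function is the limit of the step functions obtained by rounding the
  argument up to the next multiple of \<open>1 / n\<close>.\<close>

lemma borel_measurable_right_continuous:
  fixes F :: "real \<Rightarrow> real"
  assumes "\<And>x. (F \<longlongrightarrow> F x) (at_right x)"
  shows "F \<in> borel_measurable borel"
proof (rule borel_measurable_LIMSEQ_real)
  \<comment> \<open>Strictly larger than \<open>x\<close>, also at multiples of \<open>1 / Suc n\<close>, as only limits from the right are known.\<close>
  define s where "s n x = (of_int \<lfloor>real (Suc n) * x\<rfloor> + 1) / real (Suc n)" for n x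
  show "(\<lambda>n. F (s n x)) \<longlonglongrightarrow> F x" for x
  proof -
    have gt: "x < s n x" and le: "s n x \<le> x + 1 / real (Suc n)" for n
    proof -
      have "real (Suc n) * x < of_int \<lfloor>real (Suc n) * x\<rfloor> + 1" by linarith
      then show "x < s n x" by (simp add: s_def field_simps)
      have "of_int \<lfloor>real (Suc n) * x\<rfloor> + 1 \<le> real (Suc n) * x + 1" by linarith
      then have "s n x \<le> (real (Suc n) * x + 1) / real (Suc n)"
        unfolding s_def by (intro divide_right_mono) auto
      also have "\<dots> = x + 1 / real (Suc n)" by (simp add: field_simps)
      finally show "s n x \<le> x + 1 / real (Suc n)" .
    qed
    have "(\<lambda>n. s n x) \<longlonglongrightarrow> x"
    proof (rule tendsto_sandwich[of "\<lambda>_. x" _ _ "\<lambda>n. x + 1 / real (Suc n)"])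
      have "(\<lambda>n. x + 1 / real (Suc n)) \<longlonglongrightarrow> x + 0"
        by (intro tendsto_intros LIMSEQ_Suc[OF lim_1_over_n])
      then show "(\<lambda>n. x + 1 / real (Suc n)) \<longlonglongrightarrow> x" by simp
      show "eventually (\<lambda>n. x \<le> s n x) sequentially" using gt by (simp add: less_imp_le)
      show "eventually (\<lambda>n. s n x \<le> x + 1 / real (Suc n)) sequentially"
        using le by (intro always_eventually allI)
    qed simp
    then have "filterlim (\<lambda>n. s n x) (at_right x) sequentially"
      using gt by (intro tendsto_imp_filterlim_at_right always_eventually allI)
    with assms show ?thesis by (rule filterlim_compose)
  qed
  show "(\<lambda>x. F (s n x)) \<in> borel_measurable borel" for n
  proof -
    have "(\<lambda>x::real. \<lfloor>real (Suc n) * x\<rfloor>) \<in> measurable borel (count_space UNIV)" by measurable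
    then show ?thesis unfolding s_def
      by (rule measurable_compose) (rule borel_measurable_count_space)
  qed
qed

lemma dist_right_limit:
  assumes D: "is_domain D" and f: "right_continuous D' D f" and g: "right_continuous D' D g"
    and i: "i < length D'"
  shows "((\<lambda>y. dom_dist D (f (dom_proj D' i y)) (g (dom_proj D' i y))) \<longlongrightarrow>
    dom_dist D (f (dom_proj D' i x)) (g (dom_proj D' i x))) (at_right x)"
proof -
  interpret Metric_space "points D" "dom_dist D" by (rule Metric_space_domain) fact
  let ?p = "dom_proj D' i"
  have lim: "f (?p x) \<in> points D" "eventually (\<lambda>y. f (?p y) \<in> points D) (at_right x)"
    "((\<lambda>y. dom_dist D (f (?p y)) (f (?p x))) \<longlongrightarrow> 0) (at_right x)"
    "g (?p x) \<in> points D" "eventually (\<lambda>y. g (?p y) \<in> points D) (at_right x)"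
    "((\<lambda>y. dom_dist D (g (?p y)) (g (?p x))) \<longlongrightarrow> 0) (at_right x)"
    using f g i unfolding right_continuous_def dom_top_def limitin_metric_dist_null by blast+
  have "((\<lambda>y. dom_dist D (f (?p y)) (f (?p x)) + dom_dist D (g (?p y)) (g (?p x))) \<longlongrightarrow> 0 + 0) (at_right x)"
    by (intro tendsto_add lim)
  then have 0: "((\<lambda>y. dom_dist D (f (?p y)) (f (?p x)) + dom_dist D (g (?p y)) (g (?p x))) \<longlongrightarrow> 0) (at_right x)"
    by simp
  have "eventually (\<lambda>y. norm (dom_dist D (f (?p y)) (g (?p y)) - dom_dist D (f (?p x)) (g (?p x)))
      \<le> dom_dist D (f (?p y)) (f (?p x)) + dom_dist D (g (?p y)) (g (?p x))) (at_right x)"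
    using lim(2,5)
  proof eventually_elim
    case (elim y)
    have "dom_dist D (f (?p y)) (g (?p y)) \<le> dom_dist D (f (?p y)) (f (?p x)) + dom_dist D (f (?p x)) (g (?p y))"
      "dom_dist D (f (?p x)) (g (?p y)) \<le> dom_dist D (f (?p x)) (g (?p x)) + dom_dist D (g (?p x)) (g (?p y))"
      "dom_dist D (f (?p x)) (g (?p x)) \<le> dom_dist D (f (?p x)) (f (?p y)) + dom_dist D (f (?p y)) (g (?p x))"
      "dom_dist D (f (?p y)) (g (?p x)) \<le> dom_dist D (f (?p y)) (g (?p y)) + dom_dist D (g (?p y)) (g (?p x))"
      using elim lim(1,4) by (auto intro: triangle)
    then show ?case using commute[of "f (?p x)" "f (?p y)"] commute[of "g (?p x)" "g (?p y)"]
      unfolding real_norm_def by linarith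
  qed
  then have "((\<lambda>y. dom_dist D (f (?p y)) (g (?p y)) - dom_dist D (f (?p x)) (g (?p x))) \<longlongrightarrow> 0) (at_right x)"
    using 0 by (rule Lim_null_comparison)
  then show ?thesis by (simp add: LIM_zero_iff)
qed

lemma dist_measurable:
  assumes "is_domain D" "right_continuous D' D f" "right_continuous D' D g" "i < length D'"
  shows "(\<lambda>y. dom_dist D (f (dom_proj D' i y)) (g (dom_proj D' i y))) \<in> borel_measurable borel"
  by (rule borel_measurable_right_continuous) (rule dist_right_limit, use assms in auto)

lemma set_integrable_const_Ico: "set_integrable lborel {a..<b::real} (\<lambda>_. c::real)"
proof -
  have "emeasure lborel {a..<b} < \<infinity>" by (cases "a \<le> b") simp_all
  then show ?thesis
    unfolding set_integrable_def by (intro integrable_scaleR_left integrable_real_indicator) simp_all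
qed

lemma dist_integrable:
  assumes D: "is_domain D" and f: "right_continuous D' D f"
    and g: "right_continuous D' D g" and i: "i < length D'"
  shows "set_integrable lborel {a..<b} (\<lambda>y. dom_dist D (f (dom_proj D' i y)) (g (dom_proj D' i y)))"
proof -
  have "set_integrable lborel {a..<b} (\<lambda>_. sum_list D)"
    by (rule set_integrable_const_Ico)
  then show ?thesis
  proof (rule set_integrable_bound)
    have [measurable]: "(\<lambda>y. dom_dist D (f (dom_proj D' i y)) (g (dom_proj D' i y))) \<in> borel_measurable borel"
      by (rule dist_measurable[OF D f g i])
    show "set_borel_measurable lborel {a..<b} (\<lambda>y. dom_dist D (f (dom_proj D' i y)) (g (dom_proj D' i y)))"
      unfolding set_borel_measurable_def by measurable
    show "AE x in lborel. x \<in> {a..<b} \<longrightarrow>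
        norm (dom_dist D (f (dom_proj D' i x)) (g (dom_proj D' i x))) \<le> norm (sum_list D)"
    proof (intro AE_I2 impI)
      fix x
      have "f (dom_proj D' i x) \<in> points D" "g (dom_proj D' i x) \<in> points D"
        using right_continuous_in_points[OF D] f g i by blast+
      then show "norm (dom_dist D (f (dom_proj D' i x)) (g (dom_proj D' i x))) \<le> norm (sum_list D)"
        using dom_dist_bounded[OF D, of "f (dom_proj D' i x)" "g (dom_proj D' i x)"]
          dom_dist_nonneg[OF D, of "f (dom_proj D' i x)" "g (dom_proj D' i x)"] by simp
    qed
  qed
qed

text \<open>A bound for the integral forces a small value somewhere in any given interval. The window
  \<open>{y0..<y0 + \<eta>}\<close> is moved into the fundamental domain and cut off at its end; as it is open on the
  right, something of positive length remains.\<close>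

lemma small_integral_imp_near:
  assumes D: "is_domain D" and i: "i < length D" and eta: "0 < \<eta>" and c: "0 < c"
  obtains \<kappa> where "0 < \<kappa>" "\<And>f g. right_continuous D D f \<Longrightarrow>
    right_continuous D D g \<Longrightarrow> dom_integral D (\<lambda>p. dom_dist D (f p) (g p)) < \<kappa> \<Longrightarrow>
    \<exists>y\<in>{y0..<y0 + \<eta>}. dom_dist D (f (dom_proj D i y)) (g (dom_proj D i y)) < c"
proof -
  have pos: "0 < D ! i" using D i by (rule domain_pos)
  obtain m :: int where m: "0 \<le> y0 + of_int m * D ! i" "y0 + of_int m * D ! i < 0 + D ! i"
    using lift_in_window[OF pos, of 0 y0] by blast
  define y1 where "y1 = y0 + of_int m * D ! i"
  define \<eta>' where "\<eta>' = min \<eta> (D ! i - y1)"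
  have y1: "0 \<le> y1" "y1 < D ! i" "0 < \<eta>'" "y1 + \<eta>' \<le> D ! i" "\<eta>' \<le> \<eta>"
    using m eta by (auto simp: y1_def \<eta>'_def)
  show ?thesis
  proof (rule that[of "c * \<eta>'"])
    show "0 < c * \<eta>'" using c y1 by simp
    fix f g assume f: "right_continuous D D f" and g: "right_continuous D D g"
      and small: "dom_integral D (\<lambda>p. dom_dist D (f p) (g p)) < c * \<eta>'"
    define F where "F j y = dom_dist D (f (dom_proj D j y)) (g (dom_proj D j y))" for j y
    have nn: "0 \<le> F j y" for j y unfolding F_def using dom_dist_nonneg[OF D] .
    have int: "set_integrable lborel {a..<b} (F j)" if "j < length D" for a b j
      unfolding F_def using dist_integrable[OF D f g that] .
    show "\<exists>y\<in>{y0..<y0 + \<eta>}. dom_dist D (f (dom_proj D i y)) (g (dom_proj D i y)) < c"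
    proof (rule ccontr)
      assume "\<not> (\<exists>y\<in>{y0..<y0 + \<eta>}. dom_dist D (f (dom_proj D i y)) (g (dom_proj D i y)) < c)"
      then have big: "c \<le> F i y" if "y \<in> {y0..<y0 + \<eta>}" for y using that by (force simp: F_def)
      have big': "c \<le> F i y" if y: "y \<in> {y1..<y1 + \<eta>'}" for y
      proof -
        have "y + of_int (- m) * D ! i \<in> {y0..<y0 + \<eta>}" using y y1 by (auto simp: y1_def)
        from big[OF this] show ?thesis unfolding F_def dom_proj_shift .
      qed
      have "c * \<eta>' = (LINT y:{y1..<y1 + \<eta>'}|lborel. c)"
        using y1 by (simp add: set_lebesgue_integral_def)
      also have "\<dots> \<le> (LINT y:{y1..<y1 + \<eta>'}|lborel. F i y)"
        by (intro set_integral_mono set_integrable_const_Ico int[OF i] big')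
      also have "\<dots> \<le> (LINT y:{0..<D ! i}|lborel. F i y)"
        unfolding set_lebesgue_integral_def
      proof (rule integral_mono)
        show "indicat_real {y1..<y1 + \<eta>'} y *\<^sub>R F i y \<le> indicat_real {0..<D ! i} y *\<^sub>R F i y" for y
          using y1 nn[of i y] by (auto simp: indicator_def)
      qed (use int[OF i] in \<open>auto simp: set_integrable_def\<close>)
      also have "\<dots> \<le> (\<Sum>j<length D. LINT y:{0..<D ! j}|lborel. F j y)"
        using i nn by (intro member_le_sum) (auto simp: set_lebesgue_integral_def intro!: integral_nonneg_AE)
      also have "\<dots> = dom_integral D (\<lambda>p. dom_dist D (f p) (g p))"
        by (simp add: dom_integral_def F_def)
      finally show False using small by simp
    qed
  qed
qed

lemma dom_integral_nonneg:
  assumes "\<And>p. 0 \<le> \<phi> p"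
  shows "0 \<le> dom_integral D \<phi>"
  unfolding dom_integral_def set_lebesgue_integral_def
  by (intro sum_nonneg integral_nonneg_AE AE_I2) (simp add: assms)

lemma PAC_right_PAC: "f \<in> PAC D \<Longrightarrow> right_PAC D f" "f \<in> PAC D \<Longrightarrow> right_PAC D (inv_into (points D) f)"
  by (auto simp: PAC_def)

lemma right_PAC_bij: "right_PAC D f \<Longrightarrow> bij_betw f (points D) (points D)"
  by (simp add: right_PAC_def)

lemma right_PAC_right_continuous: "right_PAC D f \<Longrightarrow> right_continuous D D f"
  by (simp add: right_PAC_def)

lemma right_PAC_maps: "right_PAC D f \<Longrightarrow> f \<in> points D \<rightarrow> points D"
  by (auto simp: right_PAC_def bij_betw_def)

lemma PAC_small_dist_imp_near:
  assumes D: "is_domain D" and i: "i < length D" and eta: "0 < \<eta>" and c: "0 < c"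
  obtains \<kappa> where "0 < \<kappa>"
    "\<And>f g. f \<in> PAC D \<Longrightarrow> g \<in> PAC D \<Longrightarrow> PAC_dist D f g < \<kappa> \<Longrightarrow>
      \<exists>y\<in>{y0..<y0 + \<eta>}. dom_dist D (f (dom_proj D i y)) (g (dom_proj D i y)) < c"
    "\<And>f g. f \<in> PAC D \<Longrightarrow> g \<in> PAC D \<Longrightarrow> PAC_dist D f g < \<kappa> \<Longrightarrow>
      \<exists>y\<in>{y0..<y0 + \<eta>}. dom_dist D (inv_into (points D) f (dom_proj D i y))
        (inv_into (points D) g (dom_proj D i y)) < c"
proof -
  obtain \<kappa> where \<kappa>: "0 < \<kappa>" "\<And>f g. right_continuous D D f \<Longrightarrow>
    right_continuous D D g \<Longrightarrow> dom_integral D (\<lambda>p. dom_dist D (f p) (g p)) < \<kappa> \<Longrightarrow>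
    \<exists>y\<in>{y0..<y0 + \<eta>}. dom_dist D (f (dom_proj D i y)) (g (dom_proj D i y)) < c"
    using small_integral_imp_near[OF assms] by blast
  have nn: "0 \<le> dom_integral D (\<lambda>p. dom_dist D (f p) (g p))" for f g
    by (rule dom_integral_nonneg) (rule dom_dist_nonneg[OF D])
  show ?thesis
  proof (rule that[OF \<kappa>(1)])
    fix f g assume fg: "f \<in> PAC D" "g \<in> PAC D" "PAC_dist D f g < \<kappa>"
    note rc = PAC_right_PAC[THEN right_PAC_right_continuous]
    show "\<exists>y\<in>{y0..<y0 + \<eta>}. dom_dist D (f (dom_proj D i y)) (g (dom_proj D i y)) < c"
      using fg nn[of "inv_into (points D) f" "inv_into (points D) g"]
      by (intro \<kappa>(2) rc) (auto simp: PAC_dist_def)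
    show "\<exists>y\<in>{y0..<y0 + \<eta>}. dom_dist D (inv_into (points D) f (dom_proj D i y))
        (inv_into (points D) g (dom_proj D i y)) < c"
      using fg nn[of f g]
      by (intro \<kappa>(2) rc) (auto simp: PAC_dist_def)
  qed
qed

section \<open>Jumps persist under small perturbations\<close>

text \<open>For an element of the group, the points where the left limit differs from the value.\<close>

definition jumps :: "domain_lengths \<Rightarrow> (point \<Rightarrow> point) \<Rightarrow> point set" where
  "jumps D h = {p \<in> points D. \<not> germ False D D h p (h p)}"

lemma finite_jumps:
  assumes "is_domain D" "right_PAC D f"
  shows "finite (jumps D f)"
proof (rule finite_subset)
  show "finite (discontinuities D D f)" using assms by (simp add: right_PAC_def)
  show "jumps D f \<subseteq> discontinuities D D f"
  proof
    fix p assume p: "p \<in> jumps D f"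
    obtain q where q: "germ False D D f p q"
      using right_PAC_germ_False[OF assms, of p] p by (auto simp: jumps_def)
    have "\<not> topcontinuous_at (dom_top D) (dom_top D) f p"
      using topcontinuous_at_germ[OF assms(1,1) _ q] q p by (auto simp: jumps_def)
    then show "p \<in> discontinuities D D f" using p by (simp add: discontinuities_def jumps_def)
  qed
qed

lemma is_domain_unit_circle [simp]: "is_domain unit_circle"
  by (simp add: is_domain_def)

lemma points_unit_circle: "p \<in> points unit_circle \<longleftrightarrow> (\<exists>x. p = dom_proj unit_circle 0 x)"
  by (auto simp: in_points_iff)

text \<open>Suppose that \<open>g\<close> is near \<open>f\<close> and has no jump near \<open>x\<close>. There are points \<open>a < x < b\<close> close to
  \<open>x\<close> at which the values of \<open>g\<close> are close to the left limit \<open>q\<close> and to \<open>f x\<close>. As \<open>g\<close> is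
  increasing between \<open>a\<close> and \<open>b\<close>, it takes there all values in the middle of the arc from \<open>q\<close> to
  \<open>f x\<close>. So the inverse of \<open>g\<close> maps an interval that depends only on \<open>f\<close> into a small
  neighbourhood of \<open>x\<close>, while the inverse of \<open>f\<close> keeps away from \<open>x\<close> on it. This contradicts the
  second half of the distance.\<close>

lemma jump_persists:
  assumes f: "f \<in> PAC unit_circle" and q: "germ False unit_circle unit_circle f (dom_proj unit_circle 0 x) q"
    and ne: "q \<noteq> f (dom_proj unit_circle 0 x)" and d0: "0 < \<delta>0"
  obtains \<kappa> where "0 < \<kappa>" "\<And>g. g \<in> PAC unit_circle \<Longrightarrow> PAC_dist unit_circle g f < \<kappa> \<Longrightarrow>
    \<exists>y. \<bar>y - x\<bar> < \<delta>0 \<and> dom_proj unit_circle 0 y \<in> jumps unit_circle g"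
proof -
  define U where "U = unit_circle"
  define P where "P = dom_proj U 0"
  define finv where "finv = inv_into (points U) f"
  have U: "is_domain U" "0 < length U" "U ! 0 = 1" by (simp_all add: U_def)
  have P_in [simp]: "P y \<in> points U" for y by (simp add: P_def U_def)
  have P_eq: "P y = P z \<longleftrightarrow> (\<exists>k::int. z = y + of_int k)" for y z
    by (simp add: P_def dom_proj_eq_iff U)
  note f' = PAC_right_PAC[OF f[folded U_def]]
  have bijf: "bij_betw f (points U) (points U)" using right_PAC_bij[OF f'(1)] .
  have fP: "f (P y) \<in> points U" for y using right_PAC_maps[OF f'(1)] by auto
  have q': "germ False U U f (P x) q" "q \<noteq> f (P x)" using q ne by (simp_all add: U_def P_def)
  have qU: "q \<in> points U" using germ_points[OF q'(1)] by simp
  have P_surj: "\<exists>y. p = P y" if "p \<in> points U" for p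
    using that by (simp add: P_def U_def points_unit_circle)
  obtain Y' where Y': "q = P Y'" using P_surj[OF qU] by blast
  obtain Y0 where Y0: "f (P x) = P Y0" using P_surj[OF fP] by blast
  define Y where "Y = Y' + frac (Y0 - Y')"
  have "Y = Y0 + of_int (- \<lfloor>Y0 - Y'\<rfloor>)" by (simp add: Y_def frac_def)
  then have Y: "f (P x) = P Y" unfolding Y0 P_eq by blast
  define l where "l = Y - Y'"
  have "l \<noteq> 0" using Y Y' q'(2) by (auto simp: l_def)
  then have l: "0 < l" "l < 1" using frac_ge_0[of "Y0 - Y'"] frac_lt_1[of "Y0 - Y'"] by (auto simp: l_def Y_def)
  \<comment> \<open>The tolerance \<open>e\<close> is small compared with both arcs between the left limit and the value, which excludes that \<open>g\<close> runs along the wrong one.\<close>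
  define e where "e = min l (1 - l) / 8"
  have e: "0 < e" "8 * e \<le> l" "8 * e \<le> 1 - l" using l by (auto simp: e_def)
  \<comment> \<open>The middle of the arc that \<open>f\<close> jumps over, and the point that \<open>f\<close> sends there.\<close>
  define M where "M = Y' + l / 2"
  define w where "w = finv (P M)"
  have w: "w \<in> points U" "f w = P M"
    using bijf bij_betw_inv_into_right[OF bijf, of "P M"] bij_betwE[OF bij_betw_inv_into[OF bijf]]
    by (simp_all add: w_def finv_def)
  have "w \<noteq> P x"
  proof
    assume "w = P x"
    then obtain k :: int where "M = Y + of_int k" using w(2) Y P_eq by metis
    moreover have "M - Y = - (l / 2)" by (simp add: M_def l_def field_simps)
    ultimately have "real_of_int k < 0" "- 1 < real_of_int k" using l by linarith+
    then have "k < 0" "- 1 < k" by simp_all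
    then show False by linarith
  qed
  then have k0: "0 < dom_dist U w (P x)" using w U by (intro dom_dist_pos) auto
  define c where "c = dom_dist U w (P x) / 4"
  have c: "0 < c" using k0 by (simp add: c_def)
  have "germ True U U finv (P M) w"
    unfolding w_def using f'(2)[folded finv_def] by (intro right_PAC_germ_True[OF U(1)]) auto
  from germ_limit[OF this[unfolded P_def] c] obtain \<eta>1 where \<eta>1: "0 < \<eta>1"
    "\<And>y. y \<in> side True M \<eta>1 \<Longrightarrow> y \<noteq> M \<Longrightarrow> finv (P y) \<in> points U \<and> dom_dist U (finv (P y)) w < c"
    unfolding P_def by blast
  define \<eta> where "\<eta> = min \<eta>1 (l / 8)"
  have \<eta>: "0 < \<eta>" using \<eta>1 l by (simp add: \<eta>_def)
  have finv_near: "finv (P y) \<in> points U" "dom_dist U (finv (P y)) w < c" if "y \<in> {M..<M + \<eta>}" for y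
  proof -
    have "\<eta> \<le> \<eta>1" by (simp add: \<eta>_def)
    then have "y \<in> side True M \<eta>1" using that by (simp add: side_def)
    then have "finv (P y) \<in> points U \<and> dom_dist U (finv (P y)) w < c"
      using \<eta>1(2)[of y] w(1) c w_def[symmetric] by (cases "y = M") simp_all
    then show "finv (P y) \<in> points U" "dom_dist U (finv (P y)) w < c" by simp_all
  qed
  obtain \<delta>1 where \<delta>1: "0 < \<delta>1" "\<And>y. y \<in> side False x \<delta>1 \<Longrightarrow> y \<noteq> x \<Longrightarrow> dom_dist U (f (P y)) q < e"
    using germ_limit[OF q'(1)[unfolded P_def] e(1)] unfolding P_def by metis
  have "germ True U U f (P x) (f (P x))" using f'(1) by (intro right_PAC_germ_True[OF U(1)]) auto
  then obtain \<delta>2 where \<delta>2: "0 < \<delta>2" "\<And>y. y \<in> side True x \<delta>2 \<Longrightarrow> y \<noteq> x \<Longrightarrow> dom_dist U (f (P y)) (f (P x)) < e"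
    using germ_limit[OF _ e(1)] unfolding P_def by metis
  define \<delta> where "\<delta> = min (min \<delta>0 (min \<delta>1 \<delta>2)) (min c (1 / 4))"
  have \<delta>: "0 < \<delta>" "\<delta> \<le> \<delta>0" "\<delta> \<le> \<delta>1" "\<delta> \<le> \<delta>2" "\<delta> \<le> c" "\<delta> \<le> 1 / 4"
    using \<delta>1 \<delta>2 d0 c by (auto simp: \<delta>_def)
  have \<delta>': "0 < \<delta> / 2" "0 < \<delta> / 4" using \<delta> by auto
  have near: "\<exists>\<kappa>>0. \<forall>g\<in>PAC U. PAC_dist U g f < \<kappa> \<longrightarrow>
      (\<exists>y\<in>{y0..<y0 + \<eta>}. dom_dist U (g (P y)) (f (P y)) < e) \<and>
      (\<exists>y\<in>{y0..<y0 + \<eta>}. dom_dist U (inv_into (points U) g (P y)) (finv (P y)) < e)"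
    if "0 < \<eta>" "0 < e" for y0 \<eta> e
  proof -
    from PAC_small_dist_imp_near[OF U(1,2) that, of y0] obtain \<kappa> where \<kappa>: "0 < \<kappa>"
      "\<And>f g. f \<in> PAC U \<Longrightarrow> g \<in> PAC U \<Longrightarrow> PAC_dist U f g < \<kappa> \<Longrightarrow>
        \<exists>y\<in>{y0..<y0 + \<eta>}. dom_dist U (f (dom_proj U 0 y)) (g (dom_proj U 0 y)) < e"
      "\<And>f g. f \<in> PAC U \<Longrightarrow> g \<in> PAC U \<Longrightarrow> PAC_dist U f g < \<kappa> \<Longrightarrow>
        \<exists>y\<in>{y0..<y0 + \<eta>}. dom_dist U (inv_into (points U) f (dom_proj U 0 y))
          (inv_into (points U) g (dom_proj U 0 y)) < e" by blast
    show ?thesis unfolding P_def finv_def using \<kappa> f[folded U_def] by blast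
  qed
  from near[OF \<delta>'(1) e(1), of "x - \<delta> / 2"] obtain \<kappa>1 where \<kappa>1: "0 < \<kappa>1"
    "\<And>g. g \<in> PAC U \<Longrightarrow> PAC_dist U g f < \<kappa>1 \<Longrightarrow>
      \<exists>y\<in>{x - \<delta> / 2..<x - \<delta> / 2 + \<delta> / 2}. dom_dist U (g (P y)) (f (P y)) < e" by blast
  from near[OF \<delta>'(2) e(1), of "x + \<delta> / 4"] obtain \<kappa>2 where \<kappa>2: "0 < \<kappa>2"
    "\<And>g. g \<in> PAC U \<Longrightarrow> PAC_dist U g f < \<kappa>2 \<Longrightarrow>
      \<exists>y\<in>{x + \<delta> / 4..<x + \<delta> / 4 + \<delta> / 4}. dom_dist U (g (P y)) (f (P y)) < e" by blast
  from near[OF \<eta> c, of M] obtain \<kappa>3 where \<kappa>3: "0 < \<kappa>3"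
    "\<And>g. g \<in> PAC U \<Longrightarrow> PAC_dist U g f < \<kappa>3 \<Longrightarrow>
      \<exists>y\<in>{M..<M + \<eta>}. dom_dist U (inv_into (points U) g (P y)) (finv (P y)) < c" by blast
  define \<kappa> where "\<kappa> = min \<kappa>1 (min \<kappa>2 \<kappa>3)"
  have "\<exists>y. \<bar>y - x\<bar> < \<delta>0 \<and> P y \<in> jumps U g" if g: "g \<in> PAC U" and small: "PAC_dist U g f < \<kappa>" for g
  proof (rule ccontr)
    assume "\<not> ?thesis"
    then have nojump: "germ False U U g (P y) (g (P y))" if "\<bar>y - x\<bar> < \<delta>0" for y
      using that by (auto simp: jumps_def)
    have g': "right_PAC U g" using PAC_right_PAC[OF g] by simp
    have gP: "g (P y) \<in> points U" for y using right_PAC_maps[OF g'] by auto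
    obtain a where a: "x - \<delta> / 2 \<le> a" "a < x" "dom_dist U (g (P a)) (f (P a)) < e"
      using \<kappa>1(2)[OF g] small by (auto simp: \<kappa>_def)
    obtain b where b: "x < b" "b < x + \<delta> / 2" "dom_dist U (g (P b)) (f (P b)) < e"
    proof -
      have "PAC_dist U g f < \<kappa>2" using small by (simp add: \<kappa>_def)
      from \<kappa>2(2)[OF g this] obtain b where "x + \<delta> / 4 \<le> b" "b < x + \<delta> / 4 + \<delta> / 4"
        "dom_dist U (g (P b)) (f (P b)) < e" by auto
      then show ?thesis using \<delta>(1) by (intro that[of b]) linarith+
    qed
    have fa: "dom_dist U (f (P a)) q < e" using a \<delta> by (intro \<delta>1(2)) (auto simp: side_def)
    have "dom_dist U (g (P a)) q \<le> dom_dist U (g (P a)) (f (P a)) + dom_dist U (f (P a)) q"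
      by (rule dom_dist_triangle[OF U(1) gP fP qU])
    then have "dom_dist U (P Y') (g (P a)) < 2 * e"
      using a fa Y' dom_dist_commute[OF U(1), of q "g (P a)"] by simp
    moreover have e1: "2 * e \<le> U ! 0" using e l U by simp
    ultimately obtain A where A: "g (P a) = P A" "\<bar>Y' - A\<bar> < 2 * e"
      using dom_dist_small[OF U(1,2) gP] unfolding P_def by metis
    have fb: "dom_dist U (f (P b)) (f (P x)) < e" using b \<delta> by (intro \<delta>2(2)) (auto simp: side_def)
    have "dom_dist U (g (P b)) (f (P x)) \<le> dom_dist U (g (P b)) (f (P b)) + dom_dist U (f (P b)) (f (P x))"
      by (rule dom_dist_triangle[OF U(1) gP fP fP])
    then have "dom_dist U (P Y) (g (P b)) < 2 * e"
      using b fb Y dom_dist_commute[OF U(1), of "f (P x)" "g (P b)"] by simp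
    then obtain B where B: "g (P b) = P B" "\<bar>Y - B\<bar> < 2 * e"
      using dom_dist_small[OF U(1,2) gP] e1 unfolding P_def by metis
    have ab: "a < b" "b < a + U ! 0" using a b \<delta> U by auto
    have inj: "inj_on g (points U)" using right_PAC_bij[OF g'] by (simp add: bij_betw_def)
    have L': "germ False U U g (dom_proj U 0 y) (g (dom_proj U 0 y))" if "y \<in> {a<..b}" for y
      using nojump[of y] that a b \<delta> unfolding P_def by auto
    have R': "germ True U U g (dom_proj U 0 y) (g (dom_proj U 0 y))" if "y \<in> {a..<b}" for y
      using right_PAC_germ_True[OF U(1) g' P_in] unfolding P_def .
    obtain j G0 where G0: "j < length U" "absolutely_continuous_on {a..b} G0" "strict_mono_on {a..b} G0"
      "\<And>y. y \<in> {a..b} \<Longrightarrow> g (dom_proj U 0 y) = dom_proj U j (G0 y)"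
      using germ_lift_Icc[OF U(1,2) ab(1) R' L'] by metis
    have j: "j = 0" using G0(1) by (simp add: U_def)
    have len: "G0 b < G0 a + 1"
      using lift_length_less[OF U(1,2) ab inj G0] unfolding j U .
    have G0P: "g (P y) = P (G0 y)" if "y \<in> {a..b}" for y using G0(4)[OF that] unfolding P_def j .
    obtain k :: int where k: "A = G0 a + of_int k" using A(1) G0P[of a] ab P_eq by auto
    obtain k' :: int where k': "B = G0 b + of_int k'" using B(1) G0P[of b] ab P_eq by auto
    define G where "G y = G0 y + of_int k" for y
    have GP: "g (P y) = P (G y)" if "y \<in> {a..b}" for y
      using G0P[OF that] unfolding G_def P_eq by (simp add: P_eq)
    have "G0 a < G0 b" using strict_mono_onD[OF G0(3), of a b] ab by auto
    have "B - A = (G0 b - G0 a) + of_int (k' - k)" using k k' by simp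
    moreover have "0 < B - A" "B - A < 1" using A(2) B(2) e by (auto simp: l_def abs_less_iff)
    ultimately have "real_of_int (k' - k) < 1" "- 1 < real_of_int (k' - k)"
      using len \<open>G0 a < G0 b\<close> by linarith+
    then have "k' = k" by linarith
    then have G: "G a = A" "G b = B" using k k' by (auto simp: G_def)
    have contG: "continuous_on {a..b} G"
      unfolding G_def using absolutely_continuous_on_imp_uniformly_continuous_on[OF G0(2)]
      by (intro continuous_intros uniformly_continuous_imp_continuous) auto
    obtain y where y: "M \<le> y" "y < M + \<eta>" "dom_dist U (inv_into (points U) g (P y)) (finv (P y)) < c"
      using \<kappa>3(2)[OF g] small by (auto simp: \<kappa>_def)
    have "\<eta> \<le> l / 8" unfolding \<eta>_def by (rule min.cobounded2)
    moreover have "Y = Y' + l" by (simp add: l_def)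
    ultimately have "A \<le> y" "y \<le> B" using A(2) B(2) e y(1,2) l unfolding M_def by linarith+
    then obtain z where z: "a \<le> z" "z \<le> b" "G z = y"
      using IVT'[of G a y b] G contG ab by auto
    then have "inv_into (points U) g (P y) = P z"
      using GP[of z] inj inv_into_f_f[OF inj P_in[of z]] by auto
    then have zy: "dom_dist U (P z) (finv (P y)) < c" using y by simp
    have "dom_dist U w (P x) \<le> dom_dist U w (finv (P y)) + dom_dist U (finv (P y)) (P x)"
      using w finv_near[of y] y by (intro dom_dist_triangle[OF U(1)]) auto
    also have "dom_dist U (finv (P y)) (P x) \<le> dom_dist U (finv (P y)) (P z) + dom_dist U (P z) (P x)"
      using finv_near[of y] y by (intro dom_dist_triangle[OF U(1)]) auto
    finally have "dom_dist U w (P x) < c + (c + dom_dist U (P z) (P x))"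
      using zy finv_near(2)[of y] y dom_dist_commute[OF U(1), of w "finv (P y)"]
        dom_dist_commute[OF U(1), of "P z" "finv (P y)"] by simp
    moreover have "dom_dist U (P z) (P x) \<le> \<bar>z - x\<bar>" unfolding P_def by (rule dom_dist_le)
    moreover have "\<bar>z - x\<bar> \<le> c" using z a b \<delta> by auto
    ultimately show False unfolding c_def using k0 by linarith
  qed
  then show ?thesis using that[of \<kappa>] \<kappa>1 \<kappa>2 \<kappa>3 by (auto simp: \<kappa>_def U_def P_def)
qed


section \<open>Continuous homomorphisms into the group\<close>

lemma continuous_hom_PAC: "continuous_hom D \<rho> \<Longrightarrow> \<rho> t \<in> PAC D"
  by (auto simp: continuous_hom_def hom_def real_group_def PAC_group_def)

lemma PAC_in_Bij: "f \<in> PAC D \<Longrightarrow> f \<in> Bij (points D)"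
  by (simp add: PAC_def)

lemma continuous_hom_add:
  assumes "continuous_hom D \<rho>" "p \<in> points D"
  shows "\<rho> (s + t) p = \<rho> s (\<rho> t p)"
proof -
  have "\<rho> (s + t) = mult (BijGroup (points D)) (\<rho> s) (\<rho> t)"
    using assms(1) by (auto simp: continuous_hom_def hom_def real_group_def PAC_group_def)
  also have "\<dots> = compose (points D) (\<rho> s) (\<rho> t)"
    using continuous_hom_PAC[OF assms(1)] by (simp add: BijGroup_def PAC_in_Bij)
  finally show ?thesis using assms(2) by (simp add: compose_eq)
qed

lemma continuous_hom_bij: "continuous_hom D \<rho> \<Longrightarrow> bij_betw (\<rho> t) (points D) (points D)"
  using right_PAC_bij[OF PAC_right_PAC(1)[OF continuous_hom_PAC]] .

lemma continuous_hom_in: "continuous_hom D \<rho> \<Longrightarrow> p \<in> points D \<Longrightarrow> \<rho> t p \<in> points D"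
  using continuous_hom_bij by (metis bij_betwE)

lemma continuous_hom_0:
  assumes "continuous_hom D \<rho>" "p \<in> points D"
  shows "\<rho> 0 p = p"
proof -
  have "\<rho> 0 (\<rho> 0 p) = \<rho> 0 p" using continuous_hom_add[OF assms, of 0 0] by simp
  moreover have "inj_on (\<rho> 0) (points D)" using continuous_hom_bij[OF assms(1)] by (simp add: bij_betw_def)
  ultimately show ?thesis using continuous_hom_in[OF assms(1)] assms(2) by (meson inj_onD)
qed

definition left_limit :: "domain_lengths \<Rightarrow> domain_lengths \<Rightarrow> (point \<Rightarrow> point) \<Rightarrow> point \<Rightarrow> point" where
  "left_limit D D' h p = (THE q. germ False D D' h p q)"

lemma left_limit_eq:
  assumes "is_domain D'" "germ False D D' h p q"
  shows "left_limit D D' h p = q"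
  unfolding left_limit_def using assms(2) by (rule the_equality) (rule germ_unique[OF assms(1) _ assms(2)])

lemma jumps_eq:
  assumes "is_domain D" "right_PAC D f"
  shows "jumps D f = {p \<in> points D. left_limit D D f p \<noteq> f p}"
proof -
  have "germ False D D f p (f p) \<longleftrightarrow> left_limit D D f p = f p" if p: "p \<in> points D" for p
    using right_PAC_germ_False[OF assms p] left_limit_eq[OF assms(1)] by metis
  then show ?thesis by (auto simp: jumps_def)
qed

section \<open>The number of jumps is bounded near the identity\<close>

text \<open>The jumps of \<open>\<rho> t\<close> have disjoint neighbourhoods, and each contains a jump of \<open>\<rho> s\<close>.\<close>

lemma eventually_jumps_ge:
  assumes h: "continuous_hom unit_circle \<rho>"
  shows "eventually (\<lambda>s. card (jumps unit_circle (\<rho> t)) \<le> card (jumps unit_circle (\<rho> s))) (at t)"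
proof -
  define U where "U = unit_circle"
  define P where "P = dom_proj U 0"
  have U: "is_domain U" by (simp add: U_def)
  define J where "J = jumps U (\<rho> t)"
  have PAC: "\<rho> s \<in> PAC U" for s using continuous_hom_PAC[OF h] by (simp add: U_def)
  have fin: "finite (jumps U (\<rho> s))" for s using finite_jumps[OF U PAC_right_PAC(1)[OF PAC]] .
  have JU: "J \<subseteq> points U" unfolding J_def jumps_def by blast
  have PU: "P y \<in> points U" for y by (simp add: P_def U_def)
  have "\<exists>x. p = P x" if "p \<in> J" for p
    using that JU points_unit_circle unfolding P_def U_def by blast
  then obtain x where x: "\<And>p. p \<in> J \<Longrightarrow> P (x p) = p" by metis
  have finJ: "finite J" unfolding J_def by (rule fin)
  define R where "R = insert 1 ({dom_dist U p q |p q. p \<in> J \<and> q \<in> J} - {0})"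
  have finR: "finite R"
    unfolding R_def using finJ finite_image_set2[of "\<lambda>p. p \<in> J" "\<lambda>q. q \<in> J" "dom_dist U"] by simp
  have posR: "0 < r" if "r \<in> R" for r
  proof (cases "r = 1")
    case False
    then have "r \<in> {dom_dist U p q |p q. p \<in> J \<and> q \<in> J}" using that by (simp add: R_def)
    moreover have "r \<noteq> 0" using that by (auto simp: R_def)
    ultimately obtain p q where "r = dom_dist U p q" "r \<noteq> 0" by blast
    then show ?thesis using dom_dist_nonneg[OF U, of p q] by simp
  qed simp
  define \<delta> where "\<delta> = Min R"
  have "R \<noteq> {}" by (simp add: R_def)
  then have "\<delta> \<in> R" unfolding \<delta>_def using finR by (rule Min_in[rotated])
  then have "0 < \<delta>" by (rule posR)
  moreover have "\<delta> \<le> dom_dist U p q" if pq: "p \<in> J" "q \<in> J" "p \<noteq> q" for p q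
    unfolding \<delta>_def
  proof (rule Min_le[OF finR])
    have "0 < dom_dist U p q" using dom_dist_pos[OF U _ _ pq(3)] pq JU by blast
    moreover have "dom_dist U p q \<in> {dom_dist U p q |p q. p \<in> J \<and> q \<in> J}" using pq by blast
    ultimately show "dom_dist U p q \<in> R" unfolding R_def by simp
  qed
  ultimately have \<delta>: "0 < \<delta>" "\<And>p q. p \<in> J \<Longrightarrow> q \<in> J \<Longrightarrow> p \<noteq> q \<Longrightarrow> \<delta> \<le> dom_dist U p q"
    by blast+
  have d2: "0 < \<delta> / 2" using \<delta> by simp
  have "\<exists>\<kappa>>0. \<forall>s. PAC_dist U (\<rho> s) (\<rho> t) < \<kappa> \<longrightarrow> (\<exists>y. \<bar>y - x p\<bar> < \<delta> / 2 \<and> P y \<in> jumps U (\<rho> s))"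
    if p: "p \<in> J" for p
  proof -
    obtain q where q: "germ False U U (\<rho> t) p q"
      using right_PAC_germ_False[OF U PAC_right_PAC(1)[OF PAC]] p JU by blast
    have "q \<noteq> \<rho> t p" using p q by (auto simp: J_def jumps_def)
    have "germ False U U (\<rho> t) (P (x p)) q" "q \<noteq> \<rho> t (P (x p))" using q \<open>q \<noteq> \<rho> t p\<close> x[OF p] by simp_all
    from jump_persists[OF PAC[unfolded U_def] this[unfolded U_def P_def] d2]
    obtain \<kappa> where \<kappa>: "0 < \<kappa>" "\<And>g. g \<in> PAC U \<Longrightarrow> PAC_dist U g (\<rho> t) < \<kappa> \<Longrightarrow>
        \<exists>y. \<bar>y - x p\<bar> < \<delta> / 2 \<and> P y \<in> jumps U g"
      unfolding U_def P_def by blast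
    show ?thesis using \<kappa>(1) \<kappa>(2)[OF PAC] by blast
  qed
  then obtain \<kappa> where \<kappa>: "\<And>p. p \<in> J \<Longrightarrow> 0 < \<kappa> p" "\<And>p s. p \<in> J \<Longrightarrow> PAC_dist U (\<rho> s) (\<rho> t) < \<kappa> p \<Longrightarrow>
      \<exists>y. \<bar>y - x p\<bar> < \<delta> / 2 \<and> P y \<in> jumps U (\<rho> s)" by metis
  have "((\<lambda>s. PAC_dist U (\<rho> s) (\<rho> t)) \<longlongrightarrow> 0) (at t)"
    using h by (simp add: continuous_hom_def U_def)
  then have "\<forall>p\<in>J. eventually (\<lambda>s. PAC_dist U (\<rho> s) (\<rho> t) < \<kappa> p) (at t)"
    using \<kappa>(1) order_tendstoD(2) by blast
  then have "eventually (\<lambda>s. \<forall>p\<in>J. PAC_dist U (\<rho> s) (\<rho> t) < \<kappa> p) (at t)"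
    using finJ by (rule eventually_ball_finite[rotated])
  then show ?thesis unfolding U_def[symmetric] J_def[symmetric]
  proof eventually_elim
    case (elim s)
    then have "\<forall>p\<in>J. \<exists>y. \<bar>y - x p\<bar> < \<delta> / 2 \<and> P y \<in> jumps U (\<rho> s)" using \<kappa>(2) by blast
    then obtain y where y: "\<And>p. p \<in> J \<Longrightarrow> \<bar>y p - x p\<bar> < \<delta> / 2 \<and> P (y p) \<in> jumps U (\<rho> s)" by metis
    have near: "dom_dist U p (P (y p)) < \<delta> / 2" if "p \<in> J" for p
    proof -
      have "dom_dist U (P (x p)) (P (y p)) \<le> \<bar>x p - y p\<bar>" unfolding P_def by (rule dom_dist_le)
      then show ?thesis using y[OF that, THEN conjunct1] unfolding x[OF that] by linarith
    qed
    have eq: "p = q" if pq: "p \<in> J" "q \<in> J" "P (y p) = P (y q)" for p q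
    proof (rule ccontr)
      assume ne: "p \<noteq> q"
      have pqU: "p \<in> points U" "q \<in> points U" using subsetD[OF JU pq(1)] subsetD[OF JU pq(2)] by simp_all
      have "dom_dist U p q \<le> dom_dist U p (P (y p)) + dom_dist U (P (y p)) q"
        by (rule dom_dist_triangle[OF U pqU(1) PU pqU(2)])
      also have "dom_dist U (P (y p)) q = dom_dist U q (P (y q))"
        unfolding pq(3) by (rule dom_dist_commute[OF U])
      finally have "dom_dist U p q < \<delta> / 2 + \<delta> / 2" using near[OF pq(1)] near[OF pq(2)] by linarith
      then show False using \<delta>(2)[OF pq(1,2) ne] by simp
    qed
    then have "inj_on (\<lambda>p. P (y p)) J" by (intro inj_onI)
    then show "card J \<le> card (jumps U (\<rho> s))"
      by (rule card_inj_on_le) (use y fin in auto)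
  qed
qed

lemma jumps_compose_subset:
  assumes h: "continuous_hom unit_circle \<rho>"
  shows "jumps unit_circle (\<rho> (s + t))
    \<subseteq> jumps unit_circle (\<rho> t) \<union> {p \<in> points unit_circle. \<rho> t p \<in> jumps unit_circle (\<rho> s)}"
proof
  fix p assume p: "p \<in> jumps unit_circle (\<rho> (s + t))"
  then have pU: "p \<in> points unit_circle" by (simp add: jumps_def)
  show "p \<in> jumps unit_circle (\<rho> t) \<union> {p \<in> points unit_circle. \<rho> t p \<in> jumps unit_circle (\<rho> s)}"
  proof (rule ccontr)
    assume "\<not> ?thesis"
    then have "germ False unit_circle unit_circle (\<rho> t) p (\<rho> t p)"
      "germ False unit_circle unit_circle (\<rho> s) (\<rho> t p) (\<rho> s (\<rho> t p))"
      using pU continuous_hom_in[OF h] by (auto simp: jumps_def)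
    then have "germ False unit_circle unit_circle (\<lambda>p. \<rho> s (\<rho> t p)) p (\<rho> s (\<rho> t p))"
      by (rule germ_compose)
    then have "germ False unit_circle unit_circle (\<rho> (s + t)) p (\<rho> s (\<rho> t p))"
      by (rule germ_cong) (rule continuous_hom_add[OF h])
    then show False using p pU continuous_hom_add[OF h pU] by (simp add: jumps_def)
  qed
qed

lemma card_jumps_add:
  assumes h: "continuous_hom unit_circle \<rho>"
  shows "card (jumps unit_circle (\<rho> (s + t))) \<le> card (jumps unit_circle (\<rho> s)) + card (jumps unit_circle (\<rho> t))"
proof -
  have fin: "finite (jumps unit_circle (\<rho> s))" for s
    using finite_jumps[OF _ PAC_right_PAC(1)[OF continuous_hom_PAC[OF h]]] by simp
  have inj: "inj_on (\<rho> t) (points unit_circle)" using continuous_hom_bij[OF h] by (simp add: bij_betw_def)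
  let ?B = "{p \<in> points unit_circle. \<rho> t p \<in> jumps unit_circle (\<rho> s)}"
  have inj': "inj_on (\<rho> t) ?B" by (rule inj_on_subset[OF inj]) auto
  have sub: "\<rho> t ` ?B \<subseteq> jumps unit_circle (\<rho> s)" by auto
  have finB: "finite ?B" using finite_imageD[OF finite_subset[OF sub fin] inj'] .
  have "card ?B \<le> card (jumps unit_circle (\<rho> s))" by (rule card_inj_on_le[OF inj' sub fin])
  moreover have "card (jumps unit_circle (\<rho> (s + t))) \<le> card (jumps unit_circle (\<rho> t) \<union> ?B)"
    by (rule card_mono[OF _ jumps_compose_subset[OF h]]) (use fin finB in simp)
  moreover have "\<dots> \<le> card (jumps unit_circle (\<rho> t)) + card ?B" by (rule card_Un_le)
  ultimately show ?thesis by linarith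
qed

text \<open>Some set of parameters with at most \<open>n\<close> jumps contains an interval around some \<open>a\<close>, by the Baire
  category theorem. Translating by \<open>- a\<close> adds at most the jumps of \<open>\<rho> (- a)\<close>.\<close>

lemma bounded_jumps_near_0:
  assumes h: "continuous_hom unit_circle \<rho>"
  obtains \<epsilon> C where "0 < \<epsilon>" "\<And>t. \<bar>t\<bar> < \<epsilon> \<Longrightarrow> card (jumps unit_circle (\<rho> t)) \<le> C"
proof -
  define N where "N t = card (jumps unit_circle (\<rho> t))" for t
  have "open {t. n < N t}" for n
    unfolding open_dist
  proof (intro ballI)
    fix t assume t: "t \<in> {t. n < N t}"
    have "eventually (\<lambda>s. N t \<le> N s) (at t)" unfolding N_def by (rule eventually_jumps_ge[OF h])
    then obtain d where d: "0 < d" "\<And>s. s \<noteq> t \<Longrightarrow> dist s t < d \<Longrightarrow> N t \<le> N s"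
      unfolding eventually_at by blast
    have "s \<in> {t. n < N t}" if "dist s t < d" for s
      using d(2)[of s] that t by (cases "s = t") auto
    then show "\<exists>e>0. \<forall>s. dist s t < e \<longrightarrow> s \<in> {t. n < N t}" using d(1) by blast
  qed
  note op = this
  have "\<exists>n. closure {t. n < N t} \<noteq> UNIV"
  proof (rule ccontr)
    assume "\<not> ?thesis"
    then have "UNIV \<subseteq> closure (\<Inter> (range (\<lambda>n. {t. n < N t})))"
      using op by (intro Baire) auto
    moreover have "\<Inter> (range (\<lambda>n. {t. n < N t})) = {}" by auto
    ultimately show False by simp
  qed
  then obtain n a where "a \<notin> closure {t. n < N t}" by blast
  then obtain e where e: "0 < e" "\<And>t. dist t a < e \<Longrightarrow> t \<notin> {t. n < N t}"
    unfolding closure_approachable by (metis dist_commute)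
  show ?thesis
  proof (rule that[OF e(1)])
    fix t :: real assume "\<bar>t\<bar> < e"
    then have "N (a + t) \<le> n" using e(2)[of "a + t"] by (simp add: dist_real_def)
    moreover have "N (- a + (a + t)) \<le> N (- a) + N (a + t)" unfolding N_def by (rule card_jumps_add[OF h])
    ultimately have "N t \<le> N (- a) + n" by simp
    then show "card (jumps unit_circle (\<rho> t)) \<le> N (- a) + n" by (simp add: N_def)
  qed
qed

section \<open>The regluing permutation\<close>

lemma left_limit_germ:
  assumes "is_domain D" "right_PAC D f" "p \<in> points D"
  shows "germ False D D f p (left_limit D D f p)"
  using right_PAC_germ_False[OF assms] left_limit_eq[OF assms(1)] by metis

lemma left_limit_compose:
  assumes h: "continuous_hom D \<rho>" and D: "is_domain D" and p: "p \<in> points D"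
  shows "left_limit D D (\<rho> (s + t)) p = left_limit D D (\<rho> s) (left_limit D D (\<rho> t) p)"
proof -
  note PAC = PAC_right_PAC(1)[OF continuous_hom_PAC[OF h]]
  have 1: "germ False D D (\<rho> t) p (left_limit D D (\<rho> t) p)" using left_limit_germ[OF D PAC p] .
  then have "left_limit D D (\<rho> t) p \<in> points D" using germ_points by blast
  from left_limit_germ[OF D PAC this]
  have "germ False D D (\<rho> s) (left_limit D D (\<rho> t) p) (left_limit D D (\<rho> s) (left_limit D D (\<rho> t) p))" .
  from germ_compose[OF 1 this]
  have "germ False D D (\<rho> (s + t)) p (left_limit D D (\<rho> s) (left_limit D D (\<rho> t) p))"
    by (rule germ_cong) (rule continuous_hom_add[OF h])
  then show ?thesis by (rule left_limit_eq[OF D])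
qed

text \<open>The permutation of \<open>conjugating_permutation\<close> for the actions by values and by left limits. Both
  actions are extended by the identity outside the circle, which the permutation then fixes
  pointwise. The last clause is the relation \<open>\<sigma> \<circ> \<psi>\<^sub>t = \<phi>\<^sub>t \<circ> \<sigma>\<close>, written in terms of left germs.\<close>

theorem regluing:
  assumes h: "continuous_hom unit_circle \<rho>"
  obtains \<sigma> where "bij_betw \<sigma> (points unit_circle) (points unit_circle)"
    "finite {p \<in> points unit_circle. \<sigma> p \<noteq> p}"
    "\<And>t p. p \<in> points unit_circle \<Longrightarrow>
      germ False unit_circle unit_circle (\<rho> t) p (inv_into (points unit_circle) \<sigma> (\<rho> t (\<sigma> p)))"
proof -
  define U where "U = unit_circle"
  have U: "is_domain U" by (simp add: U_def)
  have hU: "continuous_hom U \<rho>" using h by (simp add: U_def)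
  note PAC = PAC_right_PAC(1)[OF continuous_hom_PAC[OF hU]]
  define \<phi> where "\<phi> t p = (if p \<in> points U then \<rho> t p else p)" for t p
  define \<psi> where "\<psi> t p = (if p \<in> points U then left_limit U U (\<rho> t) p else p)" for t p
  have germ_\<psi>: "germ False U U (\<rho> t) p (\<psi> t p)" if "p \<in> points U" for t p
    using left_limit_germ[OF U PAC that] that by (simp add: \<psi>_def)
  have \<psi>_in: "\<psi> t p \<in> points U" if "p \<in> points U" for t p
    using germ_points[OF germ_\<psi>[OF that]] by simp
  have act\<phi>: "real_action \<phi>"
    by unfold_locales (auto simp: \<phi>_def continuous_hom_0[OF hU] continuous_hom_add[OF hU] continuous_hom_in[OF hU])
  have act\<psi>: "real_action \<psi>"
  proof
    fix p
    have "germ False U U (\<rho> 0) p p" if "p \<in> points U"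
      using that continuous_hom_0[OF hU] by (intro germ_id)
    then show "\<psi> 0 p = p" using left_limit_eq[OF U] by (simp add: \<psi>_def)
    fix s t
    show "\<psi> (s + t) p = \<psi> s (\<psi> t p)"
      using left_limit_compose[OF hU U, of p s t] \<psi>_in[of p t] by (auto simp: \<psi>_def)
  qed
  have jumps: "{x. \<psi> t x \<noteq> \<phi> t x} = jumps U (\<rho> t)" for t
    unfolding jumps_eq[OF U PAC] by (auto simp: \<phi>_def \<psi>_def)
  have fin: "finite {x. \<psi> t x \<noteq> \<phi> t x}" for t
    unfolding jumps by (rule finite_jumps[OF U PAC])
  obtain \<epsilon> C where eC: "0 < \<epsilon>" "\<And>t. \<bar>t\<bar> < \<epsilon> \<Longrightarrow> card {x. \<psi> t x \<noteq> \<phi> t x} \<le> C"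
    using bounded_jumps_near_0[OF h] unfolding jumps U_def by blast
  obtain \<sigma> where \<sigma>: "bij \<sigma>" "finite {x. \<sigma> x \<noteq> x}" "\<And>t x. \<sigma> (\<psi> t x) = \<phi> t (\<sigma> x)"
    "\<And>x. (\<And>t. \<psi> t x = x) \<Longrightarrow> (\<And>t. \<phi> t x = x) \<Longrightarrow> \<sigma> x = x"
    using conjugating_permutation[OF act\<phi> act\<psi> eC(1) fin eC(2)] by blast
  have out: "\<sigma> x = x" if "x \<notin> points U" for x using that by (intro \<sigma>(4)) (auto simp: \<phi>_def \<psi>_def)
  have inj: "\<sigma> x = \<sigma> y \<longleftrightarrow> x = y" for x y using \<sigma>(1) by (metis bij_def injD)
  have in_iff: "\<sigma> x \<in> points U \<longleftrightarrow> x \<in> points U" for x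
    using out[of x] out[of "\<sigma> x"] inj by metis
  have bij: "bij_betw \<sigma> (points U) (points U)"
  proof (rule bij_betw_imageI)
    show "inj_on \<sigma> (points U)" using inj by (auto simp: inj_on_def)
    show "\<sigma> ` points U = points U"
    proof (intro equalityI subsetI)
      fix y assume y: "y \<in> points U"
      obtain x where "y = \<sigma> x" using \<sigma>(1) by (metis bij_pointE)
      then show "y \<in> \<sigma> ` points U" using y in_iff by blast
    qed (use in_iff in auto)
  qed
  show ?thesis
  proof (rule that[of \<sigma>])
    show "bij_betw \<sigma> (points unit_circle) (points unit_circle)" using bij by (simp add: U_def)
    show "finite {p \<in> points unit_circle. \<sigma> p \<noteq> p}" by (rule finite_subset[OF _ \<sigma>(2)]) auto
    fix t p assume "p \<in> points unit_circle"
    then have p: "p \<in> points U" by (simp add: U_def)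
    have "\<sigma> (\<psi> t p) = \<rho> t (\<sigma> p)" using \<sigma>(3)[of t p] p in_iff by (simp add: \<phi>_def)
    then have "inv_into (points U) \<sigma> (\<rho> t (\<sigma> p)) = \<psi> t p"
      using bij \<psi>_in[OF p] by (metis bij_betw_inv_into_left)
    then show "germ False unit_circle unit_circle (\<rho> t) p (inv_into (points unit_circle) \<sigma> (\<rho> t (\<sigma> p)))"
      using germ_\<psi>[OF p, of t] by (simp add: U_def)
  qed
qed


section \<open>Cutting circles out of a permutation of segments\<close>

lemma partial_sum_locate:
  fixes l :: "nat \<Rightarrow> real"
  assumes "0 \<le> y" "y < (\<Sum>j<n. l j)"
  shows "\<exists>k<n. (\<Sum>j<k. l j) \<le> y \<and> y < (\<Sum>j<k. l j) + l k"
  using assms(2)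
proof (induction n)
  case 0
  then show ?case using assms(1) by simp
next
  case (Suc n)
  show ?case
  proof (cases "y < (\<Sum>j<n. l j)")
    case True
    then show ?thesis using Suc.IH less_SucI by blast
  next
    case False
    then show ?thesis using Suc.prems by (intro exI[of _ n]) simp
  qed
qed

lemma partial_sum_unique:
  fixes l :: "nat \<Rightarrow> real"
  assumes pos: "\<And>j. j < n \<Longrightarrow> 0 < l j" and "k < n" "k' < n"
    and "(\<Sum>j<k. l j) \<le> y" "y < (\<Sum>j<k. l j) + l k" "(\<Sum>j<k'. l j) \<le> y" "y < (\<Sum>j<k'. l j) + l k'"
  shows "k = k'"
proof -
  have *: "False" if "k < k'" "k' < n" "y < (\<Sum>j<k. l j) + l k" "(\<Sum>j<k'. l j) \<le> y" for k k'
  proof -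
    have "(\<Sum>j<Suc k. l j) \<le> (\<Sum>j<k'. l j)"
      using that pos by (intro sum_mono2) (auto intro: less_imp_le)
    then show False using that by simp
  qed
  show ?thesis using *[of k k'] *[of k' k] assms by (metis linorder_neqE_nat)
qed

text \<open>Segments indexed by \<open>J\<close> are laid end to end along the cycles of \<open>\<tau>\<close>, one circle for each
  cycle: \<open>q\<close> is the number of the circle and \<open>off\<close> the position of the left end point.\<close>

definition tiles :: "'a set \<Rightarrow> ('a \<Rightarrow> 'a) \<Rightarrow> ('a \<Rightarrow> real) \<Rightarrow> real list \<Rightarrow> ('a \<Rightarrow> nat) \<Rightarrow> ('a \<Rightarrow> real) \<Rightarrow> bool" where
  "tiles J \<tau> len Ls q off \<longleftrightarrow> (\<forall>l\<in>set Ls. 0 < l) \<and>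
     (\<forall>x\<in>J. q x < length Ls \<and> 0 \<le> off x \<and> off x + len x \<le> Ls ! q x) \<and>
     (\<forall>i<length Ls. \<forall>y. 0 \<le> y \<longrightarrow> y < Ls ! i \<longrightarrow> (\<exists>x\<in>J. q x = i \<and> off x \<le> y \<and> y < off x + len x)) \<and>
     (\<forall>x\<in>J. \<forall>x'\<in>J. \<forall>y. q x = q x' \<longrightarrow> off x \<le> y \<longrightarrow> y < off x + len x \<longrightarrow>
        off x' \<le> y \<longrightarrow> y < off x' + len x' \<longrightarrow> x = x') \<and>
     (\<forall>x\<in>J. q (\<tau> x) = q x \<and>
        (off (\<tau> x) = off x + len x \<or> off (\<tau> x) = 0 \<and> off x + len x = Ls ! q x))"

lemma tilesD:
  assumes "tiles J \<tau> len Ls q off"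
  shows "l \<in> set Ls \<Longrightarrow> 0 < l" "x \<in> J \<Longrightarrow> q x < length Ls" "x \<in> J \<Longrightarrow> 0 \<le> off x"
    "x \<in> J \<Longrightarrow> off x + len x \<le> Ls ! q x"
    "i < length Ls \<Longrightarrow> 0 \<le> y \<Longrightarrow> y < Ls ! i \<Longrightarrow> \<exists>x\<in>J. q x = i \<and> off x \<le> y \<and> y < off x + len x"
    "x \<in> J \<Longrightarrow> x' \<in> J \<Longrightarrow> q x = q x' \<Longrightarrow> off x \<le> y \<Longrightarrow> y < off x + len x \<Longrightarrow>
      off x' \<le> y \<Longrightarrow> y < off x' + len x' \<Longrightarrow> x = x'"
    "x \<in> J \<Longrightarrow> q (\<tau> x) = q x"
    "x \<in> J \<Longrightarrow> off (\<tau> x) = off x + len x \<or> off (\<tau> x) = 0 \<and> off x + len x = Ls ! q x"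
  using assms unfolding tiles_def by blast+

text \<open>Induction on the set of segments: the cycle of one segment is taken out and forms a circle of
  its own, in which the segments are placed at the partial sums of their lengths.\<close>

lemma tiles_exist:
  assumes "finite J" "bij_betw \<tau> J J" "\<And>x. x \<in> J \<Longrightarrow> 0 < len x"
  shows "\<exists>Ls q off. tiles J \<tau> len Ls q off"
  using assms
proof (induction J rule: finite_psubset_induct)
  case (psubset J)
  show ?case
  proof (cases "J = {}")
    case True
    then show ?thesis by (intro exI[of _ "[]"]) (simp add: tiles_def)
  next
    case False
    then obtain x0 where x0: "x0 \<in> J" by blast
    define x where "x k = (\<tau> ^^ k) x0" for k
    have x_Suc: "x (Suc k) = \<tau> (x k)" for k by (simp add: x_def)
    have bijk: "bij_betw (\<tau> ^^ k) J J" for k using psubset.prems(1) by (rule bij_betw_funpow)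
    have xJ: "x k \<in> J" for k using bij_betwE[OF bijk] x0 by (simp add: x_def)
    have shift: "x (b - a) = x0" if "x a = x b" "a \<le> b" for a b
    proof -
      have "(\<tau> ^^ a) (x (b - a)) = x b"
        using that(2) unfolding x_def by (metis comp_apply funpow_add le_add_diff_inverse)
      then have "(\<tau> ^^ a) (x (b - a)) = (\<tau> ^^ a) x0" using that(1) by (simp add: x_def)
      then show ?thesis using bijk[of a] xJ x0 by (meson bij_betw_imp_inj_on inj_onD)
    qed
    have "\<exists>n. 0 < n \<and> x n = x0"
    proof -
      have "\<not> inj_on x {..card J}"
      proof
        assume "inj_on x {..card J}"
        then have "card {..card J} \<le> card J" using xJ psubset.hyps by (intro card_inj_on_le) auto
        then show False by simp
      qed
      then obtain a b where "x a = x b" "a < b" by (metis inj_onI linorder_neqE_nat)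
      then show ?thesis using shift[of a b] by (intro exI[of _ "b - a"]) simp
    qed
    then obtain n where n: "0 < n" "x n = x0" and least: "\<And>m. 0 < m \<Longrightarrow> x m = x0 \<Longrightarrow> n \<le> m"
      using exists_least_iff[of "\<lambda>n. 0 < n \<and> x n = x0"] by (metis not_le)
    have injx: "inj_on x {..<n}"
    proof -
      have "False" if "a < b" "b < n" "x a = x b" for a b
        using shift[of a b] least[of "b - a"] that by simp
      then show ?thesis by (intro inj_onI) (metis lessThan_iff linorder_neqE_nat)
    qed
    define Orb where "Orb = x ` {..<n}"
    have OJ: "Orb \<subseteq> J" using xJ by (auto simp: Orb_def)
    have x0O: "x0 \<in> Orb" unfolding Orb_def x_def using n(1) by force
    have \<tau>O: "\<tau> (x k) \<in> Orb" if "k < n" for k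
    proof (cases "Suc k = n")
      case True
      then show ?thesis using n(2) x0O x_Suc[of k] by simp
    next
      case False
      then show ?thesis using that x_Suc[of k] unfolding Orb_def by (intro image_eqI[of _ _ "Suc k"]) auto
    qed
    have inj\<tau>: "inj_on \<tau> J" and im\<tau>: "\<tau> ` J = J" using psubset.prems(1) by (auto simp: bij_betw_def)
    have "\<tau> ` Orb = Orb"
    proof (rule endo_inj_surj)
      show "finite Orb" by (simp add: Orb_def)
      show "\<tau> ` Orb \<subseteq> Orb" using \<tau>O by (auto simp: Orb_def)
      show "inj_on \<tau> Orb" using inj\<tau> OJ by (rule inj_on_subset)
    qed
    then have "\<tau> ` (J - Orb) = J - Orb"
      using inj_on_image_set_diff[OF inj\<tau>, of J Orb] im\<tau> OJ by simp
    then have "bij_betw \<tau> (J - Orb) (J - Orb)"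
      using inj_on_subset[OF inj\<tau>, of "J - Orb"] by (simp add: bij_betw_def)
    moreover have "J - Orb \<subset> J" using x0 x0O by blast
    ultimately obtain Ls q off where T: "tiles (J - Orb) \<tau> len Ls q off"
      using psubset.IH[of "J - Orb"] psubset.prems(2) by blast
    define S where "S k = (\<Sum>j<k. len (x j))" for k
    define idx where "idx y = the_inv_into {..<n} x y" for y
    have idx: "idx (x k) = k" if "k < n" for k
      unfolding idx_def using that by (intro the_inv_into_f_f[OF injx]) simp
    define q' where "q' y = (if y \<in> Orb then length Ls else q y)" for y
    define off' where "off' y = (if y \<in> Orb then S (idx y) else off y)" for y
    have lenpos: "0 < len (x j)" for j using psubset.prems(2) xJ by blast
    have xO: "x k \<in> Orb" if "k < n" for k using that by (simp add: Orb_def)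
    have qx: "q' (x k) = length Ls" "off' (x k) = S k" if "k < n" for k
      using that xO idx by (simp_all add: q'_def off'_def)
    have q0: "q' y = q y" "off' y = off y" if "y \<notin> Orb" for y
      using that by (simp_all add: q'_def off'_def)
    have Smono: "S a \<le> S b" if "a \<le> b" for a b
      unfolding S_def using that lenpos by (intro sum_mono2) (auto intro: less_imp_le)
    have S_Suc: "S (Suc k) = S k + len (x k)" for k by (simp add: S_def)
    have Sn: "0 < S n" unfolding S_def using n(1) lenpos by (intro sum_pos) auto
    have qlt: "q y < length Ls" if "y \<in> J - Orb" for y using T that by (simp add: tiles_def)
    let ?Ls = "Ls @ [S n]"
    have "tiles J \<tau> len ?Ls q' off'"
      unfolding tiles_def
    proof (intro conjI ballI allI impI)
      fix l assume "l \<in> set ?Ls"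
      then show "0 < l" using T Sn by (auto simp: tiles_def)
    next
      fix y assume y: "y \<in> J"
      have "q' y < length ?Ls \<and> 0 \<le> off' y \<and> off' y + len y \<le> ?Ls ! q' y \<and> q' (\<tau> y) = q' y \<and>
        (off' (\<tau> y) = off' y + len y \<or> off' (\<tau> y) = 0 \<and> off' y + len y = ?Ls ! q' y)"
      proof (cases "y \<in> Orb")
        case True
        then obtain k where k: "k < n" "y = x k" by (auto simp: Orb_def)
        have 1: "q' y = length Ls" "off' y = S k" using qx k by simp_all
        have 2: "0 \<le> S k" using Smono[of 0 k] by (simp add: S_def)
        have 3: "S k + len y \<le> S n" using Smono[of "Suc k" n] k S_Suc[of k] by simp
        have 4: "q' (\<tau> y) = length Ls" using \<tau>O[OF k(1)] k by (simp add: q'_def)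
        have 5: "off' (\<tau> y) = S k + len y \<or> off' (\<tau> y) = 0 \<and> S k + len y = S n"
        proof (cases "Suc k = n")
          case True
          then have "\<tau> y = x 0" using n(2) x_Suc[of k] k by (simp add: x_def)
          then show ?thesis using qx(2)[OF n(1)] True S_Suc[of k] k by (simp add: S_def)
        next
          case False
          then have "off' (x (Suc k)) = S (Suc k)" using k qx by simp
          then show ?thesis using x_Suc[of k] S_Suc[of k] k by simp
        qed
        show ?thesis using 1 2 3 4 5 by simp
      next
        case False
        then have y': "y \<in> J - Orb" using y by simp
        then have "\<tau> y \<in> J - Orb" using \<open>\<tau> ` (J - Orb) = J - Orb\<close> by blast
        then have "\<tau> y \<notin> Orb" by simp
        have "?Ls ! q y = Ls ! q y" using qlt[OF y'] by (simp add: nth_append)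
        then show ?thesis using tilesD(3,4,7,8)[OF T y'] qlt[OF y'] q0[OF False] q0[OF \<open>\<tau> y \<notin> Orb\<close>] by simp
      qed
      then show "q' y < length ?Ls" "0 \<le> off' y" "off' y + len y \<le> ?Ls ! q' y" "q' (\<tau> y) = q' y"
        "off' (\<tau> y) = off' y + len y \<or> off' (\<tau> y) = 0 \<and> off' y + len y = ?Ls ! q' y"
        by blast+
    next
      fix i y assume i: "i < length ?Ls" and y: "0 \<le> y" "y < ?Ls ! i"
      show "\<exists>z\<in>J. q' z = i \<and> off' z \<le> y \<and> y < off' z + len z"
      proof (cases "i < length Ls")
        case True
        then obtain z where z: "z \<in> J - Orb" "q z = i" "off z \<le> y" "y < off z + len z"
          using tilesD(5)[OF T True y(1)] y(2) by (auto simp: nth_append)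
        then show ?thesis using q0[of z] by auto
      next
        case False
        then have i': "i = length Ls" using i by simp
        then have "y < S n" using y by simp
        then obtain k where "k < n" "S k \<le> y" "y < S k + len (x k)"
          using partial_sum_locate[OF y(1), of "\<lambda>j. len (x j)" n] unfolding S_def by blast
        then show ?thesis using qx[of k] xJ i' by (intro bexI[of _ "x k"]) auto
      qed
    next
      fix z z' y
      assume zJ: "z \<in> J" "z' \<in> J" and q: "q' z = q' z'" and h: "off' z \<le> y" "y < off' z + len z"
        "off' z' \<le> y" "y < off' z' + len z'"
      show "z = z'"
      proof (cases "z \<in> Orb")
        case True
        have "z' \<in> Orb"
        proof (rule ccontr)
          assume "z' \<notin> Orb"
          then show False using q True qlt[of z'] zJ by (simp add: q'_def)
        qed
        then obtain k k' where k: "k < n" "z = x k" "k' < n" "z' = x k'" using True by (auto simp: Orb_def)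
        have "k = k'"
          using partial_sum_unique[of n "\<lambda>j. len (x j)" k k' y] lenpos h k qx[of k] qx[of k']
          unfolding S_def by simp
        then show ?thesis using k by simp
      next
        case False
        have "z' \<notin> Orb"
        proof
          assume "z' \<in> Orb"
          then show False using q False qlt[of z] zJ by (simp add: q'_def)
        qed
        then show ?thesis using T False zJ q h q0[of z] q0[of z'] unfolding tiles_def by auto
      qed
    qed
    then show ?thesis by blast
  qed
qed

section \<open>Subdivisions of the unit interval\<close>

locale subdivision =
  fixes G :: "real set"
  assumes finite: "finite G" and sub: "G \<subseteq> {0..<1}" and zero: "0 \<in> G"
begin

definition nxt :: "real \<Rightarrow> real" where
  "nxt x = Min (insert 1 {y \<in> G. x < y})"

lemma nxt_in: "nxt x \<in> insert 1 {y \<in> G. x < y}"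
  unfolding nxt_def using finite by (intro Min_in) auto

lemma nxt_greater: "x < 1 \<Longrightarrow> x < nxt x"
  using nxt_in[of x] by auto

lemma nxt_le_1: "nxt x \<le> 1"
  unfolding nxt_def using finite by (intro Min_le) auto

lemma nxt_le: "y \<in> G \<Longrightarrow> x < y \<Longrightarrow> nxt x \<le> y"
  unfolding nxt_def using finite by (intro Min_le) auto

lemma nxt_cases: "nxt x = 1 \<or> nxt x \<in> G"
  using nxt_in[of x] by auto

lemma segment_unique:
  assumes "x \<in> G" "x' \<in> G" "x \<le> z" "z < nxt x" "x' \<le> z" "z < nxt x'"
  shows "x = x'"
  using nxt_le[of x' x] nxt_le[of x x'] assms by linarith

lemma segment_exists:
  assumes "0 \<le> z" "z < 1"
  shows "\<exists>x\<in>G. x \<le> z \<and> z < nxt x"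
proof -
  let ?A = "{x \<in> G. x \<le> z}"
  define x where "x = Max ?A"
  have A: "finite ?A" "?A \<noteq> {}" using finite zero assms by auto
  have x: "x \<in> G" "x \<le> z" using Max_in[OF A] by (auto simp: x_def)
  have "z < nxt x"
  proof (rule ccontr)
    assume *: "\<not> z < nxt x"
    then have "nxt x \<in> G" using nxt_cases[of x] assms by auto
    then have "nxt x \<le> x" unfolding x_def[unfolded x_def] using * A by (intro Max_ge[of ?A, folded x_def]) auto
    then show False using nxt_greater[of x] x assms by simp
  qed
  then show ?thesis using x by blast
qed

lemma segment_exists_left:
  assumes "0 < z" "z \<le> 1"
  shows "\<exists>x\<in>G. x < z \<and> z \<le> nxt x"
proof -
  let ?A = "{x \<in> G. x < z}"
  define x where "x = Max ?A"
  have A: "finite ?A" "?A \<noteq> {}" using finite zero assms by auto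
  have x: "x \<in> G" "x < z" using Max_in[OF A] by (auto simp: x_def)
  have "z \<le> nxt x"
  proof (rule ccontr)
    assume *: "\<not> z \<le> nxt x"
    then have "nxt x \<in> G" using nxt_cases[of x] assms by auto
    then have "nxt x \<in> ?A" using * by simp
    then have "nxt x \<le> x" unfolding x_def using A(1) by (rule Max_ge[rotated])
    then show False using nxt_greater[of x] x assms by simp
  qed
  then show ?thesis using x by blast
qed

definition seg :: "real \<Rightarrow> real" where
  "seg z = (THE x. x \<in> G \<and> x \<le> z \<and> z < nxt x)"

lemma seg_eq: "x \<in> G \<Longrightarrow> x \<le> z \<Longrightarrow> z < nxt x \<Longrightarrow> seg z = x"
  unfolding seg_def by (rule the_equality) (auto intro: segment_unique)

lemma seg:
  assumes "0 \<le> z" "z < 1"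
  shows "seg z \<in> G" "seg z \<le> z" "z < nxt (seg z)"
  using segment_exists[OF assms] seg_eq by auto

lemma in_G: "x \<in> G \<Longrightarrow> 0 \<le> x \<and> x < 1"
  using sub by auto

text \<open>The end point \<open>1\<close> of the last segment is the point \<open>0\<close> of the circle.\<close>

definition cyclic_nxt :: "real \<Rightarrow> real" where
  "cyclic_nxt x = (if nxt x = 1 then 0 else nxt x)"

lemma bij_betw_cyclic_nxt: "bij_betw cyclic_nxt G G"
proof -
  have into: "cyclic_nxt x \<in> G" for x using nxt_cases[of x] zero by (auto simp: cyclic_nxt_def)
  have inj: "inj_on cyclic_nxt G"
  proof (rule inj_onI)
    fix x y assume xy: "x \<in> G" "y \<in> G" "cyclic_nxt x = cyclic_nxt y"
    have "0 < nxt x" "0 < nxt y" using nxt_greater in_G xy by (meson le_less_trans)+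
    then have "nxt x = nxt y" using xy(3) by (auto simp: cyclic_nxt_def split: if_splits)
    then show "x = y"
      using nxt_le[of y x] nxt_le[of x y] nxt_greater[of x] nxt_greater[of y] in_G xy
      by (metis linorder_neqE_linordered_idom not_le)
  qed
  show ?thesis unfolding bij_betw_def using inj into endo_inj_surj[OF finite _ inj] by auto
qed

end


section \<open>Regluing the unit circle\<close>

abbreviation cproj :: "real \<Rightarrow> point" where
  "cproj \<equiv> dom_proj unit_circle 0"

definition rep :: "point \<Rightarrow> real" where
  "rep p = the_inv_into {0..<1} cproj p"

lemma inj_on_cproj: "inj_on cproj {0..<1}"
  using inj_on_dom_proj[of unit_circle 0 0] by simp

lemma rep_cproj: "0 \<le> z \<Longrightarrow> z < 1 \<Longrightarrow> rep (cproj z) = z"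
  unfolding rep_def by (intro the_inv_into_f_f[OF inj_on_cproj]) simp

lemma cproj_eq_iff: "cproj y = cproj z \<longleftrightarrow> (\<exists>k::int. z = y + of_int k)"
  by (simp add: dom_proj_eq_iff)

lemma points_rep:
  assumes "p \<in> points unit_circle"
  shows "cproj (rep p) = p" "0 \<le> rep p" "rep p < 1"
proof -
  obtain x where x: "p = cproj x" using assms points_unit_circle by blast
  have "frac x = x + of_int (- \<lfloor>x\<rfloor>)" by (simp add: frac_def)
  then have p: "p = cproj (frac x)" unfolding x cproj_eq_iff by blast
  have "rep p = frac x" unfolding p by (intro rep_cproj) (simp_all add: frac_lt_1)
  then show "cproj (rep p) = p" "0 \<le> rep p" "rep p < 1" using p by (simp_all add: frac_lt_1)
qed

lemma cproj_in [simp]: "cproj z \<in> points unit_circle"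
  by simp

text \<open>The segments of the subdivision \<open>G\<close> are arranged along the cycles of the permutation that sends a
  segment with right end point \<open>p\<close> to the segment that starts at \<open>\<sigma> p\<close>. Hence the left side of \<open>p\<close>
  becomes adjacent to the right side of \<open>\<sigma> p\<close>.\<close>

locale regluing_map = subdivision +
  fixes \<sigma> :: "point \<Rightarrow> point" and D :: "real list" and q :: "real \<Rightarrow> nat" and off :: "real \<Rightarrow> real"
  assumes \<sigma>: "bij_betw \<sigma> (points unit_circle) (points unit_circle)"
    and support: "\<And>z. 0 \<le> z \<Longrightarrow> z < 1 \<Longrightarrow> z \<notin> G \<Longrightarrow> \<sigma> (cproj z) = cproj z"
    and tiles: "tiles G (\<lambda>x. rep (\<sigma> (cproj (cyclic_nxt x)))) (\<lambda>x. nxt x - x) D q off"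
begin

lemmas tile = tilesD[OF tiles, simplified]

lemma D: "is_domain D"
  using tile(1) by (simp add: is_domain_def)

text \<open>Translation of each segment to its place in the new domain.\<close>

definition glue :: "point \<Rightarrow> point" where
  "glue = restrict (\<lambda>p. dom_proj D (q (seg (rep p))) (rep p + (off (seg (rep p)) - seg (rep p)))) (points unit_circle)"

lemma glue_cproj:
  assumes "x \<in> G" "x \<le> z" "z < nxt x"
  shows "glue (cproj z) = dom_proj D (q x) (z + (off x - x))"
proof -
  have "0 \<le> z" "z < 1" using assms in_G[of x] nxt_le_1[of x] by linarith+
  then have "rep (cproj z) = z" by (rule rep_cproj)
  moreover have "seg z = x" using assms by (rule seg_eq)
  ultimately show ?thesis by (simp add: glue_def)
qed

lemma point_segment:
  assumes "p \<in> points unit_circle"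
  obtains x z where "x \<in> G" "x \<le> z" "z < nxt x" "p = cproj z" "0 \<le> z" "z < 1"
proof -
  note r = points_rep[OF assms]
  show ?thesis
    by (rule that[of "seg (rep p)" "rep p"]) (use r seg[OF r(2,3)] in simp_all)
qed

lemma glue_in: "p \<in> points unit_circle \<Longrightarrow> glue p \<in> points D"
  using point_segment[of p] glue_cproj tile(2) by (metis dom_proj_in_points)

lemma offset_bounds:
  assumes "x \<in> G" "x \<le> z" "z < nxt x"
  shows "0 \<le> z + (off x - x)" "z + (off x - x) < D ! q x"
  using tile(3,4)[OF assms(1)] assms by linarith+

lemma inj_glue: "inj_on glue (points unit_circle)"
proof (rule inj_onI)
  fix p p' assume pp: "p \<in> points unit_circle" "p' \<in> points unit_circle" "glue p = glue p'"
  obtain x z where x: "x \<in> G" "x \<le> z" "z < nxt x" "p = cproj z" using point_segment[OF pp(1)] by metis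
  obtain x' z' where x': "x' \<in> G" "x' \<le> z'" "z' < nxt x'" "p' = cproj z'" using point_segment[OF pp(2)] by metis
  have eq: "dom_proj D (q x) (z + (off x - x)) = dom_proj D (q x') (z' + (off x' - x'))"
    using pp(3) glue_cproj x x' by simp
  then have qq: "q x = q x'" by (simp add: dom_proj_eq_iff)
  have "z + (off x - x) = z' + (off x' - x')"
    by (rule dom_proj_near_imp_eq[OF eq[folded qq]])
       (use offset_bounds[OF x(1-3)] offset_bounds[OF x'(1-3)] qq in auto)
  moreover from this have "x = x'"
    using tile(6)[OF x(1) x'(1) qq, of "z + (off x - x)"] x x' by simp
  ultimately show "p = p'" using x x' by simp
qed

lemma surj_glue: "glue ` points unit_circle = points D"
proof (intro equalityI subsetI)
  fix r assume "r \<in> points D"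
  then obtain i w where r: "i < length D" "r = dom_proj D i w" by (auto simp: in_points_iff)
  have pos: "0 < D ! i" using D r(1) by (rule domain_pos)
  obtain m :: int where m: "0 \<le> w + of_int m * D ! i" "w + of_int m * D ! i < 0 + D ! i"
    using lift_in_window[OF pos, of 0 w] by blast
  define y where "y = w + of_int m * D ! i"
  have ry: "r = dom_proj D i y" unfolding y_def dom_proj_shift by (rule r(2))
  have y: "0 \<le> y" "y < D ! i" using m by (simp_all add: y_def)
  obtain x where x: "x \<in> G" "q x = i" "off x \<le> y" "y < off x + (nxt x - x)"
    using tile(5)[OF r(1) y] by auto
  have "glue (cproj (y - off x + x)) = dom_proj D (q x) (y - off x + x + (off x - x))"
    by (rule glue_cproj[OF x(1)]) (use x in auto)
  then have "r = glue (cproj (y - off x + x))" using ry x(2) by simp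
  then show "r \<in> glue ` points unit_circle" by (metis cproj_in image_eqI)
qed (use glue_in in auto)

lemma bij_glue: "bij_betw glue (points unit_circle) (points D)"
  by (simp add: bij_betw_def inj_glue surj_glue)

text \<open>For a translation, the germ of the inverse is available as well.\<close>

lemma translation_germs:
  assumes "j < length D" "0 < \<delta>"
    "\<And>y. y \<in> side r z \<delta> \<Longrightarrow> y \<noteq> z \<Longrightarrow> glue (cproj y) = dom_proj D j (y + c)"
  shows "germ r unit_circle D glue (cproj z) (dom_proj D j (z + c))"
    "germ r D unit_circle (inv_into (points unit_circle) glue) (dom_proj D j (z + c)) (cproj z)"
proof -
  show "germ r unit_circle D glue (cproj z) (dom_proj D j (z + c))"
    by (rule germ_translation[OF _ assms(1,2)]) (use assms(3) in auto)
  have "germ r D unit_circle (inv_into (points unit_circle) glue) (dom_proj D j (z + c)) (cproj (z + c + (- c)))"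
  proof (rule germ_translation[OF assms(1) _ assms(2)])
    fix y assume y: "y \<in> side r (z + c) \<delta>" "y \<noteq> z + c"
    have "y + (- c) \<in> side r z \<delta>" using side_add[OF y(1), of "- c"] by simp
    then have "glue (cproj (y + (- c))) = dom_proj D j y" using assms(3)[of "y + (- c)"] y(2) by simp
    then show "inv_into (points unit_circle) glue (dom_proj D j y) = cproj (y + (- c))"
      using inv_into_f_f[OF inj_glue cproj_in] by metis
  qed simp
  then show "germ r D unit_circle (inv_into (points unit_circle) glue) (dom_proj D j (z + c)) (cproj z)"
    by simp
qed

lemma glue_germs_right:
  assumes "p \<in> points unit_circle"
  shows "germ True unit_circle D glue p (glue p)"
    "germ True D unit_circle (inv_into (points unit_circle) glue) (glue p) p"
proof -
  obtain x z where x: "x \<in> G" "x \<le> z" "z < nxt x" "p = cproj z" using point_segment[OF assms] by metis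
  define \<delta> where "\<delta> = (nxt x - z) / 2"
  have \<delta>: "0 < \<delta>" using x by (simp add: \<delta>_def)
  have tr: "glue (cproj y) = dom_proj D (q x) (y + (off x - x))" if "y \<in> side True z \<delta>" for y
  proof (rule glue_cproj[OF x(1)])
    have "z \<le> y" "y \<le> z + \<delta>" using that by (auto simp: side_def)
    moreover have "z + \<delta> < nxt x" using x(3) by (simp add: \<delta>_def field_simps)
    ultimately show "x \<le> y" "y < nxt x" using x(2) by linarith+
  qed
  have "glue p = dom_proj D (q x) (z + (off x - x))" using glue_cproj x by simp
  then show "germ True unit_circle D glue p (glue p)"
    "germ True D unit_circle (inv_into (points unit_circle) glue) (glue p) p"
    using translation_germs[OF tile(2)[OF x(1)] \<delta> tr] x(4) by simp_all
qed

lemma \<sigma>_in: "p \<in> points unit_circle \<Longrightarrow> \<sigma> p \<in> points unit_circle"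
  using \<sigma> by (metis bij_betwE)

text \<open>The left germ at a cut point \<open>p\<close> is carried to the right end of the segment before \<open>p\<close>, and
  the next segment in the cycle, which begins there, is the one that starts at \<open>\<sigma> p\<close>.\<close>

lemma glue_germs_left:
  assumes "p \<in> points unit_circle"
  shows "germ False unit_circle D glue p (glue (\<sigma> p))"
    "germ False D unit_circle (inv_into (points unit_circle) glue) (glue (\<sigma> p)) p"
proof -
  obtain z where z: "0 < z" "z \<le> 1" "p = cproj z"
  proof (cases "rep p = 0")
    case True
    have "cproj 1 = cproj 0" using dom_proj_shift[of unit_circle 0 0 1] by simp
    then show ?thesis using that[of 1] points_rep(1)[OF assms] True by simp
  next
    case False
    then show ?thesis using that[of "rep p"] points_rep[OF assms] by simp
  qed
  obtain x where x: "x \<in> G" "x < z" "z \<le> nxt x" using segment_exists_left[OF z(1,2)] by blast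
  define \<delta> where "\<delta> = z - x"
  have \<delta>: "0 < \<delta>" using x by (simp add: \<delta>_def)
  have tr: "glue (cproj y) = dom_proj D (q x) (y + (off x - x))" if "y \<in> side False z \<delta>" "y \<noteq> z" for y
    using that x by (intro glue_cproj) (auto simp: side_def \<delta>_def)
  have "glue (\<sigma> p) = dom_proj D (q x) (z + (off x - x))"
  proof (cases "z < nxt x")
    case True
    have "z \<notin> G"
    proof
      assume "z \<in> G"
      then show False using nxt_le[of z x] x True by simp
    qed
    then have "\<sigma> p = p" using support[of z] z True nxt_le_1[of x] by simp
    then show ?thesis using glue_cproj[of x z] x True z by simp
  next
    case False
    then have zn: "z = nxt x" using x by simp
    define x' where "x' = rep (\<sigma> (cproj (cyclic_nxt x)))"
    have pc: "p = cproj (cyclic_nxt x)"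
    proof (cases "nxt x = 1")
      case True
      have "cproj 1 = cproj 0" using dom_proj_shift[of unit_circle 0 0 1] by simp
      then show ?thesis using True zn z by (simp add: cyclic_nxt_def)
    next
      case False
      then show ?thesis using zn z by (simp add: cyclic_nxt_def)
    qed
    have px': "\<sigma> p = cproj x'" "0 \<le> x'" "x' < 1"
      using points_rep[OF \<sigma>_in[OF assms]] pc by (simp_all add: x'_def)
    have x'G: "x' \<in> G"
    proof (rule ccontr)
      assume "x' \<notin> G"
      then have "\<sigma> (\<sigma> p) = \<sigma> p" using support[of x'] px' by simp
      then have "\<sigma> p = p" using \<sigma> assms \<sigma>_in by (metis bij_betw_inv_into_left)
      then have "cproj x' = cproj (cyclic_nxt x)" using px' pc by simp
      then have "x' = cyclic_nxt x"
        using inj_on_cproj px' in_G[of "cyclic_nxt x"] bij_betwE[OF bij_betw_cyclic_nxt] x(1)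
        by (intro dom_proj_near_imp_eq[of unit_circle 0]) auto
      then show False using \<open>x' \<notin> G\<close> bij_betwE[OF bij_betw_cyclic_nxt] x(1) by blast
    qed
    have "x' < nxt x'" using px' nxt_greater by blast
    then have gx': "glue (\<sigma> p) = dom_proj D (q x') (off x')"
      using glue_cproj[of x' x'] x'G px' by simp
    have "q x' = q x" using tile(7)[OF x(1)] by (simp add: x'_def)
    moreover have "off x' = off x + (nxt x - x) \<or> off x' = 0 \<and> off x + (nxt x - x) = D ! q x"
      using tile(8)[OF x(1)] by (simp add: x'_def)
    then have "z + (off x - x) = off x' \<or> z + (off x - x) = off x' + of_int 1 * D ! q x"
      using zn by auto
    then have "dom_proj D (q x) (off x') = dom_proj D (q x) (z + (off x - x))"
      using dom_proj_shift[of D "q x" "off x'" 1] by metis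
    ultimately show ?thesis using gx' by simp
  qed
  then show "germ False unit_circle D glue p (glue (\<sigma> p))"
    "germ False D unit_circle (inv_into (points unit_circle) glue) (glue (\<sigma> p)) p"
    using translation_germs[OF tile(2)[OF x(1)] \<delta> tr] z(3) by simp_all
qed

lemma glue_orientation_preserving: "orientation_preserving unit_circle D glue"
  using germs_imp_orientation_preserving[OF is_domain_unit_circle D inj_glue]
    glue_germs_right(1) glue_germs_left(1) by blast

lemma glue_continuous_at:
  assumes "p \<in> points unit_circle" "\<sigma> p = p"
  shows "topcontinuous_at (dom_top unit_circle) (dom_top D) glue p"
  using germs_imp_topcontinuous_at[OF is_domain_unit_circle D _ glue_germs_right(1)[OF assms(1)]]
    glue_germs_left(1)[OF assms(1)] assms(2) glue_in by auto

lemma finite_support: "finite {p \<in> points unit_circle. \<sigma> p \<noteq> p}"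
proof (rule finite_subset)
  show "finite (cproj ` G)" using finite by simp
  show "{p \<in> points unit_circle. \<sigma> p \<noteq> p} \<subseteq> cproj ` G"
  proof
    fix p assume "p \<in> {p \<in> points unit_circle. \<sigma> p \<noteq> p}"
    then have p: "p \<in> points unit_circle" "\<sigma> p \<noteq> p" by simp_all
    then have "rep p \<in> G" using support[of "rep p"] points_rep[OF p(1)] by metis
    then show "p \<in> cproj ` G" using points_rep(1)[OF p(1)] by force
  qed
qed

lemma finite_discontinuities_glue: "finite (discontinuities unit_circle D glue)"
proof (rule finite_subset[OF _ finite_support])
  show "discontinuities unit_circle D glue \<subseteq> {p \<in> points unit_circle. \<sigma> p \<noteq> p}"
    unfolding discontinuities_def using glue_continuous_at by blast
qed

text \<open>On a circle, the distance of two points is the distance of their lifts only up to half of the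
  length. Therefore the segments are subdivided into pieces that are shorter than half of every
  circle involved.\<close>

lemma glue_piecewise_isometric: "piecewise_isometric unit_circle D glue"
proof -
  \<comment> \<open>The member \<open>1\<close> stands for the unit circle, whose length counts as well.\<close>
  define L where "L = Min (insert 1 (set D))"
  have L: "0 < L" "\<And>i. i < length D \<Longrightarrow> L \<le> D ! i" "L \<le> 1"
  proof -
    have "L \<in> insert 1 (set D)" unfolding L_def by (intro Min_in) auto
    then show "0 < L" using D by (auto simp: is_domain_def)
    show "L \<le> D ! i" if "i < length D" for i unfolding L_def using that by (intro Min_le) auto
    show "L \<le> 1" unfolding L_def by (intro Min_le) auto
  qed
  obtain K :: nat where K: "2 / L < real K" using reals_Archimedean2 by blast
  have K0: "0 < real K" by (rule le_less_trans[OF _ K]) (use L in simp)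
  have KL: "1 / real K \<le> L / 2"
  proof -
    have "2 < real K * L" using K L(1) by (simp add: field_simps)
    then show ?thesis using K0 by (simp add: field_simps)
  qed
  define G' where "G' = G \<union> (\<lambda>k. real k / real K) ` {..<K}"
  interpret fine: subdivision G'
  proof
    show "finite G'" using finite by (simp add: G'_def)
    show "0 \<in> G'" using zero by (simp add: G'_def)
    show "G' \<subseteq> {0..<1}" using sub K0 by (auto simp: G'_def)
  qed
  have short: "fine.nxt x \<le> x + 1 / real K" if x: "x \<in> G'" for x
  proof -
    define k where "k = Suc (nat \<lfloor>x * real K\<rfloor>)"
    have x01: "0 \<le> x" "x < 1" using fine.in_G[OF x] by auto
    have "of_int \<lfloor>x * real K\<rfloor> \<le> x * real K" "x * real K < of_int \<lfloor>x * real K\<rfloor> + 1" by linarith+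
    moreover have "real k = of_int \<lfloor>x * real K\<rfloor> + 1" using x01 K0 by (simp add: k_def)
    ultimately have k: "x * real K < real k" "real k \<le> x * real K + 1" by linarith+
    then have k': "x < real k / real K" "real k / real K \<le> x + 1 / real K"
      using K0 by (simp_all add: field_simps)
    show ?thesis
    proof (cases "k < K")
      case True
      then have "real k / real K \<in> G'" by (simp add: G'_def)
      then show ?thesis using fine.nxt_le[of "real k / real K" x] k' by linarith
    next
      case False
      then have "1 \<le> real k / real K" using K0 by (simp add: field_simps)
      then show ?thesis using fine.nxt_le_1[of x] k' by linarith
    qed
  qed
  have refine: "\<exists>x'\<in>G. x' \<le> x \<and> fine.nxt x \<le> nxt x'" if x: "x \<in> G'" for x
  proof -
    have x01: "0 \<le> x" "x < 1" using fine.in_G[OF x] by auto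
    obtain x' where x': "x' \<in> G" "x' \<le> x" "x < nxt x'" using segment_exists[OF x01] by blast
    have "fine.nxt x \<le> nxt x'"
    proof (cases "nxt x' = 1")
      case True
      then show ?thesis using fine.nxt_le_1 by simp
    next
      case False
      then have "nxt x' \<in> G'" using nxt_cases[of x'] by (simp add: G'_def)
      then show ?thesis using x'(3) by (rule fine.nxt_le)
    qed
    then show ?thesis using x' by blast
  qed
  define Q where "Q = (\<lambda>x. cproj ` {x..<fine.nxt x}) ` G'"
  have lt1: "x < fine.nxt x" "0 \<le> x" "fine.nxt x \<le> 1" if "x \<in> G'" for x
    using fine.nxt_greater fine.in_G[OF that] fine.nxt_le_1 by auto
  have same: "x = x'" if xx: "x \<in> G'" "x' \<in> G'" "cproj ` {x..<fine.nxt x} \<inter> cproj ` {x'..<fine.nxt x'} \<noteq> {}" for x x'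
  proof -
    obtain p where p: "p \<in> cproj ` {x..<fine.nxt x}" "p \<in> cproj ` {x'..<fine.nxt x'}" using xx(3) by blast
    obtain z where z1: "p = cproj z" "z \<in> {x..<fine.nxt x}" using p(1) by (rule imageE)
    obtain z' where z2: "p = cproj z'" "z' \<in> {x'..<fine.nxt x'}" using p(2) by (rule imageE)
    have z: "x \<le> z" "z < fine.nxt x" "x' \<le> z'" "z' < fine.nxt x'" "cproj z = cproj z'"
      using z1 z2 by simp_all
    have "z = z'" by (rule dom_proj_near_imp_eq[OF z(5)]) (use z lt1[OF xx(1)] lt1[OF xx(2)] in auto)
    then show ?thesis using fine.segment_unique[OF xx(1,2)] z by blast
  qed
  have "partition_on (points unit_circle) Q"
  proof (rule partition_onI)
    show "\<Union> Q = points unit_circle"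
    proof (intro equalityI subsetI)
      fix p assume p: "p \<in> points unit_circle"
      obtain x where "x \<in> G'" "x \<le> rep p" "rep p < fine.nxt x"
        using fine.segment_exists[OF points_rep(2,3)[OF p]] by blast
      then show "p \<in> \<Union> Q" unfolding Q_def using points_rep(1)[OF p] by force
    qed (auto simp: Q_def)
    show "disjnt A B" if AB: "A \<in> Q" "B \<in> Q" "A \<noteq> B" for A B
    proof -
      obtain x x' where x: "x \<in> G'" "A = cproj ` {x..<fine.nxt x}" "x' \<in> G'" "B = cproj ` {x'..<fine.nxt x'}"
        using AB unfolding Q_def by blast
      then show ?thesis using same[of x x'] AB(3) unfolding disjnt_def by blast
    qed
    show "{} \<notin> Q"
    proof
      assume "{} \<in> Q"
      then obtain x where "x \<in> G'" "{} = cproj ` {x..<fine.nxt x}" unfolding Q_def by blast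
      then show False using lt1(1)[of x] by auto
    qed
  qed
  moreover have "finite Q" unfolding Q_def using fine.finite by simp
  moreover have "(\<exists>i a b. interval_lifts unit_circle i a b \<and> A = dom_proj unit_circle i ` {a..<b}) \<and>
      (\<forall>p\<in>A. \<forall>p'\<in>A. dom_dist D (glue p) (glue p') = dom_dist unit_circle p p')" if AQ: "A \<in> Q" for A
  proof -
    obtain x where x: "x \<in> G'" "A = cproj ` {x..<fine.nxt x}" using AQ unfolding Q_def by blast
    have "fine.nxt x < x + 1" using short[OF x(1)] KL L(3) by linarith
    then have "interval_lifts unit_circle 0 x (fine.nxt x)"
      using lt1[OF x(1)] by (simp add: interval_lifts_iff)
    moreover have "dom_dist D (glue p) (glue p') = dom_dist unit_circle p p'" if pA: "p \<in> A" "p' \<in> A" for p p'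
    proof -
      obtain x' where x': "x' \<in> G" "x' \<le> x" "fine.nxt x \<le> nxt x'" using refine[OF x(1)] by blast
      obtain z z' where z: "p = cproj z" "x \<le> z" "z < fine.nxt x" "p' = cproj z'" "x \<le> z'" "z' < fine.nxt x"
        using pA x(2) by auto
      have d: "\<bar>z - z'\<bar> \<le> L / 2" using z short[OF x(1)] KL by linarith
      have "glue p = dom_proj D (q x') (z + (off x' - x'))" "glue p' = dom_proj D (q x') (z' + (off x' - x'))"
        using glue_cproj[of x'] x' z by auto
      moreover have "dom_dist D (dom_proj D (q x') (z + (off x' - x'))) (dom_proj D (q x') (z' + (off x' - x'))) = \<bar>z - z'\<bar>"
        using dom_dist_eq[of "z + (off x' - x')" "z' + (off x' - x')" D "q x'"] d L(2)[OF tile(2)[OF x'(1)]] by simp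
      moreover have "dom_dist unit_circle p p' = \<bar>z - z'\<bar>"
        unfolding z(1,4) by (rule dom_dist_eq) (use d L(3) in simp)
      ultimately show ?thesis by simp
    qed
    ultimately show ?thesis using x(2) by blast
  qed
  ultimately show ?thesis unfolding piecewise_isometric_def by blast
qed

lemma glue_IET: "glue \<in> IET unit_circle D"
proof -
  have "right_continuous unit_circle D glue"
    by (rule germs_imp_right_continuous[OF D glue_germs_right(1)])
  moreover have "glue \<in> extensional (points unit_circle)" by (simp add: glue_def)
  ultimately show ?thesis
    unfolding IET_def using bij_glue glue_piecewise_isometric glue_orientation_preserving
      finite_discontinuities_glue by simp
qed

end


section \<open>The conjugated flow\<close>

lemma AE_lborel_shift:
  fixes c :: real
  assumes "AE z in lborel. Q z"
  shows "AE y in lborel. Q (y + c)"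
proof -
  obtain N where N: "N \<in> null_sets lborel" "{z \<in> space lborel. \<not> Q z} \<subseteq> N"
    using assms unfolding eventually_ae_filter by blast
  have "{y. y - (- c) \<in> N} \<in> null_sets lborel" by (rule null_sets_translation[OF N(1)])
  then show ?thesis
    unfolding eventually_ae_filter by (rule bexI[rotated]) (use N(2) in auto)
qed

lemma PAC_dist_integral_tendsto:
  assumes D: "is_domain D" and h: "continuous_hom D \<rho>"
  shows "((\<lambda>s. dom_integral D (\<lambda>p. dom_dist D (\<rho> s p) (\<rho> t p))) \<longlongrightarrow> 0) (at t)"
proof (rule tendsto_sandwich[of "\<lambda>_. 0" _ _ "\<lambda>s. PAC_dist D (\<rho> s) (\<rho> t)"])
  have nn: "0 \<le> dom_integral D (\<lambda>p. dom_dist D (f p) (g p))" for f g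
    by (rule dom_integral_nonneg) (rule dom_dist_nonneg[OF D])
  show "eventually (\<lambda>s. 0 \<le> dom_integral D (\<lambda>p. dom_dist D (\<rho> s p) (\<rho> t p))) (at t)"
    by (intro always_eventually allI nn)
  show "eventually (\<lambda>s. dom_integral D (\<lambda>p. dom_dist D (\<rho> s p) (\<rho> t p)) \<le> PAC_dist D (\<rho> s) (\<rho> t)) (at t)"
    unfolding PAC_dist_def by (intro always_eventually allI) (simp add: nn)
  show "((\<lambda>s. PAC_dist D (\<rho> s) (\<rho> t)) \<longlongrightarrow> 0) (at t)" using h by (simp add: continuous_hom_def)
qed simp

text \<open>Convergence in mean is too weak to be carried over pointwise by a discontinuous map; almost
  everywhere convergence along a subsequence is not.\<close>

lemma AE_convergent_subsequence:
  assumes h: "continuous_hom unit_circle \<rho>" and X: "\<And>n. X n \<noteq> t" "X \<longlonglongrightarrow> t"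
  obtains r where "strict_mono (r :: nat \<Rightarrow> nat)"
    "AE z in lborel. 0 \<le> z \<and> z < 1 \<longrightarrow>
      (\<lambda>n. dom_dist unit_circle (\<rho> (X (r n)) (cproj z)) (\<rho> t (cproj z))) \<longlonglongrightarrow> 0"
proof -
  let ?d = "\<lambda>n z. dom_dist unit_circle (\<rho> (X n) (cproj z)) (\<rho> t (cproj z))"
  let ?u = "\<lambda>n z. indicat_real {0..<1} z *\<^sub>R ?d n z"
  have rc: "right_continuous unit_circle unit_circle (\<rho> s)" for s
    by (rule right_PAC_right_continuous[OF PAC_right_PAC(1)[OF continuous_hom_PAC[OF h]]])
  have int: "integrable lborel (?u n)" for n
    using dist_integrable[OF is_domain_unit_circle rc rc, of 0 0 1 "X n" t]
    unfolding set_integrable_def by simp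
  have "norm (?u n z) = ?u n z" for n z
    using dom_dist_nonneg[OF is_domain_unit_circle] by simp
  then have eq: "(\<integral>z. norm (?u n z) \<partial>lborel)
      = dom_integral unit_circle (\<lambda>p. dom_dist unit_circle (\<rho> (X n) p) (\<rho> t p))" for n
    by (simp add: dom_integral_def set_lebesgue_integral_def)
  have "filterlim X (at t) sequentially"
    using X by (auto simp: filterlim_at)
  then have "(\<lambda>n. dom_integral unit_circle (\<lambda>p. dom_dist unit_circle (\<rho> (X n) p) (\<rho> t p))) \<longlonglongrightarrow> 0"
    by (rule filterlim_compose[OF PAC_dist_integral_tendsto[OF is_domain_unit_circle h]])
  then have lim: "(\<lambda>n. \<integral>z. norm (?u n z) \<partial>lborel) \<longlonglongrightarrow> 0" unfolding eq .
  obtain r where r: "strict_mono (r :: nat \<Rightarrow> nat)" "AE z in lborel. (\<lambda>n. ?u (r n) z) \<longlonglongrightarrow> 0"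
    using tendsto_L1_AE_subseq[OF int lim] by blast
  have "AE z in lborel. 0 \<le> z \<and> z < 1 \<longrightarrow> (\<lambda>n. ?d (r n) z) \<longlonglongrightarrow> 0"
    using r(2) by eventually_elim auto
  then show ?thesis using that r(1) by blast
qed

lemma dom_integral_tendsto_0:
  assumes D: "is_domain D" and f: "\<And>n. right_continuous D D (f n)" and g: "right_continuous D D g"
    and lim: "\<And>i. i < length D \<Longrightarrow> AE y in lborel. 0 \<le> y \<and> y < D ! i \<longrightarrow>
      (\<lambda>n. dom_dist D (f n (dom_proj D i y)) (g (dom_proj D i y))) \<longlonglongrightarrow> 0"
  shows "(\<lambda>n. dom_integral D (\<lambda>p. dom_dist D (f n p) (g p))) \<longlonglongrightarrow> 0"
proof -
  have "(\<lambda>n. set_lebesgue_integral lborel {0..<D ! i} (\<lambda>y. dom_dist D (f n (dom_proj D i y)) (g (dom_proj D i y))))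
      \<longlonglongrightarrow> 0" if i: "i < length D" for i
  proof -
    let ?s = "\<lambda>n y. indicat_real {0..<D ! i} y *\<^sub>R dom_dist D (f n (dom_proj D i y)) (g (dom_proj D i y))"
    have "(\<lambda>n. integral\<^sup>L lborel (?s n)) \<longlonglongrightarrow> integral\<^sup>L lborel (\<lambda>_ :: real. 0 :: real)"
    proof (rule integral_dominated_convergence[where s = ?s and f = "\<lambda>_. 0" and M = lborel
          and w = "\<lambda>y. indicat_real {0..<D ! i} y *\<^sub>R sum_list D"])
      show "?s n \<in> borel_measurable lborel" for n
      proof -
        have [measurable]: "(\<lambda>y. dom_dist D (f n (dom_proj D i y)) (g (dom_proj D i y))) \<in> borel_measurable borel"
          by (rule dist_measurable[OF D f g i])
        show ?thesis by measurable
      qed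
      show "integrable lborel (\<lambda>y. indicat_real {0..<D ! i} y *\<^sub>R sum_list D)"
        using set_integrable_const_Ico[of 0 "D ! i" "sum_list D"] unfolding set_integrable_def .
      show "AE y in lborel. (\<lambda>n. ?s n y) \<longlonglongrightarrow> 0"
        using lim[OF i]
      proof eventually_elim
        case (elim y)
        show ?case
        proof (cases "y \<in> {0..<D ! i}")
          case True
          then show ?thesis using elim by simp
        qed simp
      qed
      show "AE y in lborel. norm (?s n y) \<le> indicat_real {0..<D ! i} y *\<^sub>R sum_list D" for n
      proof (intro AE_I2)
        fix y
        have "dom_dist D (f n (dom_proj D i y)) (g (dom_proj D i y)) \<le> sum_list D"
          by (rule dom_dist_bounded[OF D]) (rule right_continuous_in_points[OF D _ i], use f g in blast)+
        then show "norm (?s n y) \<le> indicat_real {0..<D ! i} y *\<^sub>R sum_list D"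
          using dom_dist_nonneg[OF D] by (simp add: indicator_def)
      qed
    qed simp
    then show ?thesis by (simp add: set_lebesgue_integral_def)
  qed
  then have "(\<lambda>n. dom_integral D (\<lambda>p. dom_dist D (f n p) (g p))) \<longlonglongrightarrow> (\<Sum>i<length D. 0)"
    unfolding dom_integral_def by (intro tendsto_sum) simp
  then show ?thesis by simp
qed

text \<open>The condition on left germs says that \<open>\<sigma>\<close> intertwines the left limits of \<open>\<rho> t\<close> with \<open>\<rho> t\<close>.\<close>

locale reglued_flow = regluing_map +
  fixes \<rho> :: "real \<Rightarrow> point \<Rightarrow> point"
  assumes hom: "continuous_hom unit_circle \<rho>"
    and left_germs: "\<And>t p. p \<in> points unit_circle \<Longrightarrow>
      germ False unit_circle unit_circle (\<rho> t) p (inv_into (points unit_circle) \<sigma> (\<rho> t (\<sigma> p)))"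
begin

definition reglued :: "real \<Rightarrow> point \<Rightarrow> point" where
  "reglued t = restrict (glue \<circ> \<rho> t \<circ> inv_into (points unit_circle) glue) (points D)"

lemma glue_inv:
  assumes "r \<in> points D"
  shows "inv_into (points unit_circle) glue r \<in> points unit_circle"
    "glue (inv_into (points unit_circle) glue r) = r"
  using bij_betwE[OF bij_betw_inv_into[OF bij_glue]] bij_betw_inv_into_right[OF bij_glue] assms by blast+

lemma reglued_eq: "r \<in> points D \<Longrightarrow> reglued t r = glue (\<rho> t (inv_into (points unit_circle) glue r))"
  by (simp add: reglued_def)

lemma reglued_glue: "p \<in> points unit_circle \<Longrightarrow> reglued t (glue p) = glue (\<rho> t p)"
  using glue_in[of p] inv_into_f_f[OF inj_glue] by (simp add: reglued_eq)

lemma \<rho>_in: "p \<in> points unit_circle \<Longrightarrow> \<rho> t p \<in> points unit_circle"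
  by (rule continuous_hom_in[OF hom])

lemma reglued_in: "r \<in> points D \<Longrightarrow> reglued t r \<in> points D"
  using glue_in \<rho>_in glue_inv by (simp add: reglued_eq)

lemma reglued_germ_right:
  assumes r: "r \<in> points D"
  shows "germ True D D (reglued t) r (reglued t r)"
proof -
  define p where "p = inv_into (points unit_circle) glue r"
  have p: "p \<in> points unit_circle" "glue p = r" using glue_inv[OF r] by (simp_all add: p_def)
  have 1: "germ True D unit_circle (inv_into (points unit_circle) glue) r p"
    using glue_germs_right(2)[OF p(1)] p(2) by simp
  have 2: "germ True unit_circle unit_circle (\<rho> t) p (\<rho> t p)"
    by (rule right_PAC_germ_True[OF is_domain_unit_circle PAC_right_PAC(1)[OF continuous_hom_PAC[OF hom]] p(1)])
  have 3: "germ True unit_circle D glue (\<rho> t p) (glue (\<rho> t p))" by (rule glue_germs_right(1)[OF \<rho>_in[OF p(1)]])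
  have "germ True D D (reglued t) r (glue (\<rho> t p))"
    by (rule germ_cong[OF germ_compose[OF germ_compose[OF 1 2] 3]]) (rule reglued_eq)
  then show ?thesis using reglued_eq[OF r] by (simp add: p_def)
qed

text \<open>This is where the intertwining relation enters: the left germ at \<open>r = glue (\<sigma> p')\<close> goes to the
  left germ at \<open>p'\<close>, then to the left germ at \<open>s\<close> with \<open>\<sigma> s = \<rho> t (\<sigma> p')\<close>, and finally to the left
  germ at \<open>glue (\<sigma> s)\<close>, which is the value at \<open>r\<close>.\<close>

lemma reglued_germ_left:
  assumes r: "r \<in> points D"
  shows "germ False D D (reglued t) r (reglued t r)"
proof -
  define p where "p = inv_into (points unit_circle) glue r"
  have p: "p \<in> points unit_circle" "glue p = r" using glue_inv[OF r] by (simp_all add: p_def)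
  have inv\<sigma>: "inv_into (points unit_circle) \<sigma> x \<in> points unit_circle"
    "\<sigma> (inv_into (points unit_circle) \<sigma> x) = x" if "x \<in> points unit_circle" for x
    using bij_betwE[OF bij_betw_inv_into[OF \<sigma>]] bij_betw_inv_into_right[OF \<sigma>] that by blast+
  define p' where "p' = inv_into (points unit_circle) \<sigma> p"
  have p': "p' \<in> points unit_circle" "\<sigma> p' = p" using inv\<sigma>[OF p(1)] by (simp_all add: p'_def)
  define s where "s = inv_into (points unit_circle) \<sigma> (\<rho> t p)"
  have s: "s \<in> points unit_circle" "\<sigma> s = \<rho> t p" using inv\<sigma>[OF \<rho>_in[OF p(1)]] by (simp_all add: s_def)
  have 1: "germ False D unit_circle (inv_into (points unit_circle) glue) r p'"
    using glue_germs_left(2)[OF p'(1)] p'(2) p(2) by simp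
  have 2: "germ False unit_circle unit_circle (\<rho> t) p' s"
    using left_germs[OF p'(1)] p'(2) by (simp add: s_def)
  have 3: "germ False unit_circle D glue s (glue (\<rho> t p))" using glue_germs_left(1)[OF s(1)] s(2) by simp
  have "germ False D D (reglued t) r (glue (\<rho> t p))"
    by (rule germ_cong[OF germ_compose[OF germ_compose[OF 1 2] 3]]) (rule reglued_eq)
  then show ?thesis using reglued_eq[OF r] by (simp add: p_def)
qed

lemma reglued_add: "r \<in> points D \<Longrightarrow> reglued (s + t) r = reglued s (reglued t r)"
  using continuous_hom_add[OF hom] glue_inv \<rho>_in reglued_glue by (simp add: reglued_eq[of r])

lemma reglued_0: "r \<in> points D \<Longrightarrow> reglued 0 r = r"
  using continuous_hom_0[OF hom] glue_inv by (simp add: reglued_eq)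

lemma reglued_inverse: "r \<in> points D \<Longrightarrow> reglued (- t) (reglued t r) = r" "r \<in> points D \<Longrightarrow> reglued t (reglued (- t) r) = r"
  using reglued_add[of r "- t" t] reglued_add[of r t "- t"] reglued_0 by simp_all

lemma bij_conj: "bij_betw (reglued t) (points D) (points D)"
  by (rule bij_betw_byWitness[where f' = "reglued (- t)"]) (use reglued_inverse reglued_in in auto)

lemma inv_into_conj: "r \<in> points D \<Longrightarrow> inv_into (points D) (reglued t) r = reglued (- t) r"
  using bij_conj[of t] reglued_inverse reglued_in by (intro inv_into_f_eq) (auto simp: bij_betw_def)

lemma reglued_right_PAC: "right_PAC D (reglued t)" "continuous_map (dom_top D) (dom_top D) (reglued t)"
  using germs_imp_right_PAC[OF D bij_conj reglued_germ_right reglued_germ_left] by blast+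

lemma conj_PAC: "reglued t \<in> PAC D"
proof -
  have "right_PAC D (inv_into (points D) (reglued t))"
  proof (rule germs_imp_right_PAC(1)[OF D bij_betw_inv_into[OF bij_conj]])
    fix r assume r: "r \<in> points D"
    show "germ True D D (inv_into (points D) (reglued t)) r (inv_into (points D) (reglued t) r)"
      unfolding inv_into_conj[OF r]
      by (rule germ_cong[OF reglued_germ_right[OF r]]) (rule inv_into_conj)
    show "germ False D D (inv_into (points D) (reglued t)) r (inv_into (points D) (reglued t) r)"
      unfolding inv_into_conj[OF r]
      by (rule germ_cong[OF reglued_germ_left[OF r]]) (rule inv_into_conj)
  qed
  moreover have "reglued t \<in> extensional (points D)" by (simp add: reglued_def)
  ultimately show ?thesis
    unfolding PAC_def Bij_def using bij_conj reglued_right_PAC(1) by blast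
qed

lemma reglued_hom: "reglued \<in> hom real_group (PAC_group D)"
proof -
  have "reglued (s + t) = compose (points D) (reglued s) (reglued t)" for s t
  proof (rule extensionalityI[of _ "points D"])
    show "reglued (s + t) \<in> extensional (points D)" by (simp add: reglued_def)
    show "compose (points D) (reglued s) (reglued t) \<in> extensional (points D)" by (rule compose_extensional)
    show "reglued (s + t) r = compose (points D) (reglued s) (reglued t) r" if "r \<in> points D" for r
      using reglued_add[OF that] that by (simp add: compose_eq)
  qed
  then show ?thesis
    using conj_PAC PAC_in_Bij[OF conj_PAC]
    by (auto simp: hom_def real_group_def PAC_group_def BijGroup_def)
qed

text \<open>It suffices to find, for each sequence of parameters, a subsequence along which the integrals
  tend to \<open>0\<close>. Almost everywhere convergence on the unit circle is preserved by \<open>glue\<close> except at the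
  finitely many points that \<open>\<rho> t\<close> sends to discontinuities, and is carried to the new domain segment
  by segment, since translations preserve null sets.\<close>

lemma reglued_integral_tendsto:
  "((\<lambda>s. dom_integral D (\<lambda>r. dom_dist D (reglued s r) (reglued t r))) \<longlongrightarrow> 0) (at t)"
proof -
  define I where "I s = dom_integral D (\<lambda>r. dom_dist D (reglued s r) (reglued t r))" for s
  have I_nn: "0 \<le> I s" for s unfolding I_def by (rule dom_integral_nonneg) (rule dom_dist_nonneg[OF D])
  have rc: "right_continuous D D (reglued s)" for s by (rule right_PAC_right_continuous[OF reglued_right_PAC(1)])
  have sub: "\<exists>r::nat \<Rightarrow> nat. (\<lambda>n. I (Y (r n))) \<longlonglongrightarrow> 0" if Y: "\<And>n. Y n \<noteq> t" "Y \<longlonglongrightarrow> t" for Y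
  proof -
    obtain r where r: "AE z in lborel. 0 \<le> z \<and> z < 1 \<longrightarrow>
      (\<lambda>n. dom_dist unit_circle (\<rho> (Y (r n)) (cproj z)) (\<rho> t (cproj z))) \<longlonglongrightarrow> 0"
      using AE_convergent_subsequence[OF hom, of Y t] Y by blast
    define Bad where "Bad = {z \<in> {0..<1}. \<sigma> (\<rho> t (cproj z)) \<noteq> \<rho> t (cproj z)}"
    have inj\<rho>: "inj_on (\<rho> t) (points unit_circle)" using continuous_hom_bij[OF hom] by (simp add: bij_betw_def)
    have "finite Bad"
    proof (rule finite_imageD)
      show "finite ((\<lambda>z. \<rho> t (cproj z)) ` Bad)"
        by (rule finite_subset[OF _ finite_support]) (use \<rho>_in[OF cproj_in] in \<open>auto simp: Bad_def\<close>)
      show "inj_on (\<lambda>z. \<rho> t (cproj z)) Bad"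
      proof (rule inj_onI)
        fix z z' assume z: "z \<in> Bad" "z' \<in> Bad" "\<rho> t (cproj z) = \<rho> t (cproj z')"
        then have "cproj z = cproj z'" using inj\<rho> cproj_in by (meson inj_onD)
        then show "z = z'" using z by (intro dom_proj_near_imp_eq[of unit_circle 0]) (auto simp: Bad_def)
      qed
    qed
    then have "Bad \<in> null_sets lborel" by (rule finite_imp_null_set_lborel)
    then have "AE z in lborel. z \<notin> Bad" by (rule AE_not_in)
    with r have conv: "AE z in lborel. 0 \<le> z \<and> z < 1 \<longrightarrow>
      (\<lambda>n. dom_dist D (glue (\<rho> (Y (r n)) (cproj z))) (glue (\<rho> t (cproj z)))) \<longlonglongrightarrow> 0"
    proof eventually_elim
      case (elim z)
      show ?case
      proof
        assume z: "0 \<le> z \<and> z < 1"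
        define w where "w = \<rho> t (cproj z)"
        have w: "w \<in> points unit_circle" "\<sigma> w = w" using elim(2) z \<rho>_in by (auto simp: Bad_def w_def)
        note cont = glue_continuous_at[OF w, unfolded topcontinuous_at_iff[OF is_domain_unit_circle D]]
        show "(\<lambda>n. dom_dist D (glue (\<rho> (Y (r n)) (cproj z))) (glue (\<rho> t (cproj z)))) \<longlonglongrightarrow> 0"
          unfolding w_def[symmetric]
        proof (rule LIMSEQ_I)
          fix e :: real assume "0 < e"
          then obtain d where d: "0 < d" "\<And>x. x \<in> points unit_circle \<Longrightarrow> dom_dist unit_circle w x < d \<Longrightarrow>
            dom_dist D (glue w) (glue x) < e" using cont by blast
          have "(\<lambda>n. dom_dist unit_circle (\<rho> (Y (r n)) (cproj z)) w) \<longlonglongrightarrow> 0" using elim(1) z by (simp add: w_def)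
          then obtain N where N: "\<And>n. N \<le> n \<Longrightarrow> norm (dom_dist unit_circle (\<rho> (Y (r n)) (cproj z)) w - 0) < d"
            using LIMSEQ_D[OF _ d(1)] by blast
          show "\<exists>N. \<forall>n\<ge>N. norm (dom_dist D (glue (\<rho> (Y (r n)) (cproj z))) (glue w) - 0) < e"
          proof (intro exI[of _ N] allI impI)
            fix n assume "N \<le> n"
            then have "dom_dist unit_circle w (\<rho> (Y (r n)) (cproj z)) < d"
              using N[of n] dom_dist_commute[OF is_domain_unit_circle, of w] by simp
            then have "dom_dist D (glue w) (glue (\<rho> (Y (r n)) (cproj z))) < e"
              using \<rho>_in[OF cproj_in] by (intro d(2))
            then show "norm (dom_dist D (glue (\<rho> (Y (r n)) (cproj z))) (glue w) - 0) < e"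
              using dom_dist_commute[OF D, of "glue w"] dom_dist_nonneg[OF D] by simp
          qed
        qed
      qed
    qed
    have "(\<lambda>n. dom_integral D (\<lambda>p. dom_dist D (reglued (Y (r n)) p) (reglued t p))) \<longlonglongrightarrow> 0"
    proof (rule dom_integral_tendsto_0[OF D rc rc])
      fix i assume i: "i < length D"
      have "\<forall>x\<in>G. AE y in lborel. 0 \<le> y + (x - off x) \<and> y + (x - off x) < 1 \<longrightarrow>
        (\<lambda>n. dom_dist D (glue (\<rho> (Y (r n)) (cproj (y + (x - off x))))) (glue (\<rho> t (cproj (y + (x - off x)))))) \<longlonglongrightarrow> 0"
        using AE_lborel_shift[OF conv] by blast
      then have "AE y in lborel. \<forall>x\<in>G. 0 \<le> y + (x - off x) \<and> y + (x - off x) < 1 \<longrightarrow>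
        (\<lambda>n. dom_dist D (glue (\<rho> (Y (r n)) (cproj (y + (x - off x))))) (glue (\<rho> t (cproj (y + (x - off x)))))) \<longlonglongrightarrow> 0"
        by (simp add: AE_finite_all[OF finite])
      then show "AE y in lborel. 0 \<le> y \<and> y < D ! i \<longrightarrow>
        (\<lambda>n. dom_dist D (reglued (Y (r n)) (dom_proj D i y)) (reglued t (dom_proj D i y))) \<longlonglongrightarrow> 0"
      proof eventually_elim
        case (elim y)
        show ?case
        proof
          assume y: "0 \<le> y \<and> y < D ! i"
          then obtain x where x: "x \<in> G" "q x = i" "off x \<le> y" "y < off x + (nxt x - x)"
            using tile(5)[OF i, of y] by blast
          define z where "z = y + (x - off x)"
          have z: "x \<le> z" "z < nxt x" using x by (simp_all add: z_def)
          then have z01: "0 \<le> z" "z < 1" using in_G[OF x(1)] nxt_le_1[of x] by linarith+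
          have "glue (cproj z) = dom_proj D i y" using glue_cproj[OF x(1) z] x(2) by (simp add: z_def)
          then have "reglued s (dom_proj D i y) = glue (\<rho> s (cproj z))" for s
            using reglued_glue[OF cproj_in, of s z] by simp
          then show "(\<lambda>n. dom_dist D (reglued (Y (r n)) (dom_proj D i y)) (reglued t (dom_proj D i y))) \<longlonglongrightarrow> 0"
            using elim x(1) z01 by (simp add: z_def)
        qed
      qed
    qed
    then show ?thesis unfolding I_def by blast
  qed
  have "(I \<longlongrightarrow> 0) (at t)"
    unfolding tendsto_at_iff_sequentially
  proof (intro allI impI)
    fix X :: "nat \<Rightarrow> real" assume X: "\<forall>i. X i \<in> UNIV - {t}" "X \<longlonglongrightarrow> t"
    show "(I \<circ> X) \<longlonglongrightarrow> 0"
    proof (rule ccontr)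
      assume "\<not> (I \<circ> X) \<longlonglongrightarrow> 0"
      then obtain e where e: "0 < e" "\<And>N. \<exists>n\<ge>N. e \<le> I (X n)"
        using I_nn by (auto simp: lim_sequentially dist_real_def not_less)
      then have "infinite {n. e \<le> I (X n)}" by (auto simp: infinite_nat_iff_unbounded_le)
      then obtain m :: "nat \<Rightarrow> nat" where m: "strict_mono m" "\<And>n. e \<le> I (X (m n))"
        using infinite_enumerate[of "{n. e \<le> I (X n)}"] by blast
      have "(\<lambda>n. X (m n)) \<longlonglongrightarrow> t" using LIMSEQ_subseq_LIMSEQ[OF X(2) m(1)] by (simp add: comp_def)
      then obtain r :: "nat \<Rightarrow> nat" where "(\<lambda>n. I (X (m (r n)))) \<longlonglongrightarrow> 0"
        using sub[of "\<lambda>n. X (m n)"] X(1) by blast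
      then have "e \<le> 0" by (rule LIMSEQ_le_const) (use m(2) in blast)
      then show False using e(1) by simp
    qed
  qed
  then show ?thesis unfolding I_def .
qed

text \<open>The inverses are the maps for the negative parameters, so the second integral of the distance is
  an instance of the first.\<close>

theorem reglued_continuous_hom: "continuous_hom D reglued"
proof -
  have "((\<lambda>s. PAC_dist D (reglued s) (reglued t)) \<longlongrightarrow> 0) (at t)" for t
  proof -
    have inv: "dom_integral D (\<lambda>p. dom_dist D (inv_into (points D) (reglued s) p) (inv_into (points D) (reglued t) p))
        = dom_integral D (\<lambda>p. dom_dist D (reglued (- s) p) (reglued (- t) p))" for s
      unfolding dom_integral_def by (intro sum.cong) (simp_all add: inv_into_conj)
    have "filterlim uminus (at (- t)) (at t)"
      by (auto simp: filterlim_at eventually_at_filter intro!: tendsto_intros)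
    then have "((\<lambda>s. dom_integral D (\<lambda>p. dom_dist D (reglued (- s) p) (reglued (- t) p))) \<longlongrightarrow> 0) (at t)"
      by (rule filterlim_compose[OF reglued_integral_tendsto])
    then have "((\<lambda>s. PAC_dist D (reglued s) (reglued t)) \<longlongrightarrow> 0 + 0) (at t)"
      unfolding PAC_dist_def inv by (intro tendsto_add reglued_integral_tendsto)
    then show ?thesis by simp
  qed
  then show ?thesis using reglued_hom by (simp add: continuous_hom_def)
qed

end

text \<open>The cut points are \<open>0\<close> and the points that \<open>\<sigma>\<close> moves. They are permuted by \<open>\<sigma>\<close>, and hence so
  are the segments between them.\<close>

lemma reglued_flow_exists:
  assumes h: "continuous_hom unit_circle \<rho>"
  obtains G \<sigma> D q off where "reglued_flow G \<sigma> D q off \<rho>"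
proof -
  obtain \<sigma> where \<sigma>: "bij_betw \<sigma> (points unit_circle) (points unit_circle)"
    "finite {p \<in> points unit_circle. \<sigma> p \<noteq> p}"
    "\<And>t p. p \<in> points unit_circle \<Longrightarrow>
      germ False unit_circle unit_circle (\<rho> t) p (inv_into (points unit_circle) \<sigma> (\<rho> t (\<sigma> p)))"
    using regluing[OF h] by blast
  define G where "G = insert 0 (rep ` {p \<in> points unit_circle. \<sigma> p \<noteq> p})"
  interpret subdivision G
    by unfold_locales (use \<sigma>(2) points_rep in \<open>auto simp: G_def\<close>)
  have support: "\<sigma> (cproj z) = cproj z" if z: "0 \<le> z" "z < 1" "z \<notin> G" for z
  proof (rule ccontr)
    assume "\<sigma> (cproj z) \<noteq> cproj z"
    then have "rep (cproj z) \<in> G" unfolding G_def by simp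
    then show False using rep_cproj z by simp
  qed
  define s where "s x = rep (\<sigma> (cproj x))" for x
  have s_in: "\<sigma> (cproj x) \<in> points unit_circle" for x using bij_betwE[OF \<sigma>(1)] cproj_in by blast
  have inj: "inj_on s G"
  proof (rule inj_onI)
    fix x y assume xy: "x \<in> G" "y \<in> G" "s x = s y"
    then have "\<sigma> (cproj x) = \<sigma> (cproj y)" unfolding s_def using points_rep(1) s_in by metis
    then have "cproj x = cproj y" using \<sigma>(1) cproj_in by (meson bij_betw_imp_inj_on inj_onD)
    then show "x = y" using in_G[OF xy(1)] in_G[OF xy(2)] by (intro dom_proj_near_imp_eq[of unit_circle 0]) auto
  qed
  have "s ` G \<subseteq> G"
  proof (rule image_subsetI, rule ccontr)
    fix x assume x: "x \<in> G" "s x \<notin> G"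
    have "cproj (s x) = \<sigma> (cproj x)" "0 \<le> s x" "s x < 1" using points_rep[OF s_in] by (simp_all add: s_def)
    then have "\<sigma> (\<sigma> (cproj x)) = \<sigma> (cproj x)" using support[of "s x"] x(2) by simp
    then have "\<sigma> (cproj x) = cproj x" using \<sigma>(1) s_in cproj_in by (meson bij_betw_imp_inj_on inj_onD)
    then have "s x = x" unfolding s_def using rep_cproj in_G[OF x(1)] by simp
    then show False using x by simp
  qed
  then have "bij_betw s G G" using inj endo_inj_surj[OF finite] by (simp add: bij_betw_def)
  then have "bij_betw (\<lambda>x. s (cyclic_nxt x)) G G"
    using bij_betw_trans[OF bij_betw_cyclic_nxt] by (simp add: comp_def)
  moreover have "0 < nxt x - x" if "x \<in> G" for x using nxt_greater in_G[OF that] by simp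
  ultimately obtain D q off where "tiles G (\<lambda>x. s (cyclic_nxt x)) (\<lambda>x. nxt x - x) D q off"
    using tiles_exist[OF finite, of _ "\<lambda>x. nxt x - x"] by blast
  then have "reglued_flow G \<sigma> D q off \<rho>"
    by unfold_locales (use \<sigma> support h in \<open>simp_all add: s_def\<close>)
  then show ?thesis by (rule that)
qed

theorem theorem1p6:
  fixes \<rho> :: "real \<Rightarrow> point \<Rightarrow> point"
  assumes "continuous_hom unit_circle \<rho>"
  shows "\<exists>D f. is_domain D \<and> f \<in> IET unit_circle D \<and>
    (let \<rho>' = (\<lambda>t. restrict (f \<circ> \<rho> t \<circ> inv_into (points unit_circle) f) (points D))
     in continuous_hom D \<rho>' \<and>
        (\<forall>t. continuous_map (dom_top D) (dom_top D) (\<rho>' t)))"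
proof -
  obtain G \<sigma> D q off where "reglued_flow G \<sigma> D q off \<rho>" using reglued_flow_exists[OF assms] by blast
  then interpret reglued_flow G \<sigma> D q off \<rho> .
  have eq: "reglued = (\<lambda>t. restrict (glue \<circ> \<rho> t \<circ> inv_into (points unit_circle) glue) (points D))"
    by (simp add: reglued_def fun_eq_iff)
  show ?thesis
    using D glue_IET reglued_continuous_hom reglued_right_PAC(2)
    by (intro exI[of _ D] exI[of _ glue]) (simp add: eq Let_def)
qed

end
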